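(* The optimal value $p^\star$ of the infinite-dimensional linear program (LP) defined in the context satisfies $$p^\star\ \ge\ \int_X V(x)\,dx,$$ where $V$ is the value function of the optimal control problem defined in the context.
   Context: **Setting.** Let $f, f_{u_1},\dots,f_{u_m}\in\mathbb{R}[x]^n$ (polynomial vector fields on $\mathbb{R}^n$), and consider the controlled system $$\dot x(t) = f(x(t))+\sum_{i=1}^m f_{u_i}(x(t))u_i(t).$$ Let $X=\{x\in\mathbb{R}^n : g_i(x)\ge 0,\ i=1,\dots,n_g\}$ with $g_i\in\mathbb{R}[x]$, and $U=[0,\bar u]^m$ with $\bar u\ge 0$. $X$ is compact, one of the inequalities $g_i\ge 0$ is $N-\|x\|^2\ge 0$ for some $N\ge 0$, and $\bar g(x):=\prod_{i=1}^{n_g}g_i(x)>0$ for all $x$ in the interior $X^\circ$. Let $\beta>0$, let $l_x,l_{u_1},\dots,l_{u_m}\in\mathbb{R}[x]$ be such that $l(x,u):=l_x(x)+\sum_{i=1}^m l_{u_i}(x)u_i\ge 0$ on $X\times U$, and let $M>\beta^{-1}\sup_{x\in X,u\in U} l(x,u)$. $L(X;Y)$ denotes the Lebesgue measurable functions $X\to Y$. **Optimal control problem (OCP).** For $x_0\in X$, $$V(x_0):=\inf \int_0^{\tau(x_0)}e^{-\beta t}\Big[l_x(x(t))+\sum_{i=1}^m l_{u_i}(x(t))u_i(t)\Big]dt+e^{-\beta\tau(x_0)}M,$$ the infimum being over $u\in L^\infty([0,\tau(x_0)];U)$ and stopping functions $\tau\in L(X;[0,\infty])$ such that the solution $x(\cdot)$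 of the system with $x(0)=x_0$ satisfies $x(t)\in X$ for all $t\in[0,\tau(x_0)]$ (with $e^{-\beta\cdot\infty}=0$). **Linear program (LP).** Minimize over $(\rho,\rho_0,\rho_T,\sigma)\in C^1(X)\times C(X)\times C(X)\times C^1(X)^m$, $\sigma=(\sigma_1,\dots,\sigma_m)$, $$\int_X l_x\rho\,dx+\sum_{i=1}^m\int_X l_{u_i}\sigma_i\,dx+M\int_X\rho_T\,dx$$ subject to - $\rho_T-\rho_0+\beta\rho+\mathrm{div}(\rho f)+\sum_{i=1}^m\mathrm{div}(\sigma_if_{u_i})=0$; - $\rho\le0$ on $\partial X$; - $\rho_0\ge1$ on $X$; - $\bar u\rho\ge\sigma_i$ on $X$, $i=1,\dots,m$; - $\rho_T\ge0$ on $X$; - $\sigma_i\ge0$ on $X$, $i=1,\dots,m$. $p^\star$ denotes the infimum.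
   Formalization: The claim is proved for ū > 0 and m ≥ 1; for ū = 0 (or m = 0) the LP does not force ρ ≥ 0 and the inequality fails, e.g. on the unit ball with f(x) = −kx, kn > β, l_x = 1, where a negative constant ρ is feasible. *)

theory Defs
  imports "HOL-Analysis.Analysis"
begin

definition semialg_set :: "nat \<Rightarrow> (nat \<Rightarrow> 'a \<Rightarrow> real) \<Rightarrow> 'a set" where
  "semialg_set ng g = {x. \<forall>i\<in>{1..ng}. g i x \<ge> 0}"

definition control_set :: "real \<Rightarrow> (real ^ 'm) set" where
  "control_set ubar = {u. \<forall>i. 0 \<le> u $ i \<and> u $ i \<le> ubar}"

definition controlled_field ::
  "(real ^ 'n \<Rightarrow> real ^ 'n) \<Rightarrow> ('m::finite \<Rightarrow> real ^ 'n \<Rightarrow> real ^ 'n) \<Rightarrow>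
    real ^ 'n \<Rightarrow> real ^ 'm \<Rightarrow> real ^ 'n" where
  "controlled_field f fu x u = f x + (\<Sum>i\<in>UNIV. u $ i *\<^sub>R fu i x)"

definition stage_cost ::
  "(real ^ 'n \<Rightarrow> real) \<Rightarrow> ('m::finite \<Rightarrow> real ^ 'n \<Rightarrow> real) \<Rightarrow>
    real ^ 'n \<Rightarrow> real ^ 'm \<Rightarrow> real" where
  "stage_cost lx lu x u = lx x + (\<Sum>i\<in>UNIV. lu i x * u $ i)"

text \<open>The time interval \<open>[0, T]\<close>, to be read as \<open>[0, \<infinity>)\<close> for \<open>T = \<infinity>\<close>.\<close>

definition horizon :: "ennreal \<Rightarrow> real set" where
  "horizon T = {t. 0 \<le> t \<and> ennreal t \<le> T}"

definition discount :: "real \<Rightarrow> ennreal \<Rightarrow> real" where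
  "discount \<beta> T = (if T = \<infinity> then 0 else exp (- \<beta> * enn2real T))"

text \<open>
  Solutions of the differential equation are understood in the sense of Caratheodory, i.e. as
  solutions of the integral equation. Continuity of the trajectory is implied. The gauge
  integral of the library agrees with the Lebesgue integral here, because the integrand is
  measurable and, for trajectories in a compact set and bounded controls, bounded.
\<close>

definition is_solution ::
  "(real ^ 'n \<Rightarrow> real ^ 'n) \<Rightarrow> ('m::finite \<Rightarrow> real ^ 'n \<Rightarrow> real ^ 'n) \<Rightarrow>
    ennreal \<Rightarrow> real ^ 'n \<Rightarrow> (real \<Rightarrow> real ^ 'm) \<Rightarrow> (real \<Rightarrow> real ^ 'n) \<Rightarrow> bool" where
  "is_solution f fu T x0 u x \<longleftrightarrow>
    (\<forall>t\<in>horizon T.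
      ((\<lambda>s. controlled_field f fu (x s) (u s)) has_integral (x t - x0)) {0..t})"

text \<open>
  Every class in \<open>L\<^sup>\<infinity>([0, T]; U)\<close> has a measurable representative with values in the bounded
  set \<open>U\<close> at all times, so the pointwise condition on controls is no restriction. The stopping
  time is a measurable function on \<open>X\<close>, evaluated at the initial state.
\<close>

definition admissible ::
  "(real ^ 'n \<Rightarrow> real ^ 'n) \<Rightarrow> ('m::finite \<Rightarrow> real ^ 'n \<Rightarrow> real ^ 'n) \<Rightarrow>
    (real ^ 'n) set \<Rightarrow> (real ^ 'm) set \<Rightarrow> real ^ 'n \<Rightarrow>
    (real ^ 'n \<Rightarrow> ennreal) \<Rightarrow> (real \<Rightarrow> real ^ 'm) \<Rightarrow> (real \<Rightarrow> real ^ 'n) \<Rightarrow> bool" where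
  "admissible f fu X U x0 \<tau> u x \<longleftrightarrow>
    \<tau> \<in> borel_measurable (lebesgue_on X) \<and>
    u \<in> borel_measurable (lebesgue_on (horizon (\<tau> x0))) \<and>
    (\<forall>t\<in>horizon (\<tau> x0). u t \<in> U) \<and>
    is_solution f fu (\<tau> x0) x0 u x \<and>
    (\<forall>t\<in>horizon (\<tau> x0). x t \<in> X)"

definition ocp_cost ::
  "(real ^ 'n \<Rightarrow> real) \<Rightarrow> ('m::finite \<Rightarrow> real ^ 'n \<Rightarrow> real) \<Rightarrow> real \<Rightarrow> real \<Rightarrow>
    ennreal \<Rightarrow> (real \<Rightarrow> real ^ 'm) \<Rightarrow> (real \<Rightarrow> real ^ 'n) \<Rightarrow> real" where
  "ocp_cost lx lu \<beta> M T u x =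
    (LINT t:horizon T|lebesgue. exp (- \<beta> * t) * stage_cost lx lu (x t) (u t))
      + discount \<beta> T * M"

text \<open>
  For \<open>x0 \<in> X\<close> the infimum is over a nonempty set (stopping at once is admissible, with cost
  \<open>M\<close>), which is bounded below by \<open>0\<close> when the stage cost is nonnegative on \<open>X \<times> U\<close> and
  \<open>M \<ge> 0\<close>.
\<close>

definition value_function ::
  "(real ^ 'n \<Rightarrow> real ^ 'n) \<Rightarrow> ('m::finite \<Rightarrow> real ^ 'n \<Rightarrow> real ^ 'n) \<Rightarrow>
    (real ^ 'n \<Rightarrow> real) \<Rightarrow> ('m \<Rightarrow> real ^ 'n \<Rightarrow> real) \<Rightarrow>
    (real ^ 'n) set \<Rightarrow> (real ^ 'm) set \<Rightarrow> real \<Rightarrow> real \<Rightarrow> real ^ 'n \<Rightarrow> real" where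
  "value_function f fu lx lu X U \<beta> M x0 =
    Inf {ocp_cost lx lu \<beta> M (\<tau> x0) u x | \<tau> u x. admissible f fu X U x0 \<tau> u x}"

text \<open>
  \<open>C\<^sup>1(X)\<close> for closed \<open>X\<close>: continuous on \<open>X\<close>, differentiable in the interior, with a gradient
  that extends continuously to \<open>X\<close>. Every function that is \<open>C\<^sup>1\<close> on a neighbourhood of \<open>X\<close>
  belongs to this class.
\<close>

definition C1_on :: "'a::euclidean_space set \<Rightarrow> ('a \<Rightarrow> real) \<Rightarrow> bool" where
  "C1_on X \<rho> \<longleftrightarrow> continuous_on X \<rho> \<and>
    (\<exists>G. continuous_on X G \<and> (\<forall>x\<in>interior X. GDERIV \<rho> x :> G x))"

definition divergence :: "('a::euclidean_space \<Rightarrow> 'a) \<Rightarrow> 'a \<Rightarrow> real" where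
  "divergence F x = (\<Sum>b\<in>Basis. frechet_derivative F (at x) b \<bullet> b)"

text \<open>
  The continuity equation is required in the interior of \<open>X\<close>, where the derivatives are
  determined by the values on \<open>X\<close>; by continuity it then holds on the closure of the interior
  for the continuous extensions of the derivatives.
\<close>

definition lp_feasible ::
  "(real ^ 'n \<Rightarrow> real ^ 'n) \<Rightarrow> ('m::finite \<Rightarrow> real ^ 'n \<Rightarrow> real ^ 'n) \<Rightarrow>
    (real ^ 'n) set \<Rightarrow> real \<Rightarrow> real \<Rightarrow>
    (real ^ 'n \<Rightarrow> real) \<Rightarrow> (real ^ 'n \<Rightarrow> real) \<Rightarrow> (real ^ 'n \<Rightarrow> real) \<Rightarrow>
    ('m \<Rightarrow> real ^ 'n \<Rightarrow> real) \<Rightarrow> bool" where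
  "lp_feasible f fu X ubar \<beta> \<rho> \<rho>0 \<rho>T \<sigma> \<longleftrightarrow>
    C1_on X \<rho> \<and> continuous_on X \<rho>0 \<and> continuous_on X \<rho>T \<and> (\<forall>i. C1_on X (\<sigma> i)) \<and>
    (\<forall>x\<in>interior X.
      \<rho>T x - \<rho>0 x + \<beta> * \<rho> x + divergence (\<lambda>y. \<rho> y *\<^sub>R f y) x
        + (\<Sum>i\<in>UNIV. divergence (\<lambda>y. \<sigma> i y *\<^sub>R fu i y) x) = 0) \<and>
    (\<forall>x\<in>frontier X. \<rho> x \<le> 0) \<and>
    (\<forall>x\<in>X. \<rho>0 x \<ge> 1) \<and>
    (\<forall>x\<in>X. \<forall>i. ubar * \<rho> x \<ge> \<sigma> i x) \<and>
    (\<forall>x\<in>X. \<rho>T x \<ge> 0) \<and>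
    (\<forall>x\<in>X. \<forall>i. \<sigma> i x \<ge> 0)"

definition lp_objective ::
  "(real ^ 'n \<Rightarrow> real) \<Rightarrow> ('m::finite \<Rightarrow> real ^ 'n \<Rightarrow> real) \<Rightarrow>
    (real ^ 'n) set \<Rightarrow> real \<Rightarrow>
    (real ^ 'n \<Rightarrow> real) \<Rightarrow> (real ^ 'n \<Rightarrow> real) \<Rightarrow>
    ('m \<Rightarrow> real ^ 'n \<Rightarrow> real) \<Rightarrow> real" where
  "lp_objective lx lu X M \<rho> \<rho>T \<sigma> =
    (LINT x:X|lebesgue. lx x * \<rho> x)
      + (\<Sum>i\<in>UNIV. LINT x:X|lebesgue. lu i x * \<sigma> i x)
      + M * (LINT x:X|lebesgue. \<rho>T x)"

definition lp_value ::
  "(real ^ 'n \<Rightarrow> real ^ 'n) \<Rightarrow> ('m::finite \<Rightarrow> real ^ 'n \<Rightarrow> real ^ 'n) \<Rightarrow>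
    (real ^ 'n \<Rightarrow> real) \<Rightarrow> ('m \<Rightarrow> real ^ 'n \<Rightarrow> real) \<Rightarrow>
    (real ^ 'n) set \<Rightarrow> real \<Rightarrow> real \<Rightarrow> real \<Rightarrow> ereal" where
  "lp_value f fu lx lu X ubar \<beta> M =
    Inf {ereal (lp_objective lx lu X M \<rho> \<rho>T \<sigma>) | \<rho> \<rho>0 \<rho>T \<sigma>.
      lp_feasible f fu X ubar \<beta> \<rho> \<rho>0 \<rho>T \<sigma>}"

end

theory Submission
  imports Defs
begin

text \<open>
  For a feasible point, \<open>0 \<le> \<sigma> i \<le> ubar * \<rho>\<close> and \<open>\<rho> \<le> 0\<close> on the boundary force \<open>\<rho>\<close> and \<open>\<sigma>\<close> to
  vanish on the boundary, so their extensions by zero are Lipschitz. Let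
  \<open>F = \<rho> f + (\<Sum>i. \<sigma> i fu i)\<close>. Using the feedback \<open>\<sigma> i / \<rho>\<close>, frozen at \<open>x\<close>, for the time \<open>h \<rho> x\<close>
  moves the state from \<open>x\<close> to \<open>x + h F x\<close> up to an error of order \<open>h\<^sup>2\<close>, at the cost
  \<open>h * (lx \<rho> + (\<Sum>i. lu i \<sigma> i)) x\<close>, and the trajectory stays in the set where \<open>\<rho>\<close> is positive. The
  time change by \<open>\<rho>\<close> thus removes the singularity of the feedback. Stopping with probability
  \<open>h \<rho>T x\<close> in each step gives an upper bound for the value function. The integrals of the
  resulting iterates are controlled by a change of variables along the Euler map \<open>x + h F x\<close>,
  because the continuity equation reads \<open>div F = \<rho>0 - \<rho>T - \<beta> \<rho>\<close> with \<open>\<rho>0 \<ge> 1\<close>. No flow, no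
  regularity and no measurability of the value function is needed.
\<close>

section \<open>Volume distortion of the Euler map\<close>

text \<open>A direct argument would follow trajectories of the feedback
  \<open>\<sigma> i / \<rho>\<close>, or test \<open>V\<close> against the continuity equation. The
  feedback is singular where \<open>\<rho>\<close> vanishes, and under state constraints
  \<open>V\<close> may be discontinuous. Everything is therefore done at a fixed step
  \<open>h\<close>, with Lipschitz majorants \<open>w\<close> in place of \<open>V\<close>: each
  step commits an error of order \<open>h\<^sup>2\<close>, and of the order of \<open>1 / h\<close>
  steps are made. The lower bound on \<open>M\<close> makes the constant \<open>M\<close> a
  supersolution; it is the first majorant and keeps the later ones below \<open>M + 1\<close>. The
  Lipschitz constants of the majorants grow geometrically, hence stay bounded over a fixed time
  range. Since \<open>\<rho>T\<close> is merely continuous, a polynomial slightly above it takes its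
  place, which keeps the majorants Lipschitz. The polynomial description of \<open>X\<close> makes
  its boundary a null set, so integrals over \<open>X\<close> and over its interior agree. Stopping
  with a probability stands for a convex combination of two upper bounds of \<open>V\<close>; no
  randomised strategy is constructed.\<close>

lemma prod_one_plus_linear:
  fixes L :: real
  assumes "finite S" "L \<ge> 0"
  shows "\<exists>C\<ge>0. \<forall>(a::'i \<Rightarrow> real) h. (\<forall>i\<in>S. \<bar>a i\<bar> \<le> L) \<longrightarrow> 0 \<le> h \<longrightarrow> h \<le> 1 \<longrightarrow>
    \<bar>(\<Prod>i\<in>S. 1 + h * a i) - (1 + h * (\<Sum>i\<in>S. a i))\<bar> \<le> C * h\<^sup>2"
  using assms(1)
proof (induction S rule: finite_induct)
  case empty
  show ?case by (intro exI[of _ 0]) auto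
next
  case (insert j S)
  then obtain C where C: "C \<ge> 0" "\<And>(a::'i \<Rightarrow> real) h. (\<forall>i\<in>S. \<bar>a i\<bar> \<le> L) \<Longrightarrow> 0 \<le> h \<Longrightarrow> h \<le> 1 \<Longrightarrow>
    \<bar>(\<Prod>i\<in>S. 1 + h * a i) - (1 + h * (\<Sum>i\<in>S. a i))\<bar> \<le> C * h\<^sup>2" by blast
  show ?case
  \<comment> \<open>Peeling off the factor for \<open>j\<close> leaves \<open>1 + h * a j\<close>
    times the old remainder plus \<open>h\<^sup>2 * (a j * ?s)\<close>; the two summands of the
    constant bound these two terms.\<close>
  proof (intro exI[of _ "(1 + L) * C + L * (card S * L)"] conjI allI impI)
    show "0 \<le> (1 + L) * C + L * (card S * L)" using C(1) assms by simp
    fix a :: "'i \<Rightarrow> real" and h :: real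
    assume a: "\<forall>i\<in>insert j S. \<bar>a i\<bar> \<le> L" and h: "0 \<le> h" "h \<le> 1"
    let ?P = "\<Prod>i\<in>S. 1 + h * a i" and ?s = "\<Sum>i\<in>S. a i"
    have s: "\<bar>?s\<bar> \<le> card S * L"
      using a by (intro order_trans[OF sum_abs] sum_bounded_above) auto
    have "\<bar>h * a j\<bar> \<le> 1 * L"
      unfolding abs_mult using a h by (intro mult_mono) auto
    then have "\<bar>1 + h * a j\<bar> \<le> 1 + L" by linarith
    then have 1: "\<bar>(1 + h * a j) * (?P - (1 + h * ?s))\<bar> \<le> (1 + L) * (C * h\<^sup>2)"
      unfolding abs_mult using C a h assms by (intro mult_mono) auto
    have "\<bar>a j * ?s\<bar> \<le> L * (card S * L)"
      unfolding abs_mult using a s assms by (intro mult_mono) auto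
    then have "h\<^sup>2 * \<bar>a j * ?s\<bar> \<le> h\<^sup>2 * (L * (card S * L))"
      by (rule mult_left_mono) simp
    then have 2: "\<bar>h\<^sup>2 * (a j * ?s)\<bar> \<le> h\<^sup>2 * (L * (card S * L))"
      by (simp add: abs_mult)
    have "(\<Prod>i\<in>insert j S. 1 + h * a i) - (1 + h * (\<Sum>i\<in>insert j S. a i)) =
      (1 + h * a j) * (?P - (1 + h * ?s)) + h\<^sup>2 * (a j * ?s)"
      using insert.hyps by (simp add: algebra_simps power2_eq_square)
    then have "\<bar>(\<Prod>i\<in>insert j S. 1 + h * a i) - (1 + h * (\<Sum>i\<in>insert j S. a i))\<bar>
      \<le> \<bar>(1 + h * a j) * (?P - (1 + h * ?s))\<bar> + \<bar>h\<^sup>2 * (a j * ?s)\<bar>"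
      by linarith
    then show "\<bar>(\<Prod>i\<in>insert j S. 1 + h * a i) - (1 + h * (\<Sum>i\<in>insert j S. a i))\<bar>
      \<le> ((1 + L) * C + L * (card S * L)) * h\<^sup>2"
      using 1 2 by (simp add: algebra_simps)
  qed
qed

text \<open>In the Leibniz formula the identity permutation contributes the diagonal product, which
  is \<open>1 + h * trace A\<close> to first order. Every other permutation moves at least two
  indices, so its term has two off-diagonal factors of size at most \<open>h * L\<close>. The
  constant is uniform in \<open>A\<close> because the bound is applied to the Jacobian at every
  point.\<close>

lemma det_one_plus_lower_bound:
  fixes L :: real
  assumes L: "L \<ge> 0"
  shows "\<exists>C\<ge>0. \<forall>(A::real^'n^'n) h. (\<forall>i j. \<bar>A $ i $ j\<bar> \<le> L) \<longrightarrow> 0 \<le> h \<longrightarrow> h \<le> 1 \<longrightarrow>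
    1 + h * trace A - C * h\<^sup>2 \<le> det (mat 1 + h *\<^sub>R A)"
proof -
  obtain C0 where C0: "C0 \<ge> 0" "\<And>(a::'n \<Rightarrow> real) h. (\<forall>i\<in>UNIV. \<bar>a i\<bar> \<le> L) \<Longrightarrow> 0 \<le> h \<Longrightarrow> h \<le> 1 \<Longrightarrow>
    \<bar>(\<Prod>i\<in>UNIV. 1 + h * a i) - (1 + h * (\<Sum>i\<in>UNIV. a i))\<bar> \<le> C0 * h\<^sup>2"
    using prod_one_plus_linear[of "UNIV :: 'n set" L] L by auto
  let ?P = "{p. p permutes (UNIV :: 'n set)}"
  define D where "D = L\<^sup>2 * (1 + L) ^ CARD('n)"
  define C where "C = C0 + card (?P - {id}) * D"
  have D: "D \<ge> 0" using L by (simp add: D_def)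
  show ?thesis
  proof (intro exI[of _ C] conjI allI impI)
    show "C \<ge> 0" using C0 D by (simp add: C_def)
    fix A :: "real^'n^'n" and h :: real
    assume A: "\<forall>i j. \<bar>A $ i $ j\<bar> \<le> L" and h: "0 \<le> h" "h \<le> 1"
    let ?M = "mat 1 + h *\<^sub>R A"
    have hA: "\<bar>h * A $ i $ j\<bar> \<le> h * L" "h * L \<le> L" for i j
      using A h L by (auto simp: abs_mult intro: mult_left_mono mult_left_le_one_le)
    have M1: "\<bar>?M $ i $ j\<bar> \<le> 1 + L" for i j
      using hA(1)[where i = i and j = j] hA(2) L by (auto simp: mat_def)
    let ?t = "\<lambda>p. of_int (sign p) * (\<Prod>i\<in>UNIV. ?M $ i $ p i)"
    have off: "\<bar>?t p\<bar> \<le> D * h\<^sup>2" if p: "p \<in> ?P - {id}" for p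
    proof -
      \<comment> \<open>By injectivity the image \<open>j\<close> of a moved index \<open>i\<close>
        is moved as well, which gives the second off-diagonal factor.\<close>
      obtain i where i: "p i \<noteq> i" using p by (auto simp: fun_eq_iff)
      define j where "j = p i"
      have "inj p" using p by (auto intro: permutes_inj)
      then have j: "p j \<noteq> j" "j \<noteq> i" using i by (auto simp: j_def inj_eq)
      have "(\<Prod>k\<in>UNIV. ?M $ k $ p k) = ?M $ i $ p i * (?M $ j $ p j * (\<Prod>k\<in>UNIV - {i} - {j}. ?M $ k $ p k))"
        using j by (simp add: prod.remove[of UNIV i] prod.remove[of "UNIV - {i}" j])
      moreover have "\<bar>?M $ i $ p i\<bar> \<le> h * L" "\<bar>?M $ j $ p j\<bar> \<le> h * L"
        using i j hA by (auto simp: mat_def)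
      moreover have "\<bar>\<Prod>k\<in>UNIV - {i} - {j}. ?M $ k $ p k\<bar> \<le> (1 + L) ^ CARD('n)"
      proof -
        have "\<bar>\<Prod>k\<in>UNIV - {i} - {j}. ?M $ k $ p k\<bar> \<le> (\<Prod>k\<in>UNIV - {i} - {j}. 1 + L)"
          unfolding abs_prod using M1 by (intro prod_mono) auto
        also have "\<dots> \<le> (1 + L) ^ CARD('n)"
          unfolding prod_constant using L by (intro power_increasing card_mono) auto
        finally show ?thesis .
      qed
      ultimately have "\<bar>\<Prod>k\<in>UNIV. ?M $ k $ p k\<bar> \<le> (h * L) * ((h * L) * (1 + L) ^ CARD('n))"
        unfolding abs_mult using h L by (auto simp only: abs_mult intro!: mult_mono mult_nonneg_nonneg abs_ge_zero zero_le_power)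
      moreover have "\<bar>of_int (sign p) :: real\<bar> = 1" by (simp add: sign_def)
      ultimately show ?thesis
        by (simp add: abs_mult D_def power2_eq_square mult_ac)
    qed
    have "det ?M = ?t id + (\<Sum>p\<in>?P - {id}. ?t p)"
      unfolding det_def by (subst sum.remove[of _ id]) (auto simp: permutes_id)
    moreover have "\<bar>\<Sum>p\<in>?P - {id}. ?t p\<bar> \<le> card (?P - {id}) * (D * h\<^sup>2)"
      by (rule order_trans[OF sum_abs sum_bounded_above]) (use off in auto)
    moreover have "\<bar>?t id - (1 + h * trace A)\<bar> \<le> C0 * h\<^sup>2"
      using C0(2)[of "\<lambda>i. A $ i $ i" h] A h by (simp add: mat_def trace_def)
    ultimately show "1 + h * trace A - C * h\<^sup>2 \<le> det ?M"
      by (simp add: C_def algebra_simps abs_le_iff)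
  qed
qed

section \<open>Change of variables along the Euler map\<close>

lemma absolutely_integrable_bounded_continuous:
  fixes w :: "'a::euclidean_space \<Rightarrow> real"
  assumes "open Y" "bounded Y" "continuous_on Y w" "\<And>x. x \<in> Y \<Longrightarrow> \<bar>w x\<bar> \<le> B"
  shows "w absolutely_integrable_on Y"
proof (rule measurable_bounded_by_integrable_imp_absolutely_integrable)
  have "Y \<in> lmeasurable" using assms by (simp add: lmeasurable_open)
  then show "Y \<in> sets lebesgue" "(\<lambda>x. B) integrable_on Y"
    by (auto intro: integrable_on_const)
  then show "w \<in> borel_measurable (lebesgue_on Y)"
    using assms by (intro continuous_imp_measurable_on_sets_lebesgue)
qed (use assms in auto)

text \<open>The perturbation \<open>h *\<^sub>R F\<close> contracts by \<open>1/2\<close>, so the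
  map is injective and the fixed point of \<open>x \<mapsto> y - h *\<^sub>R F x\<close> is a
  preimage of \<open>y\<close>. Points outside \<open>Y\<close> stay put. A point of
  \<open>Y\<close> cannot land on one of them by injectivity, and for the same reason preimages of
  points of \<open>Y\<close> lie in \<open>Y\<close>.\<close>

lemma euler_map_bij_betw:
  fixes F :: "'a::euclidean_space \<Rightarrow> 'a"
  assumes lip: "\<And>x y. norm (F x - F y) \<le> L * norm (x - y)"
    and off: "\<And>x. x \<notin> Y \<Longrightarrow> F x = 0"
    and h: "0 \<le> h" "h * L \<le> 1/2" "0 \<le> L"
  shows "bij_betw (\<lambda>x. x + h *\<^sub>R F x) Y Y"
proof -
  let ?E = "\<lambda>x. x + h *\<^sub>R F x"
  have hF: "norm (h *\<^sub>R F x - h *\<^sub>R F y) \<le> 1/2 * norm (x - y)" for x y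
  proof -
    have "norm (h *\<^sub>R F x - h *\<^sub>R F y) = h * norm (F x - F y)"
      using h by (simp flip: scaleR_diff_right)
    also have "\<dots> \<le> h * (L * norm (x - y))"
      using lip h by (intro mult_left_mono) auto
    also have "\<dots> \<le> 1/2 * norm (x - y)"
      using h by (simp only: mult.assoc[symmetric]) (intro mult_right_mono, auto)
    finally show ?thesis .
  qed
  have inj: "x = y" if "?E x = ?E y" for x y
  proof -
    have "x - y = - (h *\<^sub>R F x - h *\<^sub>R F y)" using that by (simp add: algebra_simps)
    then have "norm (x - y) \<le> 1/2 * norm (x - y)" using hF[of x y] by (metis norm_minus_cancel)
    then show ?thesis by simp
  qed
  have "?E x \<in> Y" if "x \<in> Y" for x
  proof (rule ccontr)
    assume "?E x \<notin> Y"
    then have "?E (?E x) = ?E x" using off[of "?E x"] by simp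
    then have "?E x = x" by (rule inj)
    then show False using that \<open>?E x \<notin> Y\<close> by metis
  qed
  moreover have "y \<in> ?E ` Y" if "y \<in> Y" for y
  proof -
    have "\<exists>!x. y - h *\<^sub>R F x = x"
    proof (rule banach_fix_type[of "1/2"], simp, simp, intro allI)
      fix x x' show "dist (y - h *\<^sub>R F x) (y - h *\<^sub>R F x') \<le> 1/2 * dist x x'"
        using hF[of x' x] by (simp add: dist_norm norm_minus_commute)
    qed
    then obtain x where x: "y - h *\<^sub>R F x = x" by auto
    then have "y = ?E x" by (simp add: algebra_simps)
    moreover have "x \<in> Y" using off[of x] x that by (cases "x \<in> Y") auto
    ultimately show ?thesis by blast
  qed
  ultimately have "?E ` Y = Y" by blast
  moreover have "inj_on ?E Y" by (rule inj_onI) (rule inj)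
  ultimately show ?thesis by (simp add: bij_betw_def)
qed

text \<open>Difference quotients inherit the Lipschitz bound. This supplies the bound on the
  Jacobian entries that \<open>det_one_plus_lower_bound\<close> requires, and the bound on the
  divergence.\<close>

lemma lipschitz_imp_norm_derivative_le:
  fixes F :: "'a::real_normed_vector \<Rightarrow> 'b::real_normed_vector"
  assumes der: "(F has_derivative D) (at x)" and lip: "\<And>x y. norm (F x - F y) \<le> L * norm (x - y)"
  shows "norm (D v) \<le> L * norm v"
proof -
  have lin: "linear D" using der by (simp add: has_derivative_def bounded_linear.linear)
  have le: "norm (D v) \<le> L * norm v + e * norm v" if e: "e > 0" for e
  proof (cases "v = 0")
    case True then show ?thesis using lin by (simp add: linear_0)
  next
    case False
    obtain \<delta> where \<delta>: "\<delta> > 0" "\<And>y. norm (y - x) < \<delta> \<Longrightarrow> norm (F y - F x - D (y - x)) \<le> e * norm (y - x)"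
      using der e unfolding has_derivative_at_alt by blast
    define t where "t = \<delta> / (2 * norm v)"
    have t: "t > 0" "t * norm v < \<delta>" using \<delta> False by (auto simp: t_def field_simps)
    have "norm (F (x + t *\<^sub>R v) - F x - t *\<^sub>R D v) \<le> e * (t * norm v)"
      using \<delta>(2)[of "x + t *\<^sub>R v"] t linear_cmul[OF lin] by simp
    moreover have "norm (F (x + t *\<^sub>R v) - F x) \<le> L * (t * norm v)"
      using lip[of "x + t *\<^sub>R v" x] t by simp
    moreover have "norm (t *\<^sub>R D v) \<le> norm (F (x + t *\<^sub>R v) - F x) + norm (F (x + t *\<^sub>R v) - F x - t *\<^sub>R D v)"
      using norm_triangle_ineq4[of "F (x + t *\<^sub>R v) - F x" "F (x + t *\<^sub>R v) - F x - t *\<^sub>R D v"] by simp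
    ultimately have "t * norm (D v) \<le> t * (L * norm v + e * norm v)"
      using t by (simp add: algebra_simps)
    then show ?thesis using t by simp
  qed
  show ?thesis
  proof (cases "v = 0")
    case False
    show ?thesis
    proof (rule field_le_epsilon)
      fix e :: real assume "e > 0"
      then show "norm (D v) \<le> L * norm v + e" using le[of "e / norm v"] False by simp
    qed
  qed (use lin in \<open>simp add: linear_0\<close>)
qed

lemma lipschitz_imp_continuous_on:
  fixes F :: "'a::real_normed_vector \<Rightarrow> 'b::real_normed_vector"
  assumes "\<And>x y. x \<in> S \<Longrightarrow> y \<in> S \<Longrightarrow> norm (F x - F y) \<le> L * norm (x - y)"
  shows "continuous_on S F"
proof (rule lipschitz_on_continuous_on)
  show "\<bar>L\<bar>-lipschitz_on S F"
  proof (rule lipschitz_onI)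
    fix x y assume "x \<in> S" "y \<in> S"
    then have "norm (F x - F y) \<le> L * norm (x - y)" by (rule assms)
    also have "\<dots> \<le> \<bar>L\<bar> * norm (x - y)" by (intro mult_right_mono) auto
    finally show "dist (F x) (F y) \<le> \<bar>L\<bar> * dist x y" by (simp add: dist_norm)
  qed simp
qed

lemma abs_perturbed_mult_le:
  fixes v :: real
  assumes "\<bar>c\<bar> \<le> K" "0 \<le> e" "0 \<le> v" "v \<le> B"
  shows "\<bar>(1 + c - e) * v\<bar> \<le> (1 + K + e) * B"
proof -
  have "\<bar>1 + c - e\<bar> \<le> 1 + K + e" "\<bar>v\<bar> \<le> B" "0 \<le> 1 + K + e" using assms by linarith+
  then show ?thesis unfolding abs_mult by (rule mult_mono) simp
qed

text \<open>The Euler map sends \<open>Y\<close> bijectively onto itself, so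
  \<open>integral Y w\<close> equals the integral of the Jacobian determinant times \<open>w\<close>
  at the image point. The determinant is then bounded below, which is legitimate because
  \<open>w\<close> is nonnegative. \<open>C\<close> is chosen before \<open>h\<close> and
  \<open>w\<close>, so that errors can be added over many steps with different
  \<open>w\<close>.\<close>

lemma euler_map_integral_wellorder:
  fixes F :: "real^'n::{finite,wellorder} \<Rightarrow> real^'n::_"
  assumes L: "0 \<le> L" and lip: "\<And>x y. norm (F x - F y) \<le> L * norm (x - y)"
    and Y: "open Y" "bounded Y"
    and off: "\<And>x. x \<notin> Y \<Longrightarrow> F x = 0"
    and der: "\<And>x. x \<in> Y \<Longrightarrow> (F has_derivative F' x) (at x)"
    and d: "continuous_on Y d" "\<And>x. x \<in> Y \<Longrightarrow> d x = (\<Sum>i\<in>UNIV. F' x (axis i 1) $ i)"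
  shows "\<exists>C\<ge>0. \<forall>h w B. 0 \<le> h \<longrightarrow> h \<le> 1 \<longrightarrow> h * L \<le> 1/2 \<longrightarrow>
    continuous_on Y w \<longrightarrow> (\<forall>x\<in>Y. 0 \<le> w x \<and> w x \<le> B) \<longrightarrow>
    integral Y (\<lambda>x. (1 + h * d x - C * h\<^sup>2) * w (x + h *\<^sub>R F x)) \<le> integral Y w"
proof -
  obtain C where C: "C \<ge> 0" "\<And>(A::real^'n::_^'n::_) h. (\<forall>i j. \<bar>A $ i $ j\<bar> \<le> L) \<Longrightarrow> 0 \<le> h \<Longrightarrow> h \<le> 1 \<Longrightarrow>
    1 + h * trace A - C * h\<^sup>2 \<le> det (mat 1 + h *\<^sub>R A)"
    using det_one_plus_lower_bound[OF L] by blast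
  show ?thesis
  proof (intro exI[of _ C] conjI allI impI)
    show "C \<ge> 0" by fact
    fix h and w :: "real^'n::_ \<Rightarrow> real" and B
    assume h: "0 \<le> h" "h \<le> 1" "h * L \<le> 1/2"
      and w: "continuous_on Y w" "\<forall>x\<in>Y. 0 \<le> w x \<and> w x \<le> B"
    let ?E = "\<lambda>x. x + h *\<^sub>R F x"
    let ?D = "\<lambda>x v. v + h *\<^sub>R F' x v"
    have bij: "bij_betw ?E Y Y" using euler_map_bij_betw lip off h L by blast
    then have E: "?E ` Y = Y" "inj_on ?E Y" by (auto simp: bij_betw_def)
    \<comment> \<open>The scalar integrand is viewed in \<open>real^1\<close>, the form in which the
      change of variables is applied.\<close>
    have w1: "(\<lambda>x. vec (w x) :: real^1) absolutely_integrable_on Y" "w absolutely_integrable_on Y"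
      using absolutely_integrable_bounded_continuous[OF Y w(1), of B] w(2)
      by (auto simp: absolutely_integrable_on_1_iff)
    have derE: "(?E has_derivative ?D x) (at x within Y)" if "x \<in> Y" for x
      by (intro has_derivative_add has_derivative_ident has_derivative_scaleR_right)
        (rule has_derivative_at_withinI[OF der[OF that]])
    have "Y \<in> sets lebesgue" using Y by auto
    then have "((\<lambda>x. \<bar>det (matrix (?D x))\<bar> *\<^sub>R (vec (w (?E x)) :: real^1)) absolutely_integrable_on Y \<and>
        integral Y (\<lambda>x. \<bar>det (matrix (?D x))\<bar> *\<^sub>R (vec (w (?E x)) :: real^1)) = integral (?E ` Y) (\<lambda>x. vec (w x)))
      \<longleftrightarrow> (\<lambda>x. vec (w x) :: real^1) absolutely_integrable_on (?E ` Y) \<and>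
        integral (?E ` Y) (\<lambda>x. vec (w x) :: real^1) = integral (?E ` Y) (\<lambda>x. vec (w x))"
      by (rule has_absolute_integral_change_of_variables[where S = Y and g = ?E and g' = ?D])
        (erule derE, rule E(2))
    then have "(\<lambda>x. \<bar>det (matrix (?D x))\<bar> *\<^sub>R (vec (w (?E x)) :: real^1)) absolutely_integrable_on Y \<and>
        integral Y (\<lambda>x. \<bar>det (matrix (?D x))\<bar> *\<^sub>R (vec (w (?E x)) :: real^1)) = integral Y (\<lambda>x. vec (w x))"
      by (simp only: E(1) w1 simp_thms)
    then have cv: "(\<lambda>x. \<bar>det (matrix (?D x))\<bar> * w (?E x)) absolutely_integrable_on Y"
        "integral Y (\<lambda>x. \<bar>det (matrix (?D x))\<bar> * w (?E x)) = integral Y w"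
      by (auto simp: absolutely_integrable_on_1_iff integral_on_1_eq vec_eq_iff)
    have pw: "1 + h * d x - C * h\<^sup>2 \<le> \<bar>det (matrix (?D x))\<bar>" if "x \<in> Y" for x
    proof -
      have lin: "linear (F' x)" using der that by (auto simp: has_derivative_def bounded_linear.linear)
      have "matrix (?D x) = mat 1 + h *\<^sub>R matrix (F' x)"
        by (simp add: matrix_def vec_eq_iff mat_def axis_def)
      moreover have "\<bar>matrix (F' x) $ i $ j\<bar> \<le> L" for i j
        using lipschitz_imp_norm_derivative_le[of F "F' x" x L "axis j 1"] der that lip
          component_le_norm_cart[of "F' x (axis j 1)" i] by (simp add: matrix_def)
      moreover have "trace (matrix (F' x)) = d x"
        using d that by (simp add: trace_def matrix_def)
      ultimately show ?thesis
        using C(2)[of "matrix (F' x)" h] h by simp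
    qed
    have bd: "\<bar>d x\<bar> \<le> CARD('n) * L" if "x \<in> Y" for x
    proof -
      have "\<bar>F' x (axis i 1) $ i\<bar> \<le> L" for i
        using lipschitz_imp_norm_derivative_le[of F "F' x" x L "axis i 1"] der that lip
          component_le_norm_cart[of "F' x (axis i 1)" i] by simp
      then have "\<bar>\<Sum>i\<in>UNIV. F' x (axis i 1) $ i\<bar> \<le> CARD('n) * L"
        by (intro order_trans[OF sum_abs] sum_bounded_above) auto
      then show ?thesis using d that by simp
    qed
    have "continuous_on UNIV F"
      using lip by (auto intro: lipschitz_imp_continuous_on)
    then have contE: "continuous_on Y (\<lambda>x. w (?E x))"
      using E by (intro continuous_on_compose2[OF w(1)] continuous_intros) (auto intro: continuous_on_subset)
    show "integral Y (\<lambda>x. (1 + h * d x - C * h\<^sup>2) * w (?E x)) \<le> integral Y w"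
      unfolding cv(2)[symmetric]
    proof (rule integral_le)
      show "(\<lambda>x. \<bar>det (matrix (?D x))\<bar> * w (?E x)) integrable_on Y"
        using cv(1) by (rule set_lebesgue_integral_eq_integral)
      show "(\<lambda>x. (1 + h * d x - C * h\<^sup>2) * w (?E x)) integrable_on Y"
      proof (rule set_lebesgue_integral_eq_integral[OF absolutely_integrable_bounded_continuous[OF Y]])
        show "continuous_on Y (\<lambda>x. (1 + h * d x - C * h\<^sup>2) * w (?E x))"
          by (intro continuous_intros contE d)
        fix x assume x: "x \<in> Y"
        then have "?E x \<in> Y" using E by blast
        moreover have "\<bar>h * d x\<bar> \<le> h * (CARD('n) * L)"
          using bd[OF x] h by (simp add: abs_mult mult_left_mono)
        moreover have "0 \<le> C * h\<^sup>2" using C(1) by simp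
        ultimately show "\<bar>(1 + h * d x - C * h\<^sup>2) * w (?E x)\<bar> \<le> (1 + h * (CARD('n) * L) + C * h\<^sup>2) * B"
          using w by (intro abs_perturbed_mult_le) blast+
      qed
      fix x assume "x \<in> Y"
      then have "?E x \<in> Y" using E by blast
      then show "(1 + h * d x - C * h\<^sup>2) * w (?E x) \<le> \<bar>det (matrix (?D x))\<bar> * w (?E x)"
        using w pw[OF \<open>x \<in> Y\<close>] by (intro mult_right_mono) auto
    qed
  qed
qed

text \<open>
  The change of variables theorem of the library requires an index type of class wellorder. This
  type has as many elements as the basis and carries such an order, so that the theorem can be
  transferred to an arbitrary Euclidean space along a measure preserving isometry.
\<close>

typedef (overloaded) ('a::euclidean_space) basis_index = "{..<DIM('a)}"
  by (auto intro!: exI[of _ 0])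

instance basis_index :: (euclidean_space) finite
proof
  have "range (Rep_basis_index :: 'a basis_index \<Rightarrow> nat) \<subseteq> {..<DIM('a)}"
    using Rep_basis_index by auto
  then have "finite (range (Rep_basis_index :: 'a basis_index \<Rightarrow> nat))"
    using finite_subset by blast
  then show "finite (UNIV :: 'a basis_index set)"
    by (rule finite_imageD) (simp add: inj_on_def Rep_basis_index_inject)
qed

instantiation basis_index :: (euclidean_space) wellorder
begin

definition "i \<le> j \<longleftrightarrow> Rep_basis_index i \<le> Rep_basis_index j"
definition "i < j \<longleftrightarrow> Rep_basis_index i < Rep_basis_index j"

instance
proof
  fix P :: "'a basis_index \<Rightarrow> bool" and a
  assume step: "\<And>x. (\<And>y. y < x \<Longrightarrow> P y) \<Longrightarrow> P x"
  show "P a"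
    by (induction a rule: measure_induct_rule[of Rep_basis_index])
      (auto intro: step simp: less_basis_index_def)
qed (auto simp: less_eq_basis_index_def less_basis_index_def Rep_basis_index_inject)

end

lemma bij_betw_basis_index: "\<exists>e. bij_betw e (UNIV :: 'a basis_index set) (Basis :: 'a::euclidean_space set)"
proof -
  have "bij_betw Rep_basis_index (UNIV :: 'a basis_index set) {..<DIM('a)}"
    using type_definition.Rep_range[OF type_definition_basis_index]
    by (auto simp: bij_betw_def inj_on_def Rep_basis_index_inject)
  moreover have "\<exists>f. bij_betw f {..<DIM('a)} (Basis :: 'a set)"
    using ex_bij_betw_nat_finite[of "Basis :: 'a set"] by (simp add: atLeast0LessThan)
  ultimately show ?thesis using bij_betw_trans by blast
qed

text \<open>\<open>T\<close> reads off coordinates along an enumeration \<open>e\<close> of the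
  basis and \<open>S\<close> reassembles the vector. The identity for \<open>D\<close> says that the
  divergence is unchanged under conjugation by \<open>T\<close>.\<close>

lemma coordinate_isometry:
  obtains T :: "'a::euclidean_space \<Rightarrow> real^'a basis_index" and S
  where "linear T" "linear S" "\<And>x. S (T x) = x" "\<And>y. T (S y) = y" "\<And>x. norm (T x) = norm x"
    "\<And>D. (\<Sum>i\<in>UNIV. T (D (S (axis i 1))) $ i) = (\<Sum>b\<in>Basis. D b \<bullet> b)"
    "distr lborel borel T = lborel"
proof -
  obtain e where e: "bij_betw e (UNIV :: 'a basis_index set) (Basis :: 'a set)"
    using bij_betw_basis_index by blast
  then have eB: "e i \<in> Basis" and e_eq: "e i = e j \<longleftrightarrow> i = j" for i j
    by (auto simp: bij_betw_def inj_on_def)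
  define T :: "'a \<Rightarrow> real^'a basis_index" where "T x = (\<chi> i. x \<bullet> e i)" for x
  define S :: "real^'a basis_index \<Rightarrow> 'a" where "S y = (\<Sum>i\<in>UNIV. y $ i *\<^sub>R e i)" for y
  have sum_e: "(\<Sum>i\<in>UNIV. g (e i)) = (\<Sum>b\<in>Basis. g b)" for g :: "'a \<Rightarrow> 'b::comm_monoid_add"
    using sum.reindex_bij_betw[OF e, of g] .
  have linT: "linear T" by (rule linearI) (simp_all add: T_def vec_eq_iff inner_add_left)
  have linS: "linear S"
    by (rule linearI) (simp_all add: S_def scaleR_add_left sum.distrib scaleR_sum_right)
  have ST: "S (T x) = x" for x
    using sum_e[of "\<lambda>b. (x \<bullet> b) *\<^sub>R b"] by (simp add: S_def T_def euclidean_representation)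
  have S_inner: "S y \<bullet> e i = y $ i" for y i
    by (simp add: S_def inner_sum_left inner_Basis eB e_eq if_distrib cong: if_cong)
  then have TS: "T (S y) = y" for y by (simp add: T_def vec_eq_iff)
  have nT: "norm (T x) = norm x" for x
    using sum_e[of "\<lambda>b. (x \<bullet> b)\<^sup>2"]
    by (simp add: norm_vec_def L2_set_def T_def norm_eq_sqrt_inner[of x] euclidean_inner[of x x] power2_eq_square)
  have S_axis: "S (axis i 1) = e i" for i
    by (simp add: S_def axis_def if_distrib[of "\<lambda>c. c *\<^sub>R _"] cong: if_cong)
  have tr: "(\<Sum>i\<in>UNIV. T (D (S (axis i 1))) $ i) = (\<Sum>b\<in>Basis. D b \<bullet> b)" for D
    unfolding S_axis T_def using sum_e[of "\<lambda>b. D b \<bullet> b"] by simp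
  have Basis: "(Basis :: (real^'a basis_index) set) = (\<lambda>i. axis i 1) ` UNIV"
    by (auto simp: Basis_vec_def)
  have T_meas: "T \<in> borel_measurable lborel"
    using linT by (simp add: linear_continuous_on borel_measurable_continuous_onI linear_linear)
  \<comment> \<open>Lebesgue measure is determined by its values on boxes. The preimage of
    \<open>box l u\<close> is \<open>box (S l) (S u)\<close>, whose edges have the same lengths,
    merely indexed by \<open>e\<close>.\<close>
  have "lborel = distr lborel borel T"
  proof (rule lborel_eqI)
    fix l u :: "real^'a basis_index" assume lu: "\<And>b. b \<in> Basis \<Longrightarrow> l \<bullet> b \<le> u \<bullet> b"
    then have le: "l $ i \<le> u $ i" for i using lu[of "axis i 1"] by (simp add: Basis inner_axis)
    have leS: "S l \<bullet> b \<le> S u \<bullet> b" if "b \<in> Basis" for b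
    proof -
      have "b \<in> range e" using that e by (simp add: bij_betw_def)
      then obtain i where "b = e i" by blast
      then show ?thesis using le by (simp add: S_inner)
    qed
    have "T -` box l u = box (S l) (S u)"
    proof -
      have B: "(Basis :: 'a set) = range e" using e by (simp add: bij_betw_def)
      show ?thesis
        by (simp add: vimage_def box_def B Basis inner_axis T_def S_inner)
    qed
    then have "emeasure (distr lborel borel T) (box l u) = emeasure lborel (box (S l) (S u))"
      by (subst emeasure_distr) (use T_meas in auto)
    also have "\<dots> = ennreal (\<Prod>b\<in>Basis. (S u - S l) \<bullet> b)"
      using leS by (rule emeasure_lborel_box)
    also have "(\<Prod>b\<in>Basis. (S u - S l) \<bullet> b) = (\<Prod>i\<in>UNIV. (S u - S l) \<bullet> e i)"
      using prod.reindex_bij_betw[OF e, of "\<lambda>b. (S u - S l) \<bullet> b"] by simp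
    also have "\<dots> = (\<Prod>b\<in>Basis. (u - l) \<bullet> b)"
      unfolding Basis by (subst prod.reindex) (auto simp: inj_on_def axis_eq_axis inner_axis inner_diff_left S_inner)
    finally show "emeasure (distr lborel borel T) (box l u) = (\<Prod>b\<in>Basis. (u - l) \<bullet> b)" .
  qed auto
  then show thesis by (intro that[OF linT linS ST TS nT tr]) simp
qed

lemma integral_isometry_image:
  fixes w :: "'a::euclidean_space \<Rightarrow> real" and T :: "'a \<Rightarrow> 'b::euclidean_space"
  assumes Y: "open Y" "bounded Y" "continuous_on Y w" "\<And>x. x \<in> Y \<Longrightarrow> \<bar>w x\<bar> \<le> B"
    and TS: "linear T" "linear S" "\<And>x. S (T x) = x" "\<And>y. T (S y) = y" "distr lborel borel T = lborel"
  shows "integral (T ` Y) (\<lambda>y. w (S y)) = integral Y w"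
proof -
  have img: "T ` Y = S -` Y" using TS by (auto simp: image_iff) metis
  have cont: "continuous_on A T" "continuous_on A' S" for A A'
    using TS by (auto intro: linear_continuous_on simp: linear_linear)
  have o: "open (T ` Y)" unfolding img by (rule open_vimage[OF Y(1) cont(2)])
  have b: "bounded (T ` Y)" using Y(2) TS by (simp add: bounded_linear_image linear_linear)
  have cw: "continuous_on (T ` Y) (\<lambda>y. w (S y))"
    by (rule continuous_on_compose2[OF Y(3) cont(2)]) (use TS in auto)
  have abs: "w absolutely_integrable_on Y" "(\<lambda>y. w (S y)) absolutely_integrable_on (T ` Y)"
    using Y TS by (auto intro!: absolutely_integrable_bounded_continuous o b cw)
  have m: "(\<lambda>y. indicator (T ` Y) y *\<^sub>R w (S y)) \<in> borel_measurable borel"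
    "(\<lambda>y. indicator Y y *\<^sub>R w y) \<in> borel_measurable borel"
    by (intro borel_measurable_continuous_on_indicator o cw Y borel_open)+
  \<comment> \<open>Passing from the gauge integral to the Bochner integral over
    \<open>lborel\<close> makes the push-forward identity for \<open>T\<close> applicable; this
    requires Borel measurability of the truncated integrands.\<close>
  have leb: "(LINT x:A|lborel. f x) = integral A f" if "f absolutely_integrable_on A"
    "(\<lambda>y. indicator A y *\<^sub>R f y) \<in> borel_measurable borel" for f :: "'c::euclidean_space \<Rightarrow> real" and A
  proof -
    have "(LINT x:A|lborel. f x) = (LINT x:A|lebesgue. f x)"
      unfolding set_lebesgue_integral_def using that by (simp add: integral_completion)
    then show ?thesis using that set_lebesgue_integral_eq_integral by metis
  qed
  have "integral (T ` Y) (\<lambda>y. w (S y)) = (\<integral>y. indicator (T ` Y) y *\<^sub>R w (S y) \<partial>distr lborel borel T)"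
    using leb[OF abs(2)] m(1) by (simp add: set_lebesgue_integral_def TS(5))
  also have "\<dots> = (\<integral>x. indicator (T ` Y) (T x) *\<^sub>R w (S (T x)) \<partial>lborel)"
    by (rule integral_distr) (use m cont in \<open>auto intro: borel_measurable_continuous_onI\<close>)
  also have "\<dots> = (\<integral>x. indicator Y x *\<^sub>R w x \<partial>lborel)"
    using TS img by (simp add: indicator_def)
  also have "\<dots> = integral Y w"
    using leb[OF abs(1)] m(2) by (simp add: set_lebesgue_integral_def)
  finally show ?thesis .
qed

text \<open>Conjugation by the isometry preserves both the Lipschitz constant and the divergence, so
  the constant \<open>C\<close> of the transported estimate carries over unchanged.\<close>

lemma euler_map_integral:
  fixes F :: "'a::euclidean_space \<Rightarrow> 'a"
  assumes L: "0 \<le> L" and lip: "\<And>x y. norm (F x - F y) \<le> L * norm (x - y)"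
    and Y: "open Y" "bounded Y"
    and off: "\<And>x. x \<notin> Y \<Longrightarrow> F x = 0"
    and der: "\<And>x. x \<in> Y \<Longrightarrow> (F has_derivative F' x) (at x)"
    and d: "continuous_on Y d" "\<And>x. x \<in> Y \<Longrightarrow> d x = (\<Sum>b\<in>Basis. F' x b \<bullet> b)"
  shows "\<exists>C\<ge>0. \<forall>h w B. 0 \<le> h \<longrightarrow> h \<le> 1 \<longrightarrow> h * L \<le> 1/2 \<longrightarrow>
    continuous_on Y w \<longrightarrow> (\<forall>x\<in>Y. 0 \<le> w x \<and> w x \<le> B) \<longrightarrow>
    integral Y (\<lambda>x. (1 + h * d x - C * h\<^sup>2) * w (x + h *\<^sub>R F x)) \<le> integral Y w"
proof -
  obtain T :: "'a \<Rightarrow> real^'a basis_index" and S where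
    TS: "linear T" "linear S" "\<And>x. S (T x) = x" "\<And>y. T (S y) = y" "distr lborel borel T = lborel"
    and nT: "\<And>x. norm (T x) = norm x"
    and tr: "\<And>D. (\<Sum>i\<in>UNIV. T (D (S (axis i 1))) $ i) = (\<Sum>b\<in>Basis. D b \<bullet> b)"
    by (rule coordinate_isometry[where 'a = 'a]) blast
  have nS: "norm (S y) = norm y" for y using nT[of "S y"] TS by simp
  have img: "T ` Y = S -` Y" using TS by (auto simp: image_iff) metis
  have cont: "continuous_on A T" "continuous_on A' S" for A A'
    using TS by (auto intro: linear_continuous_on simp: linear_linear)
  have bl: "bounded_linear T" "bounded_linear S" using TS by (auto simp: linear_linear)
  let ?G = "\<lambda>y. T (F (S y))"
  have lipG: "norm (?G x - ?G y) \<le> L * norm (x - y)" for x y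
    using lip[of "S x" "S y"] by (simp add: nT nS flip: linear_diff[OF TS(1)] linear_diff[OF TS(2)])
  have "\<exists>C\<ge>0. \<forall>h w B. 0 \<le> h \<longrightarrow> h \<le> 1 \<longrightarrow> h * L \<le> 1/2 \<longrightarrow>
    continuous_on (T ` Y) w \<longrightarrow> (\<forall>x\<in>T ` Y. 0 \<le> w x \<and> w x \<le> B) \<longrightarrow>
    integral (T ` Y) (\<lambda>x. (1 + h * d (S x) - C * h\<^sup>2) * w (x + h *\<^sub>R ?G x)) \<le> integral (T ` Y) w"
  proof (rule euler_map_integral_wellorder[OF L lipG])
    show "open (T ` Y)" unfolding img by (rule open_vimage[OF Y(1) cont(2)])
    show "bounded (T ` Y)" using Y(2) bl by (simp add: bounded_linear_image)
    show "?G y = 0" if "y \<notin> T ` Y" for y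
      using that off[of "S y"] TS by (simp add: img linear_0)
    show "(?G has_derivative (\<lambda>v. T (F' (S y) (S v)))) (at y)" if "y \<in> T ` Y" for y
    proof -
      have "(S has_derivative S) (at y)" by (rule bounded_linear_imp_has_derivative[OF bl(2)])
      moreover have "(F has_derivative F' (S y)) (at (S y))" using that TS by (auto intro: der)
      ultimately have "((\<lambda>y. F (S y)) has_derivative (\<lambda>v. F' (S y) (S v))) (at y)"
        by (rule has_derivative_compose)
      then show ?thesis by (rule bounded_linear.has_derivative[OF bl(1)])
    qed
    show "continuous_on (T ` Y) (\<lambda>y. d (S y))"
      by (rule continuous_on_compose2[OF d(1) cont(2)]) (use TS in auto)
    show "d (S y) = (\<Sum>i\<in>UNIV. T (F' (S y) (S (axis i 1))) $ i)" if "y \<in> T ` Y" for y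
      unfolding tr using that TS by (auto intro: d)
  qed
  then obtain C where C: "C \<ge> 0" "\<forall>h w B. 0 \<le> h \<longrightarrow> h \<le> 1 \<longrightarrow> h * L \<le> 1/2 \<longrightarrow>
    continuous_on (T ` Y) w \<longrightarrow> (\<forall>x\<in>T ` Y. 0 \<le> w x \<and> w x \<le> B) \<longrightarrow>
    integral (T ` Y) (\<lambda>x. (1 + h * d (S x) - C * h\<^sup>2) * w (x + h *\<^sub>R ?G x)) \<le> integral (T ` Y) w"
    by (elim exE conjE)
  have dbound: "\<bar>d x\<bar> \<le> DIM('a) * L" if "x \<in> Y" for x
  proof -
    have "\<bar>F' x b \<bullet> b\<bar> \<le> L" if "b \<in> Basis" for b
      using lipschitz_imp_norm_derivative_le[OF der[OF \<open>x \<in> Y\<close>] lip, of b] that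
        Basis_le_norm[OF that, of "F' x b"] by simp
    then have "\<bar>\<Sum>b\<in>Basis. F' x b \<bullet> b\<bar> \<le> DIM('a) * L"
      by (intro order_trans[OF sum_abs] sum_bounded_above) auto
    then show ?thesis using d that by simp
  qed
  show ?thesis
  proof (intro exI[of _ C] conjI C allI impI)
    fix h B :: real and w :: "'a \<Rightarrow> real" assume h: "0 \<le> h" "h \<le> 1" "h * L \<le> 1/2"
      and w: "continuous_on Y w" "\<forall>x\<in>Y. 0 \<le> w x \<and> w x \<le> B"
    let ?g = "\<lambda>x. (1 + h * d x - C * h\<^sup>2) * w (x + h *\<^sub>R F x)"
    have E: "(\<lambda>x. x + h *\<^sub>R F x) ` Y = Y"
      using euler_map_bij_betw[OF lip off h(1,3) L] by (simp add: bij_betw_def)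
    have "continuous_on UNIV F"
      by (rule lipschitz_imp_continuous_on) (rule lip)
    then have contg: "continuous_on Y ?g"
      using E by (intro continuous_intros d continuous_on_compose2[OF w(1)]) (auto intro: continuous_on_subset)
    have gb: "\<bar>?g x\<bar> \<le> (1 + h * (DIM('a) * L) + C * h\<^sup>2) * B" if "x \<in> Y" for x
    proof -
      have "x + h *\<^sub>R F x \<in> Y" using E that by blast
      moreover have "\<bar>h * d x\<bar> \<le> h * (DIM('a) * L)"
        using dbound[OF that] h by (simp add: abs_mult mult_left_mono)
      moreover have "0 \<le> C * h\<^sup>2" using C(1) by simp
      ultimately show ?thesis
        using w by (intro abs_perturbed_mult_le) blast+
    qed
    have "integral (T ` Y) (\<lambda>y. ?g (S y)) \<le> integral (T ` Y) (\<lambda>y. w (S y))"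
    proof -
      have "integral (T ` Y) (\<lambda>x. (1 + h * d (S x) - C * h\<^sup>2) * w (S (x + h *\<^sub>R ?G x))) \<le> integral (T ` Y) (\<lambda>y. w (S y))"
        by (rule C(2)[rule_format, OF h, of _ B]) (use w TS in \<open>auto intro!: continuous_on_compose2[OF w(1) cont(2)]\<close>)
      then show ?thesis
        by (simp add: linear_add[OF TS(2)] linear_cmul[OF TS(2)] TS)
    qed
    moreover have "integral (T ` Y) (\<lambda>y. ?g (S y)) = integral Y ?g"
      by (rule integral_isometry_image[OF Y contg gb TS])
    moreover have "integral (T ` Y) (\<lambda>y. w (S y)) = integral Y w"
      by (rule integral_isometry_image[OF Y w(1) _ TS, of B]) (use w in auto)
    ultimately show "integral Y ?g \<le> integral Y w" by simp
  qed
qed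

section \<open>A comparison principle for transport along a vector field\<close>

text \<open>One update of the majorant. It remains above \<open>V\<close> because the error term
  \<open>Q * h\<^sup>2\<close> pays for the endpoint missing the Euler point. Its bound hardly grows
  because \<open>b \<le> M * a\<close>. Its integral decays towards that of \<open>b\<close> because
  \<open>1 \<le> a + d\<close> lets the loss rate \<open>a\<close> outweigh the compression of
  volume by at least one. The Lipschitz bound has the form
  \<open>l + 1 \<mapsto> (1 + h * C2) * (l + 1)\<close>, which iterates to a power.\<close>

lemma transport_comparison_step:
  fixes F :: "'a::euclidean_space \<Rightarrow> 'a" and a b d V w :: "'a \<Rightarrow> real"
  assumes lip: "\<And>x y. norm (F x - F y) \<le> L * norm (x - y)" and L: "0 \<le> L"
    and Y: "open Y" "bounded Y"
    and E: "\<And>x. x \<in> Y \<Longrightarrow> x + h *\<^sub>R F x \<in> Y"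
    and d: "continuous_on Y d" "\<And>x. x \<in> Y \<Longrightarrow> \<bar>d x\<bar> \<le> D"
    and F_bound: "\<And>x. norm (F x) \<le> BF"
    and a: "\<And>x y. x \<in> Y \<Longrightarrow> y \<in> Y \<Longrightarrow> \<bar>a x - a y\<bar> \<le> La * norm (x - y)"
      "\<And>x. x \<in> Y \<Longrightarrow> 0 \<le> a x" "\<And>x. x \<in> Y \<Longrightarrow> h * a x \<le> 1"
    and b: "\<And>x y. x \<in> Y \<Longrightarrow> y \<in> Y \<Longrightarrow> \<bar>b x - b y\<bar> \<le> Lb * norm (x - y)"
      "\<And>x. x \<in> Y \<Longrightarrow> 0 \<le> b x" "\<And>x. x \<in> Y \<Longrightarrow> b x \<le> M * a x"
    and ad: "\<And>x. x \<in> Y \<Longrightarrow> 1 \<le> a x + d x"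
    and cs: "0 \<le> La" "0 \<le> Lb" "0 \<le> C" "0 \<le> C0" "0 \<le> l" "l \<le> Ls" "0 < h" "M \<le> B" "B \<le> M + 1"
    and euler: "integral Y (\<lambda>x. (1 + h * d x - C * h\<^sup>2) * w (x + h *\<^sub>R F x)) \<le> integral Y w"
    and step: "\<And>x. x \<in> Y \<Longrightarrow> \<exists>y\<in>Y. norm (y - (x + h *\<^sub>R F x)) \<le> C0 * h\<^sup>2 \<and>
      V x \<le> h * b x + C0 * h\<^sup>2 + (1 - h * a x) * V y"
    and w: "\<And>x y. x \<in> Y \<Longrightarrow> y \<in> Y \<Longrightarrow> \<bar>w x - w y\<bar> \<le> l * norm (x - y)"
      "\<And>x. x \<in> Y \<Longrightarrow> 0 \<le> w x" "\<And>x. x \<in> Y \<Longrightarrow> w x \<le> B" "\<And>x. x \<in> Y \<Longrightarrow> V x \<le> w x"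
  defines "Q \<equiv> C0 * (1 + Ls)" and "C2 \<equiv> Lb + La * (M + 1) + L"
  shows "\<exists>w'. (\<forall>x\<in>Y. \<forall>y\<in>Y. \<bar>w' x - w' y\<bar> \<le> ((1 + h * C2) * (l + 1) - 1) * norm (x - y)) \<and>
    (\<forall>x\<in>Y. 0 \<le> w' x \<and> w' x \<le> B + Q * h\<^sup>2 \<and> V x \<le> w' x) \<and>
    integral Y w' \<le> integral Y w + h * (integral Y b - integral Y w)
      + h\<^sup>2 * ((Q + C * (M + 1) + Ls * BF) * measure lebesgue Y)"
proof -
  let ?E = "\<lambda>x. x + h *\<^sub>R F x"
  define w' where "w' x = h * b x + Q * h\<^sup>2 + (1 - h * a x) * w (?E x)" for x
  have Q: "0 \<le> Q" using cs by (simp add: Q_def)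
  have ha: "0 \<le> 1 - h * a x" "1 - h * a x \<le> 1" if "x \<in> Y" for x
    using a(2,3)[OF that] cs by auto
  have Elip: "norm (?E x - ?E y) \<le> (1 + h * L) * norm (x - y)" for x y
  proof -
    have "?E x - ?E y = (x - y) + h *\<^sub>R (F x - F y)" by (simp add: algebra_simps)
    then have "norm (?E x - ?E y) \<le> norm (x - y) + norm (h *\<^sub>R (F x - F y))"
      by (simp only: norm_triangle_ineq)
    also have "\<dots> = norm (x - y) + h * norm (F x - F y)"
      using cs by simp
    also have "\<dots> \<le> norm (x - y) + h * (L * norm (x - y))"
      using lip cs by (intro add_left_mono mult_left_mono) auto
    finally show ?thesis by (simp add: algebra_simps)
  qed
  have w'_lip: "\<bar>w' x - w' y\<bar> \<le> ((1 + h * C2) * (l + 1) - 1) * norm (x - y)" if xy: "x \<in> Y" "y \<in> Y" for x y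
  proof -
    let ?n = "norm (x - y)"
    have "w' x - w' y = h * (b x - b y) + (1 - h * a x) * (w (?E x) - w (?E y)) + h * (a y - a x) * w (?E y)"
      by (simp add: w'_def algebra_simps)
    moreover have "\<bar>h * (b x - b y)\<bar> \<le> h * (Lb * ?n)"
      using b(1)[OF xy] cs by (simp add: abs_mult)
    moreover have "\<bar>(1 - h * a x) * (w (?E x) - w (?E y))\<bar> \<le> 1 * (l * ((1 + h * L) * ?n))"
      unfolding abs_mult using ha[OF xy(1)] cs
        order_trans[OF w(1)[OF E[OF xy(1)] E[OF xy(2)]] mult_left_mono[OF Elip[of x y], of l]]
      by (intro mult_mono) auto
    moreover have "\<bar>h * (a y - a x) * w (?E y)\<bar> \<le> h * (La * ?n) * (M + 1)"
    proof -
      have "\<bar>h * (a y - a x)\<bar> \<le> h * (La * ?n)"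
        using a(1)[OF xy(2,1)] cs by (simp add: abs_mult norm_minus_commute)
      moreover have "\<bar>w (?E y)\<bar> \<le> M + 1" using w(2,3)[OF E[OF xy(2)]] cs by simp
      ultimately show ?thesis
        unfolding abs_mult[of "h * (a y - a x)"] using cs by (intro mult_mono) auto
    qed
    ultimately have "\<bar>w' x - w' y\<bar> \<le> h * (Lb * ?n) + l * ((1 + h * L) * ?n) + h * (La * ?n) * (M + 1)"
      by linarith
    also have "\<dots> = (h * (Lb + La * (M + 1)) + l + l * h * L) * ?n" by (simp add: algebra_simps)
    \<comment> \<open>The slack is \<open>h * L + l * (h * (Lb + La * (M + 1)))\<close>; it is given
      away so that \<open>l + 1\<close> grows by one fixed factor.\<close>
    also have "\<dots> \<le> ((1 + h * C2) * (l + 1) - 1) * ?n"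
    proof (rule mult_right_mono)
      have "0 \<le> M + 1" if "x \<in> Y" for x using w(2,3)[OF that] cs by linarith
      then have "0 \<le> h * L" "0 \<le> l * (h * (Lb + La * (M + 1)))" using cs L xy by auto
      then show "h * (Lb + La * (M + 1)) + l + l * h * L \<le> (1 + h * C2) * (l + 1) - 1"
        by (simp add: C2_def algebra_simps)
    qed simp
    finally show ?thesis .
  qed
  have w'_bounds: "0 \<le> w' x \<and> w' x \<le> B + Q * h\<^sup>2 \<and> V x \<le> w' x" if x: "x \<in> Y" for x
  proof (intro conjI)
    have wE: "0 \<le> w (?E x)" "w (?E x) \<le> B" using w E[OF x] by auto
    show "0 \<le> w' x" using b(2)[OF x] cs Q ha[OF x] wE by (simp add: w'_def)
    \<comment> \<open>The running cost is at most the fraction \<open>h * a x\<close> of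
      \<open>B\<close> that is removed by discounting and stopping, so the constant \<open>B\<close>
      reproduces itself up to \<open>Q * h\<^sup>2\<close>.\<close>
    have "h * b x \<le> h * a x * B"
      using b(3)[OF x] a(2)[OF x] cs mult_left_mono[of "b x" "a x * B" h] mult_right_mono[of M B "a x"]
      by (simp add: mult_ac)
    moreover have "(1 - h * a x) * w (?E x) \<le> (1 - h * a x) * B"
      using wE ha[OF x] by (intro mult_left_mono)
    ultimately show "w' x \<le> B + Q * h\<^sup>2" by (simp add: w'_def algebra_simps)
    obtain y where y: "y \<in> Y" "norm (y - ?E x) \<le> C0 * h\<^sup>2" "V x \<le> h * b x + C0 * h\<^sup>2 + (1 - h * a x) * V y"
      using step[OF x] by blast
    \<comment> \<open>The hypothesis \<open>step\<close> ends at \<open>y\<close>, not at the Euler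
      point. Moving the argument of \<open>w\<close> costs \<open>Ls * (C0 * h\<^sup>2)\<close>, the
      second part of \<open>Q * h\<^sup>2\<close>.\<close>
    have "w y \<le> w (?E x) + Ls * (C0 * h\<^sup>2)"
    proof -
      have "\<bar>w y - w (?E x)\<bar> \<le> l * norm (y - ?E x)" using w(1) y E[OF x] by blast
      also have "\<dots> \<le> Ls * (C0 * h\<^sup>2)" using y cs by (intro mult_mono) auto
      finally show ?thesis by simp
    qed
    then have "V y \<le> w (?E x) + Ls * (C0 * h\<^sup>2)" using w(4)[OF y(1)] by simp
    then have "(1 - h * a x) * V y \<le> (1 - h * a x) * w (?E x) + (1 - h * a x) * (Ls * (C0 * h\<^sup>2))"
      using mult_left_mono[OF _ ha(1)[OF x]] by (simp flip: distrib_left)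
    moreover have "(1 - h * a x) * (Ls * (C0 * h\<^sup>2)) \<le> 1 * (Ls * (C0 * h\<^sup>2))"
      using ha[OF x] cs by (intro mult_right_mono) auto
    ultimately show "V x \<le> w' x" using y(3) by (simp add: w'_def Q_def algebra_simps)
  qed
  have int: "g integrable_on Y" if "continuous_on Y g" "\<And>x. x \<in> Y \<Longrightarrow> \<bar>g x\<bar> \<le> K" for g :: "'a \<Rightarrow> real" and K
    by (rule set_lebesgue_integral_eq_integral[OF absolutely_integrable_bounded_continuous[OF Y that]])
  have cw: "continuous_on Y w" "continuous_on Y w'" "continuous_on Y b"
    by (rule lipschitz_imp_continuous_on, unfold real_norm_def, erule (1) w(1) w'_lip b(1))+
  have cF: "continuous_on A F" for A
    by (rule lipschitz_imp_continuous_on) (rule lip)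
  have cwE: "continuous_on Y (\<lambda>x. w (?E x))"
    by (rule continuous_on_compose2[OF cw(1)]) (auto intro!: continuous_intros cF E)
  have iw: "w integrable_on Y" by (rule int[OF cw(1), of B]) (use w in auto)
  have iw': "w' integrable_on Y"
    by (rule int[OF cw(2), of "B + Q * h\<^sup>2"]) (use w'_bounds in \<open>auto simp: abs_le_iff\<close>)
  \<comment> \<open>The bound on \<open>b\<close> obtained from \<open>b x \<le> M * a x\<close> and
    \<open>h * a x \<le> 1\<close> degenerates as \<open>h\<close> tends to \<open>0\<close>, but it
    serves integrability only.\<close>
  have ib: "b integrable_on Y"
  proof (rule int[OF cw(3)])
    fix x assume x: "x \<in> Y"
    have "b x \<le> \<bar>M\<bar> * a x"
      using b(3)[OF x] a(2)[OF x] mult_right_mono[OF abs_ge_self[of M], of "a x"] by linarith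
    then have "h * b x \<le> h * (\<bar>M\<bar> * a x)"
      using cs by (intro mult_left_mono) auto
    also have "\<dots> \<le> \<bar>M\<bar>" using mult_left_mono[OF a(3)[OF x], of "\<bar>M\<bar>"] by (simp add: mult_ac)
    finally show "\<bar>b x\<bar> \<le> \<bar>M\<bar> / h" using cs b(2)[OF x] by (simp add: field_simps)
  qed
  have lm: "Y \<in> lmeasurable" using Y by (simp add: lmeasurable_open)
  have ic: "(\<lambda>x. c :: real) integrable_on Y" for c
    using lm by (rule integrable_on_const)
  have Ic: "integral Y (\<lambda>x. c) = c * measure lebesgue Y" for c :: real
    using lmeasure_integral[OF lm] integral_mult_right[of Y c "\<lambda>x. 1"] by simp
  have ie: "(\<lambda>x. (1 + h * d x - C * h\<^sup>2) * w (?E x)) integrable_on Y"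
  proof (rule int)
    show "continuous_on Y (\<lambda>x. (1 + h * d x - C * h\<^sup>2) * w (?E x))"
      by (intro continuous_intros cwE d)
    fix x assume x: "x \<in> Y"
    show "\<bar>(1 + h * d x - C * h\<^sup>2) * w (?E x)\<bar> \<le> (1 + h * D + C * h\<^sup>2) * B"
      using d(2)[OF x] w(2,3)[OF E[OF x]] cs
      by (intro abs_perturbed_mult_le) (auto simp: abs_mult)
  qed
  have ih: "(\<lambda>x. h * b x) integrable_on Y" "(\<lambda>x. h * w x) integrable_on Y"
    using integrable_cmul[OF ib, of h] integrable_cmul[OF iw, of h] by simp_all
  define K where "K = Q + C * (M + 1) + Ls * BF"
  have pw: "w' x \<le> (1 + h * d x - C * h\<^sup>2) * w (?E x) + (h * b x - h * w x) + h\<^sup>2 * K" if x: "x \<in> Y" for x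
  proof -
    have wE: "0 \<le> w (?E x)" "w (?E x) \<le> M + 1" using w E[OF x] cs by force+
    \<comment> \<open>This turns the loss rate into the volume factor \<open>1 + h * d x\<close>
      minus \<open>h\<close>. The surplus \<open>h * w (?E x)\<close> is compared with
      \<open>h * w x\<close> at a cost of \<open>h\<^sup>2 * Ls * BF\<close>, and the volume factor
      is then absorbed by \<open>euler\<close>.\<close>
    have "1 - h * a x \<le> 1 - h + h * d x"
      using mult_left_mono[OF ad[OF x], of h] cs by (simp add: algebra_simps)
    then have 1: "(1 - h * a x) * w (?E x) \<le> (1 - h + h * d x) * w (?E x)"
      using wE by (intro mult_right_mono)
    have 2: "C * h\<^sup>2 * w (?E x) \<le> C * h\<^sup>2 * (M + 1)"
      using wE cs by (intro mult_left_mono) auto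
    have "w x - w (?E x) \<le> l * norm (x - ?E x)" using w(1)[OF x E[OF x]] by simp
    also have "\<dots> \<le> Ls * (h * BF)"
      using cs F_bound[of x] by (intro mult_mono) auto
    finally have 3: "h * (w x - w (?E x)) \<le> h * (Ls * (h * BF))"
      using cs by (intro mult_left_mono) auto
    show ?thesis
      using 1 2 3 by (simp add: w'_def K_def algebra_simps power2_eq_square)
  qed
  have "integral Y w' \<le> integral Y (\<lambda>x. (1 + h * d x - C * h\<^sup>2) * w (?E x) + (h * b x - h * w x) + h\<^sup>2 * K)"
    by (intro integral_le iw' integrable_add integrable_diff ie ic ih pw)
  also have "\<dots> = integral Y (\<lambda>x. (1 + h * d x - C * h\<^sup>2) * w (?E x)) + (h * integral Y b - h * integral Y w)
      + h\<^sup>2 * K * measure lebesgue Y"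
    by (simp add: integral_add integral_diff integrable_add integrable_diff ie ic ih Ic)
  finally have "integral Y w' \<le> integral Y w + h * (integral Y b - integral Y w) + h\<^sup>2 * (K * measure lebesgue Y)"
    using euler by (simp add: algebra_simps)
  then show ?thesis using w'_lip w'_bounds unfolding K_def by blast
qed

text \<open>
  Think of \<open>V\<close> as a value function, of \<open>F\<close> as a drift with divergence \<open>d\<close>, and of \<open>a\<close> as a rate of
  discounting and stopping. Starting from the constant \<open>M\<close>, the iterates
  \<open>w' x = h * b x + Q * h\<^sup>2 + (1 - h * a x) * w (x + h *\<^sub>R F x)\<close> stay above \<open>V\<close>. If the claim failed
  by \<open>\<delta>\<close>, each step would lower their integral by at least \<open>h * \<delta> / 2\<close>, and after sufficiently
  many steps it would be negative. The value \<open>v\<close> plays the role of the (lower) integral of \<open>V\<close>,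
  whose measurability is not known.
\<close>

lemma transport_comparison:
  fixes F :: "'a::euclidean_space \<Rightarrow> 'a" and a b d V :: "'a \<Rightarrow> real"
  assumes lip: "\<And>x y. norm (F x - F y) \<le> L * norm (x - y)" and L: "0 \<le> L"
    and Y: "open Y" "bounded Y"
    and off: "\<And>x. x \<notin> Y \<Longrightarrow> F x = 0"
    and der: "\<And>x. x \<in> Y \<Longrightarrow> (F has_derivative F' x) (at x)"
    and d: "continuous_on Y d" "\<And>x. x \<in> Y \<Longrightarrow> d x = (\<Sum>b\<in>Basis. F' x b \<bullet> b)"
      "\<And>x. x \<in> Y \<Longrightarrow> \<bar>d x\<bar> \<le> D"
    and F_bound: "\<And>x. norm (F x) \<le> BF"
    and a: "\<And>x y. x \<in> Y \<Longrightarrow> y \<in> Y \<Longrightarrow> \<bar>a x - a y\<bar> \<le> La * norm (x - y)" "0 \<le> La"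
      "\<And>x. x \<in> Y \<Longrightarrow> 0 \<le> a x" "\<And>x. x \<in> Y \<Longrightarrow> a x \<le> A"
    and b: "\<And>x y. x \<in> Y \<Longrightarrow> y \<in> Y \<Longrightarrow> \<bar>b x - b y\<bar> \<le> Lb * norm (x - y)" "0 \<le> Lb"
      "\<And>x. x \<in> Y \<Longrightarrow> 0 \<le> b x" "\<And>x. x \<in> Y \<Longrightarrow> b x \<le> M * a x"
    and ad: "\<And>x. x \<in> Y \<Longrightarrow> 1 \<le> a x + d x"
    and V: "\<And>x. x \<in> Y \<Longrightarrow> V x \<le> M" and M: "0 \<le> M"
    and C0: "0 \<le> C0" and h0: "0 < h0"
    and step: "\<And>h x. 0 < h \<Longrightarrow> h \<le> h0 \<Longrightarrow> x \<in> Y \<Longrightarrow> \<exists>y\<in>Y. norm (y - (x + h *\<^sub>R F x)) \<le> C0 * h\<^sup>2 \<and>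
      V x \<le> h * b x + C0 * h\<^sup>2 + (1 - h * a x) * V y"
    and v: "\<And>w. continuous_on Y w \<Longrightarrow> (\<And>x. x \<in> Y \<Longrightarrow> V x \<le> w x \<and> 0 \<le> w x \<and> w x \<le> M + 1) \<Longrightarrow> v \<le> integral Y w"
  shows "v \<le> integral Y b"
proof (rule ccontr)
  assume "\<not> v \<le> integral Y b"
  define \<delta> where "\<delta> = v - integral Y b"
  have \<delta>: "0 < \<delta>" using \<open>\<not> v \<le> integral Y b\<close> by (simp add: \<delta>_def)
  have "\<exists>C\<ge>0. \<forall>h w B. 0 \<le> h \<longrightarrow> h \<le> 1 \<longrightarrow> h * L \<le> 1/2 \<longrightarrow>
    continuous_on Y w \<longrightarrow> (\<forall>x\<in>Y. 0 \<le> w x \<and> w x \<le> B) \<longrightarrow>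
    integral Y (\<lambda>x. (1 + h * d x - C * h\<^sup>2) * w (x + h *\<^sub>R F x)) \<le> integral Y w"
    (is "\<exists>C\<ge>0. ?euler C")
    by (rule euler_map_integral[OF L lip Y off der d(1,2)])
  then obtain C where C: "C \<ge> 0" "?euler C"
    by (elim exE conjE)
  define \<mu> where "\<mu> = measure lebesgue Y"
  \<comment> \<open>Time after which an integral starting at \<open>M * \<mu>\<close> and falling at
    rate \<open>\<delta> / 2\<close> has reached \<open>- \<delta> / 2\<close>.\<close>
  define S where "S = 2 * M * \<mu> / \<delta> + 1"
  define C2 where "C2 = Lb + La * (M + 1) + L"
  \<comment> \<open>Discrete Gronwall bound:
    \<open>(1 + h * C2) ^ k \<le> exp (C2 * (k * h))\<close>, and \<open>k * h\<close> never exceeds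
    \<open>S\<close>.\<close>
  define Ls where "Ls = exp (C2 * S)"
  define Q where "Q = C0 * (1 + Ls)"
  define Q' where "Q' = (Q + C * (M + 1) + Ls * BF) * \<mu>"
  have BF: "0 \<le> BF" using F_bound[of undefined] norm_ge_zero order_trans by blast
  have pos: "0 \<le> \<mu>" "0 < S" "0 \<le> C2" "0 < Ls" "0 \<le> Q" "0 \<le> Q'"
    unfolding Q'_def Q_def Ls_def C2_def S_def \<mu>_def
    using C0 C(1) M \<delta> a(2) b(2) L BF by (auto intro!: add_nonneg_pos add_nonneg_nonneg mult_nonneg_nonneg divide_nonneg_pos)
  \<comment> \<open>The entries ensure in this order that \<open>step\<close> applies, that
    \<open>h \<le> 1\<close>, that \<open>h * L \<le> 1/2\<close>, that
    \<open>h * a x \<le> 1\<close>, that the errors \<open>Q * h\<^sup>2\<close> of all steps add up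
    to at most \<open>1\<close>, and that the integral error of one step is at most
    \<open>h * (\<delta> / 2)\<close>.\<close>
  define h1 where "h1 = Min {h0, 1, 1 / (2 * L + 1), 1 / (\<bar>A\<bar> + 1), 1 / (Q * S + 1), \<delta> / (2 * Q' + 1)}"
  have h1: "0 < h1" using h0 L pos \<delta> by (simp add: h1_def add_nonneg_pos)
  obtain N :: nat where N: "S / h1 < N" using reals_Archimedean2 by blast
  define h where "h = S / N"
  have "0 < real N" using N pos h1 by (meson divide_pos_pos less_trans)
  then have h: "0 < h" "h \<le> h1" "N * h = S"
    using N pos h1 by (auto simp: h_def field_simps)
  have "h \<le> h0" "h \<le> 1" "h \<le> 1 / (2 * L + 1)" "h \<le> 1 / (\<bar>A\<bar> + 1)" "h \<le> 1 / (Q * S + 1)" "h \<le> \<delta> / (2 * Q' + 1)"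
    using h(2) by (auto simp: h1_def)
  moreover have "0 < 2 * L + 1" "0 < Q * S + 1" "0 < 2 * Q' + 1"
    using L pos by (auto intro: add_nonneg_pos)
  ultimately have hb: "h \<le> h0" "h \<le> 1" "h * (2 * L + 1) \<le> 1" "h * (\<bar>A\<bar> + 1) \<le> 1" "h * (Q * S + 1) \<le> 1" "h * (2 * Q' + 1) \<le> \<delta>"
    by (auto simp: pos_le_divide_eq)
  have hL: "h * L \<le> 1/2" and hQ: "h * (Q * S) \<le> 1" and hQ': "h * Q' \<le> \<delta> / 2"
    using hb h(1) by (auto simp: algebra_simps)
  have hA: "h * a x \<le> 1" if "x \<in> Y" for x
  proof -
    have "h * a x \<le> h * (\<bar>A\<bar> + 1)" using a(4)[OF that] h(1) by (intro mult_left_mono) auto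
    then show ?thesis using hb by simp
  qed
  have E: "x + h *\<^sub>R F x \<in> Y" if "x \<in> Y" for x
    using euler_map_bij_betw[OF lip off _ hL L] h(1) that by (auto simp: bij_betw_def)
  have lm: "Y \<in> lmeasurable" using Y by (simp add: lmeasurable_open)
  have "\<exists>w. (\<forall>x\<in>Y. \<forall>y\<in>Y. \<bar>w x - w y\<bar> \<le> ((1 + h * C2) ^ k - 1) * norm (x - y)) \<and>
    (\<forall>x\<in>Y. 0 \<le> w x \<and> w x \<le> M + k * (Q * h\<^sup>2) \<and> V x \<le> w x) \<and>
    integral Y w \<le> M * \<mu> - k * (h * (\<delta> / 2))" if "k \<le> N" for k
    using that
  proof (induction k)
    case 0
    have "integral Y (\<lambda>x. M) = M * \<mu>"
      using lmeasure_integral[OF lm] integral_mult_right[of Y M "\<lambda>x. 1"] by (simp add: \<mu>_def)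
    then show ?case using M V by (intro exI[of _ "\<lambda>x. M"]) auto
  next
    case (Suc k)
    define l where "l = (1 + h * C2) ^ k - 1"
    define B where "B = M + k * (Q * h\<^sup>2)"
    from Suc obtain w where
      w1: "\<And>x y. x \<in> Y \<Longrightarrow> y \<in> Y \<Longrightarrow> \<bar>w x - w y\<bar> \<le> l * norm (x - y)" and
      w2: "\<And>x. x \<in> Y \<Longrightarrow> 0 \<le> w x" "\<And>x. x \<in> Y \<Longrightarrow> w x \<le> B" "\<And>x. x \<in> Y \<Longrightarrow> V x \<le> w x" and
      w3: "integral Y w \<le> M * \<mu> - k * (h * (\<delta> / 2))"
      unfolding l_def B_def by auto
    have kh: "k * h \<le> S" using Suc.prems h mult_right_mono[of "real k" "real N" h] by simp
    have l: "0 \<le> l" "l \<le> Ls"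
    proof -
      show "0 \<le> l" using h(1) pos by (simp add: l_def one_le_power)
      have "(1 + h * C2) ^ k \<le> exp (h * C2) ^ k"
        using h(1) pos by (intro power_mono exp_ge_add_one_self) auto
      also have "\<dots> = exp (C2 * (k * h))" by (simp add: exp_of_nat_mult[symmetric] mult_ac)
      also have "\<dots> \<le> Ls" using kh pos by (simp add: Ls_def mult_left_mono)
      finally show "l \<le> Ls" by (simp add: l_def)
    qed
    have B: "M \<le> B" "B \<le> M + 1"
    proof -
      show "M \<le> B" using pos by (simp add: B_def)
      have "k * (Q * h\<^sup>2) = (k * h) * (Q * h)" by (simp add: power2_eq_square)
      also have "\<dots> \<le> S * (Q * h)" using kh pos h by (intro mult_right_mono) auto
      also have "\<dots> \<le> 1" using hQ by (simp add: mult_ac)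
      finally show "B \<le> M + 1" by (simp add: B_def)
    qed
    have cw: "continuous_on Y w"
      by (rule lipschitz_imp_continuous_on[of _ _ l]) (use w1 in auto)
    have euler: "integral Y (\<lambda>x. (1 + h * d x - C * h\<^sup>2) * w (x + h *\<^sub>R F x)) \<le> integral Y w"
      by (rule C(2)[rule_format, OF _ hb(2) hL cw, of B]) (use h w2 in auto)
    obtain w' where w': "\<forall>x\<in>Y. \<forall>y\<in>Y. \<bar>w' x - w' y\<bar> \<le> ((1 + h * C2) * (l + 1) - 1) * norm (x - y)"
      "\<forall>x\<in>Y. 0 \<le> w' x \<and> w' x \<le> B + Q * h\<^sup>2 \<and> V x \<le> w' x"
      "integral Y w' \<le> integral Y w + h * (integral Y b - integral Y w) + h\<^sup>2 * Q'"
      unfolding Q'_def Q_def C2_def \<mu>_def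
      using transport_comparison_step[OF lip L Y E d(1,3) F_bound a(1,3) hA b(1,3,4) ad a(2) b(2) C(1) C0 l h(1) B euler
          step[OF h(1) hb(1)] w1 w2] by blast
    \<comment> \<open>As \<open>w\<close> lies between \<open>V\<close> and \<open>M + 1\<close>,
      its integral exceeds that of \<open>b\<close> by at least \<open>\<delta>\<close>. Half of the
      resulting decrease \<open>h * \<delta>\<close> is spent on the error
      \<open>h\<^sup>2 * Q'\<close>.\<close>
    have "v \<le> integral Y w" by (rule v[OF cw]) (use w2 B in \<open>auto intro: order_trans\<close>)
    then have "h * (integral Y b - integral Y w) \<le> h * (- \<delta>)"
      using h(1) by (intro mult_left_mono) (auto simp: \<delta>_def)
    moreover have "h\<^sup>2 * Q' \<le> h * (\<delta> / 2)"
      using mult_left_mono[OF hQ', of h] h(1) by (simp add: power2_eq_square mult_ac)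
    moreover have "h * (- \<delta>) = - 2 * (h * (\<delta> / 2))" by simp
    moreover have "Suc k * (h * (\<delta> / 2)) = k * (h * (\<delta> / 2)) + h * (\<delta> / 2)"
      by (simp only: of_nat_Suc distrib_right mult_1 add.commute)
    ultimately have "integral Y w' \<le> M * \<mu> - Suc k * (h * (\<delta> / 2))"
      using w'(3) w3 by linarith
    moreover have "(1 + h * C2) * (l + 1) = (1 + h * C2) ^ Suc k" by (simp add: l_def)
    moreover have "B + Q * h\<^sup>2 = M + Suc k * (Q * h\<^sup>2)" by (simp add: B_def algebra_simps)
    ultimately show ?case using w'(1,2) by (intro exI[of _ w']) (simp only: simp_thms)
  qed
  from this[of N] obtain w where w: "\<forall>x\<in>Y. 0 \<le> w x" "integral Y w \<le> M * \<mu> - N * (h * (\<delta> / 2))"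
    by auto
  have "N * (h * (\<delta> / 2)) = S * (\<delta> / 2)" using h(3) by (simp add: mult.assoc[symmetric])
  also have "\<dots> = M * \<mu> + \<delta> / 2" using \<delta> by (simp add: S_def field_simps)
  finally have "integral Y w < 0" using w(2) \<delta> by linarith
  \<comment> \<open>The sign holds in either case, since \<open>integral\<close> defaults to
    \<open>0\<close> for a function that is not integrable.\<close>
  moreover have "0 \<le> integral Y w" using w(1) by (cases "w integrable_on Y") (auto simp: integral_nonneg not_integrable_integral)
  ultimately show False by simp
qed

section \<open>Polynomials and extensions by zero\<close>

text \<open>The sup bound and the Lipschitz bound must be carried through the induction together:
  the Lipschitz bound of a product uses the sup bounds of its factors.\<close>

lemma real_polynomial_function_lipschitz_bounded:
  fixes p :: "'a::real_normed_vector \<Rightarrow> real"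
  assumes "real_polynomial_function p" and S: "bounded S"
  shows "\<exists>B\<ge>0. (\<forall>x\<in>S. \<bar>p x\<bar> \<le> B) \<and> (\<forall>x\<in>S. \<forall>y\<in>S. \<bar>p x - p y\<bar> \<le> B * norm (x - y))"
  using assms(1)
proof (induction rule: real_polynomial_function.induct)
  case (linear f)
  interpret bounded_linear f by fact
  obtain K where K: "K > 0" "\<And>x. norm (f x) \<le> norm x * K" using pos_bounded by blast
  obtain R where R: "R > 0" "\<And>x. x \<in> S \<Longrightarrow> norm x \<le> R" using S by (auto simp: bounded_pos)
  show ?case
  proof (intro exI[of _ "K + R * K"] conjI ballI)
    show "0 \<le> K + R * K" using K R by simp
    fix x assume "x \<in> S"
    then have "norm x * K \<le> R * K" using R K by (intro mult_right_mono) auto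
    then show "\<bar>f x\<bar> \<le> K + R * K" using K(2)[of x, unfolded real_norm_def] K(1) by linarith
    fix y
    have "\<bar>f x - f y\<bar> \<le> K * norm (x - y)" using K(2)[of "x - y"] by (simp add: diff mult.commute)
    also have "\<dots> \<le> (K + R * K) * norm (x - y)" using K R by (intro mult_right_mono) auto
    finally show "\<bar>f x - f y\<bar> \<le> (K + R * K) * norm (x - y)" .
  qed
next
  case (const c)
  show ?case by (intro exI[of _ "\<bar>c\<bar>"]) auto
next
  case (add f g)
  then obtain A B where "0 \<le> A" "0 \<le> B" and
    f: "\<And>x. x \<in> S \<Longrightarrow> \<bar>f x\<bar> \<le> A" "\<And>x y. x \<in> S \<Longrightarrow> y \<in> S \<Longrightarrow> \<bar>f x - f y\<bar> \<le> A * norm (x - y)" and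
    g: "\<And>x. x \<in> S \<Longrightarrow> \<bar>g x\<bar> \<le> B" "\<And>x y. x \<in> S \<Longrightarrow> y \<in> S \<Longrightarrow> \<bar>g x - g y\<bar> \<le> B * norm (x - y)"
    by auto
  show ?case
  proof (intro exI[of _ "A + B"] conjI ballI)
    show "0 \<le> A + B" using \<open>0 \<le> A\<close> \<open>0 \<le> B\<close> by simp
    fix x assume x: "x \<in> S"
    show "\<bar>f x + g x\<bar> \<le> A + B" using f(1)[OF x] g(1)[OF x] by linarith
    fix y assume y: "y \<in> S"
    show "\<bar>(f x + g x) - (f y + g y)\<bar> \<le> (A + B) * norm (x - y)"
      using f(2)[OF x y] g(2)[OF x y] unfolding distrib_right by linarith
  qed
next
  case (mult f g)
  then obtain A B where AB: "0 \<le> A" "0 \<le> B" and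
    f: "\<And>x. x \<in> S \<Longrightarrow> \<bar>f x\<bar> \<le> A" "\<And>x y. x \<in> S \<Longrightarrow> y \<in> S \<Longrightarrow> \<bar>f x - f y\<bar> \<le> A * norm (x - y)" and
    g: "\<And>x. x \<in> S \<Longrightarrow> \<bar>g x\<bar> \<le> B" "\<And>x y. x \<in> S \<Longrightarrow> y \<in> S \<Longrightarrow> \<bar>g x - g y\<bar> \<le> B * norm (x - y)"
    by auto
  show ?case
  proof (intro exI[of _ "2 * (A * B)"] conjI ballI)
    show "0 \<le> 2 * (A * B)" using AB by simp
    fix x assume x: "x \<in> S"
    have "\<bar>f x * g x\<bar> \<le> A * B" unfolding abs_mult using f(1)[OF x] g(1)[OF x] AB by (intro mult_mono) auto
    also have "\<dots> \<le> 2 * (A * B)" using AB by simp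
    finally show "\<bar>f x * g x\<bar> \<le> 2 * (A * B)" .
    fix y assume y: "y \<in> S"
    have "\<bar>f x * (g x - g y)\<bar> \<le> A * (B * norm (x - y))"
      unfolding abs_mult using f(1)[OF x] g(2)[OF x y] AB by (intro mult_mono) auto
    moreover have "\<bar>(f x - f y) * g y\<bar> \<le> (A * norm (x - y)) * B"
      unfolding abs_mult using g(1)[OF y] f(2)[OF x y] AB by (intro mult_mono) auto
    moreover have "f x * g x - f y * g y = f x * (g x - g y) + (f x - f y) * g y"
      by (simp add: algebra_simps)
    ultimately show "\<bar>f x * g x - f y * g y\<bar> \<le> 2 * (A * B) * norm (x - y)"
      by (simp add: algebra_simps)
  qed
qed

lemma polynomial_function_lipschitz_bounded:
  fixes p :: "'a::real_normed_vector \<Rightarrow> 'b::euclidean_space"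
  assumes "polynomial_function p" and S: "bounded S"
  shows "\<exists>B\<ge>0. (\<forall>x\<in>S. norm (p x) \<le> B) \<and> (\<forall>x\<in>S. \<forall>y\<in>S. norm (p x - p y) \<le> B * norm (x - y))"
proof -
  have "\<forall>b\<in>Basis. \<exists>B\<ge>0. (\<forall>x\<in>S. \<bar>p x \<bullet> b\<bar> \<le> B) \<and> (\<forall>x\<in>S. \<forall>y\<in>S. \<bar>p x \<bullet> b - p y \<bullet> b\<bar> \<le> B * norm (x - y))"
  proof
    fix b :: 'b assume "b \<in> Basis"
    have "real_polynomial_function (\<lambda>x. p x \<bullet> b)"
      using assms(1) bounded_linear_inner_left[of b] unfolding polynomial_function_def o_def by blast
    from real_polynomial_function_lipschitz_bounded[OF this S]
    show "\<exists>B\<ge>0. (\<forall>x\<in>S. \<bar>p x \<bullet> b\<bar> \<le> B) \<and> (\<forall>x\<in>S. \<forall>y\<in>S. \<bar>p x \<bullet> b - p y \<bullet> b\<bar> \<le> B * norm (x - y))" .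
  qed
  from bchoice[OF this] obtain B where "\<forall>b\<in>Basis. 0 \<le> B b \<and> (\<forall>x\<in>S. \<bar>p x \<bullet> b\<bar> \<le> B b) \<and>
    (\<forall>x\<in>S. \<forall>y\<in>S. \<bar>p x \<bullet> b - p y \<bullet> b\<bar> \<le> B b * norm (x - y))" ..
  then have B: "\<And>b. b \<in> Basis \<Longrightarrow> 0 \<le> B b" "\<And>b x. b \<in> Basis \<Longrightarrow> x \<in> S \<Longrightarrow> \<bar>p x \<bullet> b\<bar> \<le> B b"
    "\<And>b x y. b \<in> Basis \<Longrightarrow> x \<in> S \<Longrightarrow> y \<in> S \<Longrightarrow> \<bar>p x \<bullet> b - p y \<bullet> b\<bar> \<le> B b * norm (x - y)"
    by blast+
  show ?thesis
  proof (intro exI[of _ "sum B Basis"] conjI ballI)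
    show "0 \<le> sum B Basis" using B by (intro sum_nonneg)
    fix x assume x: "x \<in> S"
    show "norm (p x) \<le> sum B Basis"
      using norm_le_l1[of "p x"] sum_mono[of Basis "\<lambda>b. \<bar>p x \<bullet> b\<bar>" B] B(2)[OF _ x] by force
    fix y assume y: "y \<in> S"
    have "norm (p x - p y) \<le> (\<Sum>b\<in>Basis. \<bar>(p x - p y) \<bullet> b\<bar>)" by (rule norm_le_l1)
    also have "\<dots> \<le> (\<Sum>b\<in>Basis. B b * norm (x - y))"
      using B(3)[OF _ x y] by (intro sum_mono) (simp add: inner_diff_left)
    finally show "norm (p x - p y) \<le> sum B Basis * norm (x - y)" by (simp add: sum_distrib_right)
  qed
qed

text \<open>\<open>p\<close> is controlled on \<open>S\<close> only. With one point in
  \<open>S\<close>, the difference is split so that \<open>p\<close> is evaluated off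
  \<open>S\<close> only where it is multiplied by the value \<open>0\<close> of
  \<open>r\<close>.\<close>

lemma lipschitz_mult_supported:
  fixes r :: "'a::real_normed_vector \<Rightarrow> real" and p :: "'a \<Rightarrow> 'b::real_normed_vector"
  assumes r: "\<And>x y. \<bar>r x - r y\<bar> \<le> K * norm (x - y)" "\<And>x. \<bar>r x\<bar> \<le> K" "\<And>x. x \<notin> S \<Longrightarrow> r x = 0"
    and p: "\<And>x. x \<in> S \<Longrightarrow> norm (p x) \<le> B" "\<And>x y. x \<in> S \<Longrightarrow> y \<in> S \<Longrightarrow> norm (p x - p y) \<le> B * norm (x - y)"
    and B: "0 \<le> B"
  shows "norm (r x *\<^sub>R p x - r y *\<^sub>R p y) \<le> 2 * K * B * norm (x - y)"
proof -
  have K: "0 \<le> K" using r(2)[of x] by linarith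
  have one: "norm (r x *\<^sub>R p x - r y *\<^sub>R p y) \<le> 2 * K * B * norm (x - y)" if x: "x \<in> S" for x y
  proof -
    have eq: "r x *\<^sub>R p x - r y *\<^sub>R p y = (r x - r y) *\<^sub>R p x + r y *\<^sub>R (p x - p y)"
      by (simp add: algebra_simps)
    have "norm ((r x - r y) *\<^sub>R p x) \<le> (K * norm (x - y)) * B"
      unfolding norm_scaleR using r(1)[of x y] p(1)[OF x] K by (intro mult_mono) auto
    moreover have "norm (r y *\<^sub>R (p x - p y)) \<le> K * (B * norm (x - y))"
    proof (cases "y \<in> S")
      case True
      then show ?thesis
        unfolding norm_scaleR using r(2)[of y] p(2)[OF x True] K by (intro mult_mono) auto
    next
      case False
      then show ?thesis using r(3) K B by simp
    qed
    ultimately show ?thesis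
      unfolding eq using norm_triangle_ineq[of "(r x - r y) *\<^sub>R p x" "r y *\<^sub>R (p x - p y)"]
      by (simp add: algebra_simps)
  qed
  show ?thesis
  proof (cases "x \<in> S \<or> y \<in> S")
    case True
    then show ?thesis using one[of x y] one[of y x] by (auto simp: norm_minus_commute)
  next
    case False
    then show ?thesis using r(3) K B by simp
  qed
qed

text \<open>\<open>X\<close> need not be convex, so a bounded gradient does not by itself bound
  \<open>\<rho>\<close> along a segment between two points of \<open>X\<close>. If the segment stays
  in the interior, the mean value theorem applies. Otherwise both endpoints are compared with a
  point of the segment outside the interior, where \<open>r\<close> is \<open>0\<close>, and the two
  distances add up to the length of the segment.\<close>

lemma C1_zero_extension_lipschitz:
  fixes r :: "'a::euclidean_space \<Rightarrow> real"
  assumes "C1_on X \<rho>" "compact X" "\<And>x. x \<in> frontier X \<Longrightarrow> \<rho> x = 0"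
    and r: "\<And>x. x \<in> X \<Longrightarrow> r x = \<rho> x" "\<And>x. x \<notin> X \<Longrightarrow> r x = 0"
  shows "\<exists>K\<ge>0. (\<forall>x. \<bar>r x\<bar> \<le> K) \<and> (\<forall>x y. \<bar>r x - r y\<bar> \<le> K * norm (x - y))"
proof -
  obtain G where \<rho>: "continuous_on X \<rho>" and G: "continuous_on X G" "\<And>x. x \<in> interior X \<Longrightarrow> GDERIV \<rho> x :> G x"
    using assms(1) by (auto simp: C1_on_def)
  have "bounded (G ` X)" "bounded (\<rho> ` X)"
    using \<rho> G(1) assms(2) by (auto intro: compact_imp_bounded compact_continuous_image)
  then obtain B1 B2 where B: "B1 > 0" "\<And>x. x \<in> X \<Longrightarrow> norm (G x) \<le> B1" "B2 > 0" "\<And>x. x \<in> X \<Longrightarrow> \<bar>\<rho> x\<bar> \<le> B2"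
    by (auto simp: bounded_pos)
  have closed: "closed X" using assms(2) by (rule compact_imp_closed)
  have seg: "\<bar>\<rho> y - \<rho> x\<bar> \<le> B1 * norm (y - x)"
    if xy: "x \<in> X" "y \<in> X" and int: "\<And>t. 0 < t \<Longrightarrow> t < 1 \<Longrightarrow> x + t *\<^sub>R (y - x) \<in> interior X" for x y
  proof -
    let ?c = "\<lambda>t. x + t *\<^sub>R (y - x)"
    have inX: "?c t \<in> X" if "t \<in> {0..1}" for t
      using that int[of t] xy interior_subset[of X] by (cases "t = 0"; cases "t = 1") auto
    have "\<exists>t\<in>{0<..<1}. \<rho> (?c 1) - \<rho> (?c 0) = (1 - 0) *\<^sub>R (y - x) \<bullet> G (?c t)"
    proof (rule mvt[where f = "\<lambda>t. \<rho> (?c t)" and f' = "\<lambda>t s. s *\<^sub>R (y - x) \<bullet> G (?c t)"])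
      show "continuous_on {0..1} (\<lambda>t. \<rho> (?c t))"
        by (rule continuous_on_compose2[OF \<rho>]) (auto intro!: continuous_intros inX)
      fix t :: real assume t: "0 < t" "t < 1"
      have "(?c has_derivative (\<lambda>s. s *\<^sub>R (y - x))) (at t)"
        by (auto intro!: derivative_eq_intros)
      moreover have "(\<rho> has_derivative (\<lambda>h. h \<bullet> G (?c t))) (at (?c t))"
        using G(2)[OF int[OF t]] by (simp add: gderiv_def inner_commute)
      ultimately show "((\<lambda>t. \<rho> (?c t)) has_derivative (\<lambda>s. s *\<^sub>R (y - x) \<bullet> G (?c t))) (at t)"
        by (rule has_derivative_compose)
    qed auto
    then obtain t where t: "0 < t" "t < 1" "\<rho> y - \<rho> x = (y - x) \<bullet> G (?c t)" by auto
    have "\<bar>(y - x) \<bullet> G (?c t)\<bar> \<le> norm (y - x) * norm (G (?c t))" by (rule Cauchy_Schwarz_ineq2)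
    also have "\<dots> \<le> norm (y - x) * B1" using inX[of t] t B by (intro mult_left_mono) auto
    finally show ?thesis using t by (simp add: mult.commute)
  qed
  have r0: "r x = 0" if "x \<notin> interior X" for x
    using that r[of x] assms(3)[of x] closed by (cases "x \<in> X") (auto simp: frontier_def)
  \<comment> \<open>On the way from \<open>x\<close> to \<open>z\<close>, the first point outside
    the interior belongs to \<open>X\<close> by closedness, hence is a boundary point where
    \<open>\<rho>\<close> is \<open>0\<close>. The segment up to it lies in the interior, so
    \<open>seg\<close> applies.\<close>
  have exit: "\<bar>r x\<bar> \<le> B1 * norm (z - x)" if z: "z \<notin> interior X" for x z
  proof (cases "x \<in> interior X")
    case True
    let ?c = "\<lambda>t. x + t *\<^sub>R (z - x)"
    define A where "A = {0..1} \<inter> ?c -` (- interior X)"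
    have "compact A" unfolding A_def
      by (intro compact_Int_closed continuous_closed_vimage) (auto intro!: continuous_intros)
    moreover have "1 \<in> A" using z by (simp add: A_def)
    ultimately obtain t0 where t0: "t0 \<in> A" "\<And>t. t \<in> A \<Longrightarrow> t0 \<le> t"
      using compact_attains_inf[of A] by blast
    have "t0 \<noteq> 0" using t0(1) True by (auto simp: A_def)
    then have t01: "0 < t0" "t0 \<le> 1" using t0(1) by (auto simp: A_def)
    have before: "?c t \<in> interior X" if "0 \<le> t" "t < t0" for t
      using t0(2)[of t] that t01 by (force simp: A_def)
    have "?c ` closure {0..<t0} \<subseteq> X"
    proof (rule image_closure_subset)
      show "?c ` {0..<t0} \<subseteq> X" using before interior_subset[of X] by auto
    qed (auto intro!: continuous_intros closed)
    moreover have "t0 \<in> closure {0..<t0}" using t01 by simp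
    ultimately have inX: "?c t0 \<in> X" by blast
    have "\<bar>\<rho> (?c t0) - \<rho> x\<bar> \<le> B1 * norm (?c t0 - x)"
    proof (rule seg)
      show "x \<in> X" using True interior_subset by blast
      fix t :: real assume "0 < t" "t < 1"
      then have "?c (t * t0) \<in> interior X" using t01 by (intro before) auto
      then show "x + t *\<^sub>R (?c t0 - x) \<in> interior X" by simp
    qed (rule inX)
    moreover have "\<rho> (?c t0) = 0" using r0[of "?c t0"] r(1)[OF inX] t0(1) by (simp add: A_def)
    ultimately have "\<bar>\<rho> x\<bar> \<le> B1 * norm (?c t0 - x)" by simp
    also have "\<dots> \<le> B1 * norm (z - x)"
      using t01 B(1) by (intro mult_left_mono) (simp_all add: mult_left_le_one_le)
    finally have "\<bar>\<rho> x\<bar> \<le> B1 * norm (z - x)" .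
    then show ?thesis using r(1)[of x] True interior_subset[of X] by auto
  next
    case False
    then show ?thesis using r0 B by simp
  qed
  have "\<bar>r x - r y\<bar> \<le> B1 * norm (x - y)" for x y
  proof (cases "\<exists>t. 0 \<le> t \<and> t \<le> 1 \<and> x + t *\<^sub>R (y - x) \<notin> interior X")
    case True
    then obtain t where t: "0 \<le> t" "t \<le> 1" "x + t *\<^sub>R (y - x) \<notin> interior X" by blast
    have "\<bar>r x\<bar> \<le> B1 * (t * norm (y - x))" using exit[OF t(3), of x] t by simp
    moreover have "\<bar>r y\<bar> \<le> B1 * ((1 - t) * norm (y - x))"
    proof -
      have "x + t *\<^sub>R (y - x) - y = (1 - t) *\<^sub>R (x - y)" by (simp add: algebra_simps)
      then show ?thesis using exit[OF t(3), of y] t by (simp add: norm_minus_commute)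
    qed
    moreover have "B1 * (t * norm (y - x)) + B1 * ((1 - t) * norm (y - x)) = B1 * norm (x - y)"
      by (simp add: algebra_simps norm_minus_commute)
    ultimately show ?thesis by linarith
  next
    case False
    then have int: "x + t *\<^sub>R (y - x) \<in> interior X" if "0 \<le> t" "t \<le> 1" for t using that by blast
    have "x \<in> X" "y \<in> X" using int[of 0] int[of 1] interior_subset[of X] by auto
    then show ?thesis using seg[of x y] int r(1) by (simp add: norm_minus_commute abs_minus_commute)
  qed
  moreover have "\<bar>r x\<bar> \<le> B2" for x using r B by (cases "x \<in> X") auto
  ultimately show ?thesis
    using B by (intro exI[of _ "B1 + B2"])
      (auto simp: distrib_right intro: order_trans add_increasing add_increasing2)
qed

text \<open>
  A line through a point \<open>a\<close> with \<open>p a \<noteq> 0\<close> meets the zero set in finitely many points, so no point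
  lies in infinitely many of the dilations of the zero set about \<open>a\<close> with the factors \<open>t k\<close>.
\<close>

lemma negligible_zeros_real_polynomial_function:
  fixes p :: "'a::euclidean_space \<Rightarrow> real"
  assumes p: "real_polynomial_function p" and a: "p a \<noteq> 0"
  shows "negligible {x. p x = 0}"
proof -
  have cont: "continuous_on UNIV p"
    using p continuous_on_polymonial_function real_polynomial_function_eq by blast
  have closed: "closed {x. p x = 0}"
    using continuous_closed_vimage[of "{0}" p] cont
    by (simp add: vimage_def continuous_on_eq_continuous_at)
  \<comment> \<open>Distinct dilation factors between \<open>1\<close> and \<open>2\<close>: a
    dilate loses no measure, and all dilates of a bounded set lie in a common ball.\<close>
  define t where "t k = 1 + 1 / real (Suc k)" for k
  have t: "1 \<le> t k" "t k \<le> 2" for k by (auto simp: t_def)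
  have "inj t" by (auto simp: inj_on_def t_def)
  have finite_line: "finite {k. p (a + (1 / t k) *\<^sub>R y) = 0}" for y
  proof -
    let ?q = "\<lambda>s. p (a + s *\<^sub>R y)"
    have "real_polynomial_function (p \<circ> (\<lambda>s. a + s *\<^sub>R y))"
      using p by (intro real_polynomial_function_compose polynomial_function_add polynomial_function_const
          polynomial_function_bounded_linear bounded_linear_scaleR_left)
    then obtain c n where q: "?q = (\<lambda>s. \<Sum>i\<le>n. c i * s ^ i)"
      by (auto simp: real_polynomial_function_iff_sum o_def)
    \<comment> \<open>At \<open>s = 0\<close> the polynomial takes the value \<open>p a\<close>,
      which is nonzero.\<close>
    have "\<exists>i\<le>n. c i \<noteq> 0"
    proof (rule ccontr)
      assume "\<not> ?thesis"
      then show False using a fun_cong[OF q, of 0] by simp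
    qed
    then have "finite {s. (\<Sum>i\<le>n. c i * s ^ i) = 0}" using polyfun_rootbound_finite by blast
    then have "finite {s. ?q s = 0}" by (simp only: fun_cong[OF q])
    moreover have "(\<lambda>k. 1 / t k) ` {k. p (a + (1 / t k) *\<^sub>R y) = 0} \<subseteq> {s. ?q s = 0}" by auto
    ultimately have "finite ((\<lambda>k. 1 / t k) ` {k. p (a + (1 / t k) *\<^sub>R y) = 0})"
      by (rule finite_subset[rotated])
    moreover have "inj_on (\<lambda>k. 1 / t k) {k. p (a + (1 / t k) *\<^sub>R y) = 0}"
      using \<open>inj t\<close> by (auto simp: inj_on_def)
    ultimately show ?thesis by (rule finite_imageD)
  qed
  have "negligible ({x. p x = 0} \<inter> cball a R)" for R
  proof (rule ccontr)
    define S where "S = {x. p x = 0} \<inter> cball a R"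
    assume "\<not> negligible ({x. p x = 0} \<inter> cball a R)"
    then have nn: "\<not> negligible S" by (simp add: S_def)
    have S: "S \<in> lmeasurable"
      unfolding S_def using closed by (intro lmeasurable_compact closed_Int_compact) auto
    have m: "0 < measure lebesgue S"
      using nn S by (simp add: negligible_iff_measure zero_less_measure_iff)
    define A where "A k = (\<lambda>x. t k *\<^sub>R x + (a - t k *\<^sub>R a)) ` S" for k
    have memA: "a + (1 / t k) *\<^sub>R (x - a) \<in> S" if xA: "x \<in> A k" for x k
    proof -
      obtain z where z: "z \<in> S" "x = t k *\<^sub>R z + (a - t k *\<^sub>R a)" using xA by (auto simp: A_def)
      have "x - a = t k *\<^sub>R (z - a)" using z by (simp add: algebra_simps)
      then have "(1 / t k) *\<^sub>R (x - a) = z - a" using t[of k] by simp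
      then show ?thesis using z by simp
    qed
    have A: "A k \<in> lmeasurable" "measure lebesgue S \<le> measure lebesgue (A k)" "A k \<subseteq> cball a (2 * \<bar>R\<bar>)" for k
    proof -
      have "compact S" unfolding S_def using closed by (intro closed_Int_compact) auto
      then show "A k \<in> lmeasurable"
        unfolding A_def by (intro lmeasurable_compact compact_continuous_image continuous_intros)
      have "measure lebesgue (A k) = \<bar>t k\<bar> ^ DIM('a) * measure lebesgue S"
        unfolding A_def by (rule measure_lebesgue_affine)
      moreover have "1 \<le> \<bar>t k\<bar> ^ DIM('a)" using t[of k] by (intro one_le_power) auto
      ultimately show "measure lebesgue S \<le> measure lebesgue (A k)"
        using m mult_right_mono[of 1 "\<bar>t k\<bar> ^ DIM('a)" "measure lebesgue S"] by simp
      show "A k \<subseteq> cball a (2 * \<bar>R\<bar>)"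
      proof
        fix x assume "x \<in> A k"
        then have "norm ((1 / t k) *\<^sub>R (x - a)) \<le> \<bar>R\<bar>"
          using memA[of x k] by (auto simp: S_def dist_norm)
        moreover have "norm ((1 / t k) *\<^sub>R (x - a)) = norm (x - a) / t k" using t[of k] by simp
        ultimately have "norm (x - a) \<le> t k * \<bar>R\<bar>"
          using t[of k] by (simp add: pos_divide_le_eq mult.commute)
        also have "\<dots> \<le> 2 * \<bar>R\<bar>" using t[of k] by (intro mult_right_mono) auto
        finally show "x \<in> cball a (2 * \<bar>R\<bar>)" by (simp add: dist_norm norm_minus_commute)
      qed
    qed
    \<comment> \<open>These sets decrease within a bounded region and each has at least the measure
      of \<open>S\<close>, so their intersection has positive measure. A point of it lies in
      infinitely many dilates, against \<open>finite_line\<close>.\<close>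
    define B where "B N = (\<Union>k\<in>{N..}. A k)" for N
    have B: "B N \<in> lmeasurable" for N
    proof (rule bounded_set_imp_lmeasurable)
      show "bounded (B N)" using A(3) by (intro bounded_subset[OF bounded_cball[of a "2 * \<bar>R\<bar>"]]) (auto simp: B_def)
      show "B N \<in> sets lebesgue" unfolding B_def using A(1) by (intro sets.countable_UN') auto
    qed
    have "(\<lambda>N. measure lebesgue (B N)) \<longlonglongrightarrow> measure lebesgue (\<Inter>N. B N)"
    proof (rule Lim_measure_decseq)
      show "decseq B" unfolding decseq_def B_def by (intro allI impI UN_mono) auto
      show "range B \<subseteq> sets lebesgue" using B by (blast intro: fmeasurableD)
      show "emeasure lebesgue (B N) \<noteq> \<infinity>" for N using fmeasurableD2[OF B[of N]] by simp
    qed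
    moreover have "measure lebesgue S \<le> measure lebesgue (B N)" for N
      using A(2)[of N] measure_mono_fmeasurable[of "A N" "B N" lebesgue] A(1) B
      by (force simp: B_def)
    ultimately have "measure lebesgue S \<le> measure lebesgue (\<Inter>N. B N)"
      by (intro LIMSEQ_le_const) auto
    then have "(\<Inter>N. B N) \<noteq> {}" using m by auto
    then obtain x where x: "\<And>N. x \<in> B N" by auto
    have "infinite {k. p (a + (1 / t k) *\<^sub>R (x - a)) = 0}"
      unfolding infinite_nat_iff_unbounded_le
    proof
      fix N
      obtain k where "N \<le> k" "x \<in> A k" using x[of N] by (auto simp: B_def)
      then show "\<exists>k\<ge>N. k \<in> {k. p (a + (1 / t k) *\<^sub>R (x - a)) = 0}"
        using memA[of x k] by (auto simp: S_def)
    qed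
    then show False using finite_line by blast
  qed
  then have "negligible (\<Union>n::nat. {x. p x = 0} \<inter> cball a n)"
    by (intro negligible_countable_Union) auto
  moreover have "(\<Union>n::nat. {x. p x = 0} \<inter> cball a n) = {x. p x = 0}"
    using real_arch_simple by auto
  ultimately show ?thesis by simp
qed

text \<open>An identically vanishing \<open>g i\<close> imposes no condition. If all other
  \<open>g i\<close> are positive at a point, they are positive nearby, so the point is interior.
  The non-interior points hence lie in finitely many zero sets of nonzero polynomials.\<close>

lemma negligible_semialg_set_minus_interior:
  fixes g :: "nat \<Rightarrow> 'a::euclidean_space \<Rightarrow> real"
  assumes g: "\<And>i. i \<in> {1..ng} \<Longrightarrow> real_polynomial_function (g i)"
  shows "negligible (semialg_set ng g - interior (semialg_set ng g))"
proof -
  define I where "I = {i \<in> {1..ng}. \<exists>a. g i a \<noteq> 0}"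
  have "negligible (\<Union>i\<in>I. {x. g i x = 0})"
    using g by (intro negligible_Union) (auto simp: I_def intro: negligible_zeros_real_polynomial_function)
  moreover have "semialg_set ng g - interior (semialg_set ng g) \<subseteq> (\<Union>i\<in>I. {x. g i x = 0})"
  proof
    fix x assume x: "x \<in> semialg_set ng g - interior (semialg_set ng g)"
    show "x \<in> (\<Union>i\<in>I. {x. g i x = 0})"
    proof (rule ccontr)
      assume nx: "x \<notin> (\<Union>i\<in>I. {x. g i x = 0})"
      define W where "W = (\<Inter>i\<in>I. {y. 0 < g i y})"
      have "open W" unfolding W_def
      proof (intro open_INT ballI)
        fix i assume "i \<in> I"
        then have "continuous_on UNIV (g i)"
          using g[of i] continuous_on_polymonial_function real_polynomial_function_eq by (auto simp: I_def)
        then show "open {y. 0 < g i y}" by (intro open_Collect_less continuous_intros)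
      qed (simp add: I_def)
      moreover have "x \<in> W"
        using x nx by (force simp: W_def I_def semialg_set_def)
      moreover have "W \<subseteq> semialg_set ng g"
      proof
        fix y assume "y \<in> W"
        then have "0 \<le> g i y" if "i \<in> {1..ng}" for i
          using that by (cases "i \<in> I") (auto simp: W_def I_def intro: less_imp_le)
        then show "y \<in> semialg_set ng g" by (simp add: semialg_set_def)
      qed
      ultimately show False using x interiorI by blast
    qed
  qed
  ultimately show ?thesis by (rule negligible_subset)
qed

section \<open>Costs attainable in finite time\<close>

text \<open>Picard's fixed point argument with contraction factor \<open>L * T \<le> 1/2\<close>. A
  short horizon is enough, since each Euler step only needs a duration proportional to
  \<open>h\<close>.\<close>

lemma lipschitz_ode_solution_exists:
  fixes q :: "'a::euclidean_space \<Rightarrow> 'a"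
  assumes lip: "\<And>x y. norm (q x - q y) \<le> L * norm (x - y)" and L: "0 \<le> L"
    and T: "0 \<le> T" "L * T \<le> 1/2"
  shows "\<exists>z. continuous_on {0..T} z \<and> (\<forall>t\<in>{0..T}. ((\<lambda>s. q (z s)) has_integral (z t - x0)) {0..t})"
proof -
  have cq: "continuous_on A q" for A by (rule lipschitz_imp_continuous_on) (rule lip)
  \<comment> \<open>Clamping time to \<open>{0..T}\<close> lets the fixed point theorem run in the
    complete space of bounded continuous functions on the whole line.\<close>
  define c where "c t = max 0 (min t T)" for t :: real
  have c: "continuous_on A c" "c t \<in> {0..T}" for A t
    unfolding c_def using T by (auto intro!: continuous_intros)
  define P where "P \<phi> t = x0 + integral {0..c t} (\<lambda>s. q (\<phi> s))" for \<phi> t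
  have cqp: "continuous_on A (\<lambda>s. q (apply_bcontfun \<phi> s))" for A and \<phi> :: "real \<Rightarrow>\<^sub>C 'a"
    by (rule continuous_on_compose2[OF cq[of UNIV]]) auto
  have iq: "(\<lambda>s. q (apply_bcontfun \<phi> s)) integrable_on {0..t}" for \<phi> :: "real \<Rightarrow>\<^sub>C 'a" and t
    by (rule integrable_continuous_interval[OF cqp])
  have P: "P (apply_bcontfun \<phi>) \<in> bcontfun" for \<phi>
  proof -
    let ?g = "\<lambda>t. x0 + integral {0..t} (\<lambda>s. q (apply_bcontfun \<phi> s))"
    have g: "continuous_on {0..T} ?g"
      by (intro continuous_intros indefinite_integral_continuous_1 iq)
    have "continuous_on UNIV (P (apply_bcontfun \<phi>))"
      unfolding P_def by (rule continuous_on_compose2[OF g c(1)]) (use c in auto)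
    moreover have "range (P (apply_bcontfun \<phi>)) \<subseteq> ?g ` {0..T}"
      using c(2) by (auto simp: P_def)
    moreover have "bounded (?g ` {0..T})"
      by (intro compact_imp_bounded compact_continuous_image g) simp
    ultimately show ?thesis by (auto simp: bcontfun_def intro: bounded_subset)
  qed
  define PC where "PC \<phi> = Bcontfun (P (apply_bcontfun \<phi>))" for \<phi>
  have PC: "apply_bcontfun (PC \<phi>) = P (apply_bcontfun \<phi>)" for \<phi>
    unfolding PC_def using P by (rule Bcontfun_inverse)
  have "\<exists>!\<phi>. PC \<phi> = \<phi>"
  proof (rule banach_fix_type[of "1/2"], simp, simp, intro allI)
    fix \<phi> \<psi>
    show "dist (PC \<phi>) (PC \<psi>) \<le> 1/2 * dist \<phi> \<psi>"
    proof (rule dist_bound)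
      fix t
      have "norm (integral {0..c t} (\<lambda>s. q (apply_bcontfun \<phi> s) - q (apply_bcontfun \<psi> s))) \<le> (L * dist \<phi> \<psi>) * (c t - 0)"
      proof (rule integral_bound)
        show "continuous_on {0..c t} (\<lambda>s. q (apply_bcontfun \<phi> s) - q (apply_bcontfun \<psi> s))"
          by (intro continuous_intros cqp)
        fix s
        have "norm (q (apply_bcontfun \<phi> s) - q (apply_bcontfun \<psi> s)) \<le> L * norm (apply_bcontfun \<phi> s - apply_bcontfun \<psi> s)"
          by (rule lip)
        also have "\<dots> \<le> L * dist \<phi> \<psi>"
          using dist_bounded[of \<phi> s \<psi>] L by (intro mult_left_mono) (auto simp: dist_norm)
        finally show "norm (q (apply_bcontfun \<phi> s) - q (apply_bcontfun \<psi> s)) \<le> L * dist \<phi> \<psi>" .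
      qed (use c in auto)
      also have "\<dots> \<le> (L * dist \<phi> \<psi>) * T"
        using c(2)[of t] L by (intro mult_left_mono) auto
      also have "\<dots> = (L * T) * dist \<phi> \<psi>" by simp
      also have "\<dots> \<le> 1/2 * dist \<phi> \<psi>"
        using T by (intro mult_right_mono) auto
      finally show "dist (apply_bcontfun (PC \<phi>) t) (apply_bcontfun (PC \<psi>) t) \<le> 1/2 * dist \<phi> \<psi>"
        by (simp add: PC P_def dist_norm integral_diff iq)
    qed
  qed
  then obtain \<phi> where \<phi>: "PC \<phi> = \<phi>" by blast
  have "((\<lambda>s. q (apply_bcontfun \<phi> s)) has_integral (apply_bcontfun \<phi> t - x0)) {0..t}" if "t \<in> {0..T}" for t
  proof -
    have "apply_bcontfun \<phi> t = P (apply_bcontfun \<phi>) t" using PC[of \<phi>] \<phi> by simp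
    also have "\<dots> = x0 + integral {0..t} (\<lambda>s. q (apply_bcontfun \<phi> s))"
      using that by (simp add: P_def c_def)
    finally show ?thesis using iq[of \<phi> t] by (simp add: has_integral_iff)
  qed
  then show ?thesis by (intro exI[of _ "apply_bcontfun \<phi>"]) auto
qed

text \<open>\<open>p\<close> is Lipschitz on \<open>D\<close> only. Composing it with the
  nearest-point projection onto the convex set \<open>D\<close> makes it globally Lipschitz with the
  same constant. The speed bound keeps the solution within \<open>B * T\<close> of \<open>x\<close>,
  hence in \<open>S\<close>, where the projection is the identity. Along the solution the velocity
  differs from \<open>p x\<close> by at most \<open>B * (B * T)\<close>, which integrates to the
  Euler error \<open>(B * T)\<^sup>2\<close>.\<close>

lemma local_ode_solution_exists:
  fixes p :: "'a::euclidean_space \<Rightarrow> 'a"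
  assumes D: "closed D" "convex D" "S \<subseteq> D"
    and p: "\<And>y. y \<in> D \<Longrightarrow> norm (p y) \<le> B" "\<And>y z. y \<in> D \<Longrightarrow> z \<in> D \<Longrightarrow> norm (p y - p z) \<le> B * norm (y - z)"
    and B: "0 \<le> B" and T: "0 \<le> T" "B * T \<le> 1/2"
    and S: "\<And>y. norm (y - x) \<le> B * T \<Longrightarrow> y \<in> S"
  shows "\<exists>z. continuous_on {0..T} z \<and> (\<forall>t\<in>{0..T}. ((\<lambda>s. p (z s)) has_integral (z t - x)) {0..t} \<and>
    z t \<in> S \<and> norm (z t - x) \<le> B * T) \<and> norm (z T - (x + T *\<^sub>R p x)) \<le> (B * T)\<^sup>2"
proof -
  have x: "x \<in> S" by (rule S) (use B T in simp)
  have ne: "D \<noteq> {}" using x D by auto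
  define q where "q y = p (closest_point D y)" for y
  have cp: "closest_point D y \<in> D" for y by (rule closest_point_in_set[OF D(1) ne])
  have "norm (q y - q z) \<le> B * norm (y - z)" for y z
  proof -
    have "norm (q y - q z) \<le> B * norm (closest_point D y - closest_point D z)"
      unfolding q_def by (intro p cp)
    also have "\<dots> \<le> B * norm (y - z)"
      using closest_point_lipschitz[OF D(2,1) ne, of y z] B by (intro mult_left_mono) (auto simp: dist_norm)
    finally show ?thesis .
  qed
  from lipschitz_ode_solution_exists[OF this B T, of x] obtain z where
    z: "continuous_on {0..T} z" "\<And>t. t \<in> {0..T} \<Longrightarrow> ((\<lambda>s. q (z s)) has_integral (z t - x)) {0..t}"
    by blast
  have dist: "norm (z t - x) \<le> B * T" if t: "t \<in> {0..T}" for t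
  proof -
    have "norm (z t - x) \<le> B * measure lborel (cbox 0 t)"
      by (rule has_integral_bound[OF B]) (use z(2)[OF t] p(1)[OF cp] in \<open>auto simp: q_def\<close>)
    also have "\<dots> \<le> B * T" using t B by (auto intro: mult_left_mono)
    finally show ?thesis .
  qed
  have zS: "z t \<in> S" if "t \<in> {0..T}" for t using S[OF dist[OF that]] .
  have zq: "q (z t) = p (z t)" if "t \<in> {0..T}" for t
    using zS[OF that] D by (auto simp: q_def closest_point_self)
  have zp: "((\<lambda>s. p (z s)) has_integral (z t - x)) {0..t}" if t: "t \<in> {0..T}" for t
    by (rule has_integral_eq[OF _ z(2)[OF t]]) (use t zq in auto)
  have "((\<lambda>s. p x) has_integral (T *\<^sub>R p x)) {0..T}"
    using has_integral_const_real[of "p x" 0 T] T by simp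
  from has_integral_diff[OF zp[of T] this]
  have "((\<lambda>s. p (z s) - p x) has_integral (z T - x - T *\<^sub>R p x)) (cbox 0 T)" using T by simp
  then have "norm (z T - x - T *\<^sub>R p x) \<le> (B * (B * T)) * measure lborel (cbox 0 T)"
  proof (rule has_integral_bound[rotated])
    fix s assume s: "s \<in> cbox 0 T"
    have "norm (p (z s) - p x) \<le> B * norm (z s - x)"
      using s zS[of s] x D(3) by (intro p) auto
    also have "\<dots> \<le> B * (B * T)" using s dist B by (intro mult_left_mono) auto
    finally show "norm (p (z s) - p x) \<le> B * (B * T)" .
  qed (use B T in auto)
  then have "norm (z T - (x + T *\<^sub>R p x)) \<le> (B * T)\<^sup>2"
    using T by (simp add: diff_diff_eq power2_eq_square mult_ac)
  then show ?thesis using z(1) zp zS dist by blast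
qed

lemma has_integral_concat:
  fixes g1 g2 :: "real \<Rightarrow> 'a::banach"
  assumes g1: "(g1 has_integral I1) {0..T}" and g2: "(g2 has_integral I2) {0..s}" and "0 \<le> T" "0 \<le> s"
  shows "((\<lambda>t. if t \<le> T then g1 t else g2 (t - T)) has_integral (I1 + I2)) {0..T + s}"
proof (rule has_integral_combine[of 0 T])
  show "((\<lambda>t. if t \<le> T then g1 t else g2 (t - T)) has_integral I1) {0..T}"
    by (rule has_integral_eq[OF _ g1]) auto
  have "((\<lambda>t. g2 (t - T)) has_integral I2) {T..T + s}"
    using has_integral_shift_real_ivl[OF g2, of "- T"] by (simp add: add.commute)
  then show "((\<lambda>t. if t \<le> T then g1 t else g2 (t - T)) has_integral I2) {T..T + s}"
    by (rule has_integral_spike_finite[of "{T}", rotated 2]) auto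
qed (use assms in auto)

text \<open>
  Costs of strategies that stop at a finite time. Their infimum bounds the value function from
  above, and the dynamic programming inequality for it needs no infinite horizons.
\<close>

definition attainable_cost ::
  "(real ^ 'n \<Rightarrow> real ^ 'n) \<Rightarrow> ('m::finite \<Rightarrow> real ^ 'n \<Rightarrow> real ^ 'n) \<Rightarrow>
    (real ^ 'n \<Rightarrow> real) \<Rightarrow> ('m \<Rightarrow> real ^ 'n \<Rightarrow> real) \<Rightarrow>
    (real ^ 'n) set \<Rightarrow> (real ^ 'm) set \<Rightarrow> real \<Rightarrow> real \<Rightarrow> real ^ 'n \<Rightarrow> real \<Rightarrow> bool" where
  "attainable_cost f fu lx lu X U \<beta> M x c \<longleftrightarrow> (\<exists>T u z J. 0 \<le> T \<and> u \<in> borel_measurable borel \<and>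
    (\<forall>t\<in>{0..T}. u t \<in> U \<and> z t \<in> X \<and>
      ((\<lambda>s. controlled_field f fu (z s) (u s)) has_integral (z t - x)) {0..t}) \<and>
    ((\<lambda>t. exp (- \<beta> * t) * stage_cost lx lu (z t) (u t)) has_integral J) {0..T} \<and>
    c = J + exp (- \<beta> * T) * M)"

lemma attainable_cost_stop:
  assumes "x \<in> X" "u0 \<in> U"
  shows "attainable_cost f fu lx lu X U \<beta> M x M"
  unfolding attainable_cost_def
  by (intro exI[of _ 0] exI[of _ "\<lambda>_. u0"] exI[of _ "\<lambda>_. x"] exI[of _ "0::real"])
    (use assms in \<open>auto intro: has_integral_null_real\<close>)

text \<open>Shifting time by \<open>T\<close> multiplies the cost of the tail by
  \<open>exp (- \<beta> * T)\<close>. A constant initial control is all that a step with frozen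
  feedback uses.\<close>

lemma attainable_cost_prepend:
  assumes T: "0 \<le> T" and u0: "u0 \<in> U"
    and z: "\<And>t. t \<in> {0..T} \<Longrightarrow> z t \<in> X"
      "\<And>t. t \<in> {0..T} \<Longrightarrow> ((\<lambda>s. controlled_field f fu (z s) u0) has_integral (z t - x)) {0..t}"
    and J: "((\<lambda>t. exp (- \<beta> * t) * stage_cost lx lu (z t) u0) has_integral J) {0..T}"
    and c: "attainable_cost f fu lx lu X U \<beta> M (z T) c"
  shows "attainable_cost f fu lx lu X U \<beta> M x (J + exp (- \<beta> * T) * c)"
proof -
  from c obtain T' u' z' J' where T': "0 \<le> T'" and u': "u' \<in> borel_measurable borel"
    and z': "\<And>t. t \<in> {0..T'} \<Longrightarrow> u' t \<in> U" "\<And>t. t \<in> {0..T'} \<Longrightarrow> z' t \<in> X"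
      "\<And>t. t \<in> {0..T'} \<Longrightarrow> ((\<lambda>s. controlled_field f fu (z' s) (u' s)) has_integral (z' t - z T)) {0..t}"
    and J': "((\<lambda>t. exp (- \<beta> * t) * stage_cost lx lu (z' t) (u' t)) has_integral J') {0..T'}"
    and c: "c = J' + exp (- \<beta> * T') * M"
    unfolding attainable_cost_def by blast
  define u where "u t = (if t \<le> T then u0 else u' (t - T))" for t
  define w where "w t = (if t \<le> T then z t else z' (t - T))" for t
  have um: "u \<in> borel_measurable borel" unfolding u_def
    by (intro measurable_If measurable_compose[OF _ u']) auto
  have cf: "(\<lambda>s. controlled_field f fu (w s) (u s)) = (\<lambda>t. if t \<le> T then controlled_field f fu (z t) u0
      else controlled_field f fu (z' (t - T)) (u' (t - T)))"
    by (auto simp: w_def u_def)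
  have dyn: "u t \<in> U \<and> w t \<in> X \<and> ((\<lambda>s. controlled_field f fu (w s) (u s)) has_integral (w t - x)) {0..t}"
    if t: "t \<in> {0..T + T'}" for t
  proof (cases "t \<le> T")
    case True
    have "((\<lambda>s. controlled_field f fu (w s) (u s)) has_integral (z t - x)) {0..t}"
      by (rule has_integral_eq[OF _ z(2)[of t]]) (use t True in \<open>auto simp: w_def u_def\<close>)
    then show ?thesis using True t u0 z(1) by (auto simp: u_def w_def)
  next
    case False
    then have t': "t - T \<in> {0..T'}" using t by auto
    have "((\<lambda>s. controlled_field f fu (w s) (u s)) has_integral ((z T - x) + (z' (t - T) - z T))) {0..T + (t - T)}"
      unfolding cf by (rule has_integral_concat[OF z(2) z'(3)[OF t']]) (use T False in auto)
    then show ?thesis using False t' z' by (auto simp: u_def w_def)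
  qed
  have "((\<lambda>t. if t \<le> T then exp (- \<beta> * t) * stage_cost lx lu (z t) u0
      else exp (- \<beta> * T) * (exp (- \<beta> * (t - T)) * stage_cost lx lu (z' (t - T)) (u' (t - T))))
      has_integral (J + exp (- \<beta> * T) * J')) {0..T + T'}"
    by (rule has_integral_concat[OF J has_integral_mult_right[OF J']]) (use T T' in auto)
  moreover have "(\<lambda>t. if t \<le> T then exp (- \<beta> * t) * stage_cost lx lu (z t) u0
      else exp (- \<beta> * T) * (exp (- \<beta> * (t - T)) * stage_cost lx lu (z' (t - T)) (u' (t - T)))) =
      (\<lambda>t. exp (- \<beta> * t) * stage_cost lx lu (w t) (u t))"
    by (auto simp: w_def u_def mult.assoc[symmetric] exp_add[symmetric] algebra_simps)
  ultimately have cost: "((\<lambda>t. exp (- \<beta> * t) * stage_cost lx lu (w t) (u t)) has_integral (J + exp (- \<beta> * T) * J')) {0..T + T'}"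
    by simp
  show ?thesis unfolding attainable_cost_def
  proof (intro exI conjI ballI)
    show "0 \<le> T + T'" using T T' by simp
    show "J + exp (- \<beta> * T) * c = (J + exp (- \<beta> * T) * J') + exp (- \<beta> * (T + T')) * M"
      by (simp add: c algebra_simps exp_add[symmetric] flip: mult.assoc)
  qed (use um dyn cost in auto)
qed

section \<open>Finite-time optimal cost and its dynamic programming inequality\<close>

context
  fixes f :: "real ^ 'n \<Rightarrow> real ^ 'n" and fu :: "'m::finite \<Rightarrow> real ^ 'n \<Rightarrow> real ^ 'n"
    and lx :: "real ^ 'n \<Rightarrow> real" and lu :: "'m \<Rightarrow> real ^ 'n \<Rightarrow> real"
    and X :: "(real ^ 'n) set" and U :: "(real ^ 'm) set" and \<beta> M :: real
  assumes l_nonneg: "\<And>x u. x \<in> X \<Longrightarrow> u \<in> U \<Longrightarrow> 0 \<le> stage_cost lx lu x u" and M_nonneg: "0 \<le> M"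
begin

lemma attainable_cost_nonneg:
  assumes "attainable_cost f fu lx lu X U \<beta> M x c"
  shows "0 \<le> c"
proof -
  obtain T u z J where "\<forall>t\<in>{0..T}. u t \<in> U \<and> z t \<in> X" and c: "c = J + exp (- \<beta> * T) * M"
    and J: "((\<lambda>t. exp (- \<beta> * t) * stage_cost lx lu (z t) (u t)) has_integral J) {0..T}"
    using assms unfolding attainable_cost_def by blast
  then have "0 \<le> J" by (intro has_integral_nonneg[OF J]) (auto simp: l_nonneg)
  then show ?thesis using M_nonneg by (simp add: c)
qed

text \<open>The stopping function may be taken constant, since only its value at the initial state
  enters the cost. The gauge integral \<open>J\<close> agrees with the Lebesgue integral in
  \<open>ocp_cost\<close> because the integrand is nonnegative.\<close>

lemma value_function_le_attainable_cost:
  assumes "attainable_cost f fu lx lu X U \<beta> M x c"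
  shows "value_function f fu lx lu X U \<beta> M x \<le> c"
proof -
  obtain T u z J where T: "0 \<le> T" and u: "u \<in> borel_measurable borel"
    and z: "\<And>t. t \<in> {0..T} \<Longrightarrow> u t \<in> U" "\<And>t. t \<in> {0..T} \<Longrightarrow> z t \<in> X"
      "\<And>t. t \<in> {0..T} \<Longrightarrow> ((\<lambda>s. controlled_field f fu (z s) (u s)) has_integral (z t - x)) {0..t}"
    and J: "((\<lambda>t. exp (- \<beta> * t) * stage_cost lx lu (z t) (u t)) has_integral J) {0..T}"
    and c: "c = J + exp (- \<beta> * T) * M"
    using assms unfolding attainable_cost_def by blast
  have hor: "horizon (ennreal T) = {0..T}"
    using T by (auto simp: horizon_def)
  let ?\<tau> = "\<lambda>_ :: real^'n. ennreal T"
  have "u \<in> borel_measurable lebesgue" using u by (simp add: measurable_completion)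
  then have "u \<in> borel_measurable (lebesgue_on {0..T})" by (rule measurable_restrict_space1)
  then have adm: "admissible f fu X U x ?\<tau> u z"
    using z by (auto simp: admissible_def is_solution_def hor)
  have "(\<lambda>t. exp (- \<beta> * t) * stage_cost lx lu (z t) (u t)) absolutely_integrable_on {0..T}"
    using J z l_nonneg by (intro nonnegative_absolutely_integrable_1) (auto simp: has_integral_iff)
  then have "(LINT t:{0..T}|lebesgue. exp (- \<beta> * t) * stage_cost lx lu (z t) (u t)) = J"
    using J by (simp add: set_lebesgue_integral_eq_integral has_integral_iff)
  then have "ocp_cost lx lu \<beta> M (?\<tau> x) u z = c"
    using T by (simp add: ocp_cost_def hor discount_def c)
  \<comment> \<open>The infimum of reals is a lower bound only for sets bounded below. Nonnegativity
    of the integral also covers integrands that are not integrable, whose integral is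
    \<open>0\<close>.\<close>
  moreover have "bdd_below {ocp_cost lx lu \<beta> M (\<tau> x) u z | \<tau> u z. admissible f fu X U x \<tau> u z}"
  proof (rule bdd_belowI)
    fix c' assume "c' \<in> {ocp_cost lx lu \<beta> M (\<tau> x) u z | \<tau> u z. admissible f fu X U x \<tau> u z}"
    then obtain \<tau> u z where c': "c' = ocp_cost lx lu \<beta> M (\<tau> x) u z" "admissible f fu X U x \<tau> u z" by blast
    then have "0 \<le> stage_cost lx lu (z t) (u t)" if "t \<in> horizon (\<tau> x)" for t
      using that by (intro l_nonneg) (auto simp: admissible_def)
    then have "0 \<le> (LINT t:horizon (\<tau> x)|lebesgue. exp (- \<beta> * t) * stage_cost lx lu (z t) (u t))"
      unfolding set_lebesgue_integral_def by (intro integral_nonneg_AE) (auto simp: indicator_def)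
    then show "0 \<le> c'" using M_nonneg by (simp add: c' ocp_cost_def discount_def)
  qed
  ultimately show ?thesis
    unfolding value_function_def using adm
    by (intro cInf_lower CollectI exI[of _ ?\<tau>] exI[of _ u] exI[of _ z]) auto
qed

definition optimal_attainable_cost where
  "optimal_attainable_cost x = Inf {c. attainable_cost f fu lx lu X U \<beta> M x c}"

lemma bdd_below_attainable_cost: "bdd_below {c. attainable_cost f fu lx lu X U \<beta> M x c}"
  using attainable_cost_nonneg by (intro bdd_belowI[of _ 0]) auto

lemma optimal_attainable_cost_le:
  "attainable_cost f fu lx lu X U \<beta> M x c \<Longrightarrow> optimal_attainable_cost x \<le> c"
  unfolding optimal_attainable_cost_def by (intro cInf_lower bdd_below_attainable_cost) simp

lemma optimal_attainable_cost_bounds: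
  assumes "x \<in> X" "U \<noteq> {}"
  shows "value_function f fu lx lu X U \<beta> M x \<le> optimal_attainable_cost x"
    "0 \<le> optimal_attainable_cost x" "optimal_attainable_cost x \<le> M"
proof -
  obtain u0 where "u0 \<in> U" using assms by blast
  note stop = attainable_cost_stop[OF assms(1) this, of f fu lx lu \<beta> M]
  show "optimal_attainable_cost x \<le> M" using stop by (rule optimal_attainable_cost_le)
  show "value_function f fu lx lu X U \<beta> M x \<le> optimal_attainable_cost x" "0 \<le> optimal_attainable_cost x"
    unfolding optimal_attainable_cost_def
    using stop value_function_le_attainable_cost attainable_cost_nonneg by (intro cInf_greatest; blast)+
qed

lemma optimal_attainable_cost_prepend:
  assumes T: "0 \<le> T" and u0: "u0 \<in> U"
    and z: "\<And>t. t \<in> {0..T} \<Longrightarrow> z t \<in> X"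
      "\<And>t. t \<in> {0..T} \<Longrightarrow> ((\<lambda>s. controlled_field f fu (z s) u0) has_integral (z t - x)) {0..t}"
    and J: "((\<lambda>t. exp (- \<beta> * t) * stage_cost lx lu (z t) u0) has_integral J) {0..T}"
  shows "optimal_attainable_cost x \<le> J + exp (- \<beta> * T) * optimal_attainable_cost (z T)"
proof -
  \<comment> \<open>Solving for the cost of the tail exhibits a lower bound of all costs attainable
    from \<open>z T\<close>, so no nearly optimal strategy has to be selected.\<close>
  have "(optimal_attainable_cost x - J) / exp (- \<beta> * T) \<le> optimal_attainable_cost (z T)"
    unfolding optimal_attainable_cost_def[of "z T"]
  proof (rule cInf_greatest)
    show "{c. attainable_cost f fu lx lu X U \<beta> M (z T) c} \<noteq> {}"
      using attainable_cost_stop[of "z T" X u0 U f fu lx lu \<beta> M] z(1)[of T] T u0 by auto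
    fix c assume "c \<in> {c. attainable_cost f fu lx lu X U \<beta> M (z T) c}"
    then have "optimal_attainable_cost x \<le> J + exp (- \<beta> * T) * c"
      by (intro optimal_attainable_cost_le attainable_cost_prepend[OF T u0 z J]) auto
    then show "(optimal_attainable_cost x - J) / exp (- \<beta> * T) \<le> c"
      by (simp add: pos_divide_le_eq mult.commute)
  qed
  then show ?thesis by (simp add: pos_divide_le_eq mult.commute)
qed

end

section \<open>One Euler step of the finite-time optimal cost\<close>

lemma control_set_sum_bounds:
  fixes u :: "real^'m::finite" and v :: "'m \<Rightarrow> 'a::real_normed_vector"
  assumes "u \<in> control_set ubar"
  shows "norm (\<Sum>i\<in>UNIV. u $ i *\<^sub>R v i) \<le> ubar * (\<Sum>i\<in>UNIV. norm (v i))"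
proof -
  have "norm (\<Sum>i\<in>UNIV. u $ i *\<^sub>R v i) \<le> (\<Sum>i\<in>UNIV. ubar * norm (v i))"
    using assms by (intro sum_norm_le) (auto simp: control_set_def intro: mult_right_mono)
  then show ?thesis by (simp add: sum_distrib_left)
qed

lemma affine_in_control_lipschitz_bounded:
  fixes p :: "'a::real_normed_vector \<Rightarrow> 'b::euclidean_space" and q :: "'m::finite \<Rightarrow> 'a \<Rightarrow> 'b"
  assumes "polynomial_function p" "\<And>i. polynomial_function (q i)" "bounded D" "0 \<le> ubar"
  shows "\<exists>B\<ge>0. \<forall>u \<in> control_set ubar. (\<forall>x\<in>D. norm (p x + (\<Sum>i\<in>UNIV. u $ i *\<^sub>R q i x)) \<le> B) \<and>
    (\<forall>x\<in>D. \<forall>y\<in>D. norm ((p x + (\<Sum>i\<in>UNIV. u $ i *\<^sub>R q i x)) - (p y + (\<Sum>i\<in>UNIV. u $ i *\<^sub>R q i y))) \<le> B * norm (x - y))"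
proof -
  obtain A where A: "0 \<le> A" "\<And>x. x \<in> D \<Longrightarrow> norm (p x) \<le> A" "\<And>x y. x \<in> D \<Longrightarrow> y \<in> D \<Longrightarrow> norm (p x - p y) \<le> A * norm (x - y)"
    using polynomial_function_lipschitz_bounded[OF assms(1,3)] by blast
  have "\<forall>i. \<exists>B\<ge>0. (\<forall>x\<in>D. norm (q i x) \<le> B) \<and> (\<forall>x\<in>D. \<forall>y\<in>D. norm (q i x - q i y) \<le> B * norm (x - y))"
    using polynomial_function_lipschitz_bounded[OF assms(2,3)] by blast
  from choice[OF this] obtain B where "\<forall>i. 0 \<le> B i \<and> (\<forall>x\<in>D. norm (q i x) \<le> B i) \<and>
    (\<forall>x\<in>D. \<forall>y\<in>D. norm (q i x - q i y) \<le> B i * norm (x - y))" ..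
  then have B: "\<And>i. 0 \<le> B i" "\<And>i x. x \<in> D \<Longrightarrow> norm (q i x) \<le> B i"
    "\<And>i x y. x \<in> D \<Longrightarrow> y \<in> D \<Longrightarrow> norm (q i x - q i y) \<le> B i * norm (x - y)" by blast+
  show ?thesis
  proof (intro exI[of _ "A + ubar * sum B UNIV"] conjI ballI)
    show "0 \<le> A + ubar * sum B UNIV" using A B assms by (intro add_nonneg_nonneg mult_nonneg_nonneg sum_nonneg) auto
    fix u :: "real^'m" and x assume u: "u \<in> control_set ubar" and x: "x \<in> D"
    have "ubar * (\<Sum>i\<in>UNIV. norm (q i x)) \<le> ubar * sum B UNIV"
      using assms(4) B(2)[OF x] by (intro mult_left_mono sum_mono)
    then show "norm (p x + (\<Sum>i\<in>UNIV. u $ i *\<^sub>R q i x)) \<le> A + ubar * sum B UNIV"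
      using norm_triangle_ineq[of "p x" "\<Sum>i\<in>UNIV. u $ i *\<^sub>R q i x"] A(2)[OF x]
        control_set_sum_bounds[OF u, of "\<lambda>i. q i x"] by linarith
    fix y assume y: "y \<in> D"
    have "ubar * (\<Sum>i\<in>UNIV. norm (q i x - q i y)) \<le> ubar * (\<Sum>i\<in>UNIV. B i * norm (x - y))"
      using assms(4) B(3)[OF x y] by (intro mult_left_mono sum_mono)
    moreover have "(p x + (\<Sum>i\<in>UNIV. u $ i *\<^sub>R q i x)) - (p y + (\<Sum>i\<in>UNIV. u $ i *\<^sub>R q i y)) =
        (p x - p y) + (\<Sum>i\<in>UNIV. u $ i *\<^sub>R (q i x - q i y))"
      by (simp add: scaleR_diff_right sum_subtractf)
    moreover have "ubar * (\<Sum>i\<in>UNIV. B i * norm (x - y)) = (ubar * sum B UNIV) * norm (x - y)"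
      by (simp add: sum_distrib_right mult.assoc)
    ultimately show "norm ((p x + (\<Sum>i\<in>UNIV. u $ i *\<^sub>R q i x)) - (p y + (\<Sum>i\<in>UNIV. u $ i *\<^sub>R q i y)))
        \<le> (A + ubar * sum B UNIV) * norm (x - y)"
      using norm_triangle_ineq[of "p x - p y" "\<Sum>i\<in>UNIV. u $ i *\<^sub>R (q i x - q i y)"] A(3)[OF x y]
        control_set_sum_bounds[OF u, of "\<lambda>i. q i x - q i y"]
      by (simp only: distrib_right)
  qed
qed

text \<open>
  The control frozen at \<open>s i x / r x\<close> is applied for the time \<open>h * r x\<close>. During this time the state
  moves by at most a small multiple of \<open>r x\<close>, hence it does not leave the set where \<open>r\<close> is positive.
\<close>

lemma optimal_attainable_cost_step:
  fixes f :: "real ^ 'n \<Rightarrow> real ^ 'n" and fu :: "'m::finite \<Rightarrow> real ^ 'n \<Rightarrow> real ^ 'n"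
    and lx :: "real ^ 'n \<Rightarrow> real" and lu :: "'m \<Rightarrow> real ^ 'n \<Rightarrow> real"
    and U :: "(real ^ 'm) set"
  assumes poly: "polynomial_function f" "\<And>i. polynomial_function (fu i)"
      "real_polynomial_function lx" "\<And>i. real_polynomial_function (lu i)"
    and X: "bounded X" "Y \<subseteq> X" and U: "U = control_set ubar" "0 \<le> ubar"
    and l: "\<And>x u. x \<in> X \<Longrightarrow> u \<in> U \<Longrightarrow> 0 \<le> stage_cost lx lu x u" and M: "0 \<le> M" and \<beta>: "0 \<le> \<beta>"
    and r: "\<And>x y. \<bar>r x - r y\<bar> \<le> K * norm (x - y)" "\<And>x. \<bar>r x\<bar> \<le> K" "\<And>x. 0 \<le> r x" "\<And>y. 0 < r y \<Longrightarrow> y \<in> Y"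
    and s: "\<And>i x. 0 \<le> s i x" "\<And>i x. s i x \<le> ubar * r x"
  shows "\<exists>C\<ge>0. \<exists>h0>0. \<forall>h x. 0 < h \<longrightarrow> h \<le> h0 \<longrightarrow> x \<in> Y \<longrightarrow>
    (\<exists>y\<in>Y. norm (y - (x + h *\<^sub>R (r x *\<^sub>R f x + (\<Sum>i\<in>UNIV. s i x *\<^sub>R fu i x)))) \<le> C * h\<^sup>2 \<and>
      optimal_attainable_cost f fu lx lu X U \<beta> M x \<le> h * (lx x * r x + (\<Sum>i\<in>UNIV. lu i x * s i x)) + C * h\<^sup>2
        + exp (- \<beta> * (h * r x)) * optimal_attainable_cost f fu lx lu X U \<beta> M y)"
proof -
  obtain R where R: "X \<subseteq> cball 0 R" using X(1) by (auto simp: bounded_iff subset_iff)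
  \<comment> \<open>A ball, because the local existence result projects onto a closed convex set and
    \<open>X\<close> need not be convex.\<close>
  define D where "D = (cball 0 R :: (real^'n) set)"
  have D: "closed D" "convex D" "bounded D" "Y \<subseteq> D" "X \<subseteq> D" using R X by (auto simp: D_def)
  obtain B where B: "0 \<le> B" "\<And>u x. u \<in> U \<Longrightarrow> x \<in> D \<Longrightarrow> norm (controlled_field f fu x u) \<le> B"
    "\<And>u x y. u \<in> U \<Longrightarrow> x \<in> D \<Longrightarrow> y \<in> D \<Longrightarrow> norm (controlled_field f fu x u - controlled_field f fu y u) \<le> B * norm (x - y)"
    using affine_in_control_lipschitz_bounded[of f fu, OF poly(1,2) D(3) U(2)] unfolding controlled_field_def U(1) by blast
  have stage: "stage_cost lx lu x u = lx x + (\<Sum>i\<in>UNIV. u $ i *\<^sub>R lu i x)" for x u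
    by (simp add: stage_cost_def mult.commute)
  obtain Bl where Bl: "0 \<le> Bl"
    "\<And>u x y. u \<in> U \<Longrightarrow> x \<in> D \<Longrightarrow> y \<in> D \<Longrightarrow> \<bar>stage_cost lx lu x u - stage_cost lx lu y u\<bar> \<le> Bl * norm (x - y)"
    using affine_in_control_lipschitz_bounded[of lx lu, OF poly(3,4)[unfolded real_polynomial_function_eq] D(3) U(2)]
    unfolding stage U(1) real_norm_def by blast
  have K: "0 \<le> K" using r(2)[of undefined] by linarith
  define h0 where "h0 = 1 / (2 * (B * K) + 1)"
  have BK: "0 < 2 * (B * K) + 1" using B K by (intro add_nonneg_pos) auto
  \<comment> \<open>With \<open>T \<le> h * K\<close>, the first summand covers the drift of the
    stage cost along the trajectory and the second the Euler error
    \<open>(B * T)\<^sup>2\<close>.\<close>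
  define C where "C = Bl * (B * K\<^sup>2) + B\<^sup>2 * K\<^sup>2"
  note cost = l M
  have C0: "0 \<le> C" using Bl B by (auto simp: C_def)
  show ?thesis
  proof (rule exI[of _ C], rule conjI[OF C0], rule exI[of _ h0], intro conjI allI impI)
    show "0 < h0" using BK by (auto simp: h0_def)
    fix h x assume h: "0 < h" "h \<le> h0" and x: "x \<in> Y"
    let ?V = "optimal_attainable_cost f fu lx lu X U \<beta> M"
    have hBK: "h * (B * K) \<le> 1/2"
    proof -
      have "h * (2 * (B * K) + 1) \<le> 1" using h BK by (simp add: h0_def pos_le_divide_eq)
      then show ?thesis using h by (simp add: algebra_simps)
    qed
    define T where "T = h * r x"
    have T: "0 \<le> T" "T \<le> h * K" using h r(2,3)[of x] by (auto simp: T_def intro: mult_left_mono)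
    have BT: "B * T \<le> 1/2"
      using mult_left_mono[OF T(2) B(1)] hBK by (simp add: mult_ac)
    \<comment> \<open>Where \<open>r x = 0\<close>, division by zero gives the control
      \<open>0\<close>; the duration \<open>T\<close> is then \<open>0\<close> and all
      \<open>s i x\<close> vanish, so the step is trivial.\<close>
    define u0 :: "real^'m" where "u0 = (\<chi> i. s i x / r x)"
    have u0: "u0 \<in> U"
      using s[of _ x] r(3)[of x] U(2) by (cases "r x = 0") (auto simp: U(1) control_set_def u0_def pos_divide_le_eq)
    have s_zero: "s i x = 0" if "r x = 0" for i
      using s[of i x] that by simp
    then have s0: "r x * (s i x / r x) = s i x" for i
      by (cases "r x = 0") auto
    have Tf: "T *\<^sub>R controlled_field f fu x u0 = h *\<^sub>R (r x *\<^sub>R f x + (\<Sum>i\<in>UNIV. s i x *\<^sub>R fu i x))"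
      using s_zero
      by (cases "r x = 0") (simp_all add: T_def controlled_field_def u0_def scaleR_add_right scaleR_sum_right s0 mult.assoc)
    have Tl: "T * stage_cost lx lu x u0 = h * (lx x * r x + (\<Sum>i\<in>UNIV. lu i x * s i x))"
      using s_zero
      by (cases "r x = 0") (simp_all add: T_def stage_cost_def u0_def distrib_left sum_distrib_left mult_ac)
    have near: "y \<in> Y" if "norm (y - x) \<le> B * T" for y
    proof (cases "r x = 0")
      case True
      then show ?thesis using that x by (simp add: T_def)
    next
      case False
      then have rx: "0 < r x" using r(3)[of x] by simp
      have "\<bar>r y - r x\<bar> \<le> K * (B * T)" using r(1)[of y x] mult_left_mono[OF that K] by linarith
      also have "\<dots> = (h * (B * K)) * r x" by (simp add: T_def mult_ac)
      also have "\<dots> \<le> 1/2 * r x" using hBK rx by (intro mult_right_mono) auto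
      finally have "0 < r y" using rx by linarith
      then show ?thesis by (rule r(4))
    qed
    obtain z where zc: "continuous_on {0..T} z"
      and z: "\<And>t. t \<in> {0..T} \<Longrightarrow> ((\<lambda>s. controlled_field f fu (z s) u0) has_integral (z t - x)) {0..t}"
        "\<And>t. t \<in> {0..T} \<Longrightarrow> z t \<in> Y" "\<And>t. t \<in> {0..T} \<Longrightarrow> norm (z t - x) \<le> B * T"
      and zT: "norm (z T - (x + T *\<^sub>R controlled_field f fu x u0)) \<le> (B * T)\<^sup>2"
      using local_ode_solution_exists[OF D(1,2,4) B(2)[OF u0] B(3)[OF u0] B(1) T(1) BT near] by blast
    have lc: "continuous_on D (\<lambda>y. stage_cost lx lu y u0)"
      by (rule lipschitz_imp_continuous_on, unfold real_norm_def) (erule (1) Bl(2)[OF u0])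
    have "(\<lambda>t. exp (- \<beta> * t) * stage_cost lx lu (z t) u0) integrable_on {0..T}"
      by (intro integrable_continuous_interval continuous_intros continuous_on_compose2[OF lc zc])
        (use z(2) D in auto)
    then obtain J where J: "((\<lambda>t. exp (- \<beta> * t) * stage_cost lx lu (z t) u0) has_integral J) {0..T}"
      by blast
    have "J \<le> T * (stage_cost lx lu x u0 + Bl * (B * T))"
    proof (rule has_integral_le[OF J])
      show "((\<lambda>_. stage_cost lx lu x u0 + Bl * (B * T)) has_integral T * (stage_cost lx lu x u0 + Bl * (B * T))) {0..T}"
        using has_integral_const_real[of "stage_cost lx lu x u0 + Bl * (B * T)" 0 T] T by simp
      fix t assume t: "t \<in> {0..T}"
      have "z t \<in> X" "x \<in> X" using z(2)[OF t] x X by auto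
      then have "\<bar>stage_cost lx lu (z t) u0 - stage_cost lx lu x u0\<bar> \<le> Bl * norm (z t - x)"
        using D by (intro Bl u0) auto
      also have "\<dots> \<le> Bl * (B * T)" using z(3)[OF t] Bl by (intro mult_left_mono)
      finally have "stage_cost lx lu (z t) u0 \<le> stage_cost lx lu x u0 + Bl * (B * T)" by linarith
      moreover have "exp (- \<beta> * t) * stage_cost lx lu (z t) u0 \<le> 1 * stage_cost lx lu (z t) u0"
        using t \<beta> l[OF \<open>z t \<in> X\<close> u0] by (intro mult_right_mono) auto
      ultimately show "exp (- \<beta> * t) * stage_cost lx lu (z t) u0 \<le> stage_cost lx lu x u0 + Bl * (B * T)" by linarith
    qed
    also have "\<dots> = h * (lx x * r x + (\<Sum>i\<in>UNIV. lu i x * s i x)) + Bl * B * T\<^sup>2"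
      unfolding distrib_left Tl by (simp add: power2_eq_square)
    finally have J_le: "J \<le> h * (lx x * r x + (\<Sum>i\<in>UNIV. lu i x * s i x)) + Bl * B * T\<^sup>2" .
    have T2: "T\<^sup>2 \<le> K\<^sup>2 * h\<^sup>2" using power_mono[OF T(2,1), of 2] by (simp add: power_mult_distrib mult.commute)
    have C1: "Bl * B * T\<^sup>2 \<le> C * h\<^sup>2" "(B * T)\<^sup>2 \<le> C * h\<^sup>2"
    proof -
      have a: "Bl * B * T\<^sup>2 \<le> Bl * B * (K\<^sup>2 * h\<^sup>2)" using T2 Bl B by (intro mult_left_mono) auto
      have b: "(B * T)\<^sup>2 \<le> B\<^sup>2 * (K\<^sup>2 * h\<^sup>2)" using T2 by (simp add: power_mult_distrib mult_left_mono)
      have "C * h\<^sup>2 = Bl * B * (K\<^sup>2 * h\<^sup>2) + B\<^sup>2 * (K\<^sup>2 * h\<^sup>2)" by (simp add: C_def algebra_simps)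
      moreover have "0 \<le> Bl * B * (K\<^sup>2 * h\<^sup>2)" "0 \<le> B\<^sup>2 * (K\<^sup>2 * h\<^sup>2)" using Bl B by auto
      ultimately show "Bl * B * T\<^sup>2 \<le> C * h\<^sup>2" "(B * T)\<^sup>2 \<le> C * h\<^sup>2" using a b by linarith+
    qed
    have "?V x \<le> J + exp (- \<beta> * T) * ?V (z T)"
      by (rule optimal_attainable_cost_prepend[OF cost T(1) u0 _ z(1) J]) (use z(2) X in auto)
    then have "?V x \<le> h * (lx x * r x + (\<Sum>i\<in>UNIV. lu i x * s i x)) + C * h\<^sup>2 + exp (- \<beta> * (h * r x)) * ?V (z T)"
      using J_le C1(1) unfolding T_def by linarith
    moreover have "norm (z T - (x + h *\<^sub>R (r x *\<^sub>R f x + (\<Sum>i\<in>UNIV. s i x *\<^sub>R fu i x)))) \<le> C * h\<^sup>2"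
      using zT C1(2) unfolding Tf by linarith
    moreover have "z T \<in> Y" using T by (intro z) auto
    ultimately show "\<exists>y\<in>Y. norm (y - (x + h *\<^sub>R (r x *\<^sub>R f x + (\<Sum>i\<in>UNIV. s i x *\<^sub>R fu i x)))) \<le> C * h\<^sup>2 \<and>
      ?V x \<le> h * (lx x * r x + (\<Sum>i\<in>UNIV. lu i x * s i x)) + C * h\<^sup>2 + exp (- \<beta> * (h * r x)) * ?V y"
      by blast
  qed
qed

section \<open>The linear program\<close>

definition bounded_lipschitz :: "('a::real_normed_vector \<Rightarrow> 'b::real_normed_vector) \<Rightarrow> bool" where
  "bounded_lipschitz F \<longleftrightarrow> (\<exists>A\<ge>0. (\<forall>x. norm (F x) \<le> A) \<and> (\<forall>x y. norm (F x - F y) \<le> A * norm (x - y)))"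

lemma bounded_lipschitz_add:
  assumes "bounded_lipschitz F" "bounded_lipschitz G"
  shows "bounded_lipschitz (\<lambda>x. F x + G x)"
proof -
  obtain A B where A: "0 \<le> A" "\<And>x. norm (F x) \<le> A" "\<And>x y. norm (F x - F y) \<le> A * norm (x - y)"
    and B: "0 \<le> B" "\<And>x. norm (G x) \<le> B" "\<And>x y. norm (G x - G y) \<le> B * norm (x - y)"
    using assms unfolding bounded_lipschitz_def by blast
  have "norm (F x + G x) \<le> A + B" for x
    using norm_triangle_ineq[of "F x" "G x"] A(2)[of x] B(2)[of x] by linarith
  moreover have "norm ((F x + G x) - (F y + G y)) \<le> (A + B) * norm (x - y)" for x y
    using norm_triangle_ineq[of "F x - F y" "G x - G y"] A(3)[of x y] B(3)[of x y]
    by (simp add: distrib_right add_diff_add)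
  ultimately show ?thesis
    unfolding bounded_lipschitz_def using A(1) B(1) by (intro exI[of _ "A + B"]) auto
qed

lemma bounded_lipschitz_sum:
  assumes "finite I" "\<And>i. i \<in> I \<Longrightarrow> bounded_lipschitz (F i)"
  shows "bounded_lipschitz (\<lambda>x. \<Sum>i\<in>I. F i x)"
  using assms
proof (induction I rule: finite_induct)
  case empty
  then show ?case by (auto simp: bounded_lipschitz_def)
next
  case (insert i I)
  then show ?case using bounded_lipschitz_add[of "F i" "\<lambda>x. \<Sum>i\<in>I. F i x"] by simp
qed

lemma bounded_lipschitz_mult_polynomial:
  fixes r :: "'a::euclidean_space \<Rightarrow> real" and p :: "'a \<Rightarrow> 'b::euclidean_space"
  assumes r: "bounded_lipschitz r" "\<And>x. x \<notin> X \<Longrightarrow> r x = 0" and p: "polynomial_function p" and X: "bounded X"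
  shows "bounded_lipschitz (\<lambda>x. r x *\<^sub>R p x)"
proof -
  obtain K where K: "0 \<le> K" "\<And>x. \<bar>r x\<bar> \<le> K" "\<And>x y. \<bar>r x - r y\<bar> \<le> K * norm (x - y)"
    using r(1) unfolding bounded_lipschitz_def real_norm_def by blast
  obtain B where B: "0 \<le> B" "\<And>x. x \<in> X \<Longrightarrow> norm (p x) \<le> B" "\<And>x y. x \<in> X \<Longrightarrow> y \<in> X \<Longrightarrow> norm (p x - p y) \<le> B * norm (x - y)"
    using polynomial_function_lipschitz_bounded[OF p X] by blast
  have "norm (r x *\<^sub>R p x - r y *\<^sub>R p y) \<le> 2 * K * B * norm (x - y)" for x y
    by (rule lipschitz_mult_supported[OF K(3,2) r(2) B(2,3,1)])
  moreover have "norm (r x *\<^sub>R p x) \<le> 2 * K * B" for x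
  proof (cases "x \<in> X")
    case True
    have "norm (r x *\<^sub>R p x) \<le> K * B"
      unfolding norm_scaleR using K B(2)[OF True] by (intro mult_mono) auto
    moreover have "2 * K * B = K * B + K * B" by simp
    ultimately show ?thesis using mult_nonneg_nonneg[OF K(1) B(1)] by linarith
  next
    case False
    then show ?thesis using r(2) K B by simp
  qed
  ultimately show ?thesis
    unfolding bounded_lipschitz_def using K(1) B(1) by (intro exI[of _ "2 * K * B"]) auto
qed

lemma set_integral_compact_eq_integral_interior:
  fixes g :: "'a::euclidean_space \<Rightarrow> real"
  assumes X: "compact X" "negligible (X - interior X)" and g: "continuous_on X g"
  shows "(LINT x:X|lebesgue. g x) = integral (interior X) g" "g integrable_on interior X"
proof -
  have "bounded (g ` X)" using X g by (auto intro: compact_imp_bounded compact_continuous_image)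
  then obtain B where B: "\<And>x. x \<in> X \<Longrightarrow> norm (g x) \<le> B" by (auto simp: bounded_iff)
  have "X \<in> lmeasurable" using X by (simp add: lmeasurable_compact)
  then have "g absolutely_integrable_on X"
    using g B by (intro measurable_bounded_by_integrable_imp_absolutely_integrable[of _ _ "\<lambda>_. B"]
        continuous_imp_measurable_on_sets_lebesgue integrable_on_const) auto
  note abs = set_lebesgue_integral_eq_integral[OF this]
  show "(LINT x:X|lebesgue. g x) = integral (interior X) g"
    using abs(2) integral_subset_negligible[OF interior_subset X(2), of g] by simp
  have "interior X - X \<union> (X - interior X) = X - interior X" using interior_subset by blast
  then show "g integrable_on interior X"
    using abs(1) X(2) integrable_spike_set_eq[of X "interior X" g] by (simp add: Un_commute)
qed

text \<open>From \<open>1 + y \<le> exp y\<close> and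
  \<open>(1 + y) * (1 - y + y\<^sup>2) = 1 + y ^ 3\<close>. It makes the discount over one step
  linear up to an error of order \<open>h\<^sup>2\<close>.\<close>

lemma exp_minus_le_quadratic:
  fixes y :: real
  assumes "0 \<le> y"
  shows "exp (- y) \<le> 1 - y + y\<^sup>2"
proof -
  have "1 \<le> (1 + y) * (1 - y + y\<^sup>2)"
    using assms by (simp add: algebra_simps power2_eq_square)
  also have "\<dots> \<le> exp y * (1 - y + y\<^sup>2)"
  proof (rule mult_right_mono)
    show "1 + y \<le> exp y" by (rule exp_ge_add_one_self)
    have "0 \<le> (y - 1/2)\<^sup>2" by simp
    then show "0 \<le> 1 - y + y\<^sup>2" by (simp add: power2_eq_square algebra_simps)
  qed
  finally show ?thesis by (simp add: exp_minus field_simps)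
qed

text \<open>Instance of \<open>transport_comparison\<close> in which \<open>a\<close> is the
  discount rate \<open>\<beta> * r\<close> plus a stopping rate \<open>\<kappa>\<close>, and
  \<open>b\<close> is the running cost plus \<open>M * \<kappa>\<close>. The bound
  \<open>stage_cost \<le> \<beta> * M\<close> becomes \<open>b \<le> M * a\<close>, and the
  continuity equation with \<open>\<rho>0 \<ge> 1\<close> becomes
  \<open>1 \<le> a + d\<close>.\<close>

lemma lp_objective_ge_value_integral:
  fixes f :: "real ^ 'n \<Rightarrow> real ^ 'n" and fu :: "'m::finite \<Rightarrow> real ^ 'n \<Rightarrow> real ^ 'n"
    and lx :: "real ^ 'n \<Rightarrow> real" and lu :: "'m \<Rightarrow> real ^ 'n \<Rightarrow> real" and U :: "(real ^ 'm) set"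
  assumes poly: "polynomial_function f" "\<And>i. polynomial_function (fu i)"
      "real_polynomial_function lx" "\<And>i. real_polynomial_function (lu i)"
    and X: "compact X" "negligible (X - interior X)"
    and U: "U = control_set ubar" "0 < ubar"
    and l: "\<And>x u. x \<in> X \<Longrightarrow> u \<in> U \<Longrightarrow> 0 \<le> stage_cost lx lu x u"
      "\<And>x u. x \<in> X \<Longrightarrow> u \<in> U \<Longrightarrow> stage_cost lx lu x u \<le> \<beta> * M"
    and M: "0 \<le> M" and \<beta>: "0 < \<beta>"
    and feas: "lp_feasible f fu X ubar \<beta> \<rho> \<rho>0 \<rho>T \<sigma>"
  shows "enn2ereal (\<integral>\<^sup>+x\<in>X. ennreal (value_function f fu lx lu X U \<beta> M x) \<partial>lebesgue)
    \<le> ereal (lp_objective lx lu X M \<rho> \<rho>T \<sigma>)"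
proof -
  define Y where "Y = interior X"
  have Y: "open Y" "bounded Y" "Y \<subseteq> X"
    using X(1) interior_subset[of X] by (auto simp: Y_def intro: compact_imp_bounded bounded_subset)
  have lm: "Y \<in> lmeasurable" using Y by (simp add: lmeasurable_open)
  have bX: "bounded X" and cX: "closed X" using X(1) by (auto intro: compact_imp_bounded compact_imp_closed)
  have C1: "C1_on X \<rho>" "\<And>i. C1_on X (\<sigma> i)" and cont: "continuous_on X \<rho>0" "continuous_on X \<rho>T"
    and pde: "\<And>x. x \<in> Y \<Longrightarrow> \<rho>T x - \<rho>0 x + \<beta> * \<rho> x + divergence (\<lambda>y. \<rho> y *\<^sub>R f y) x
        + (\<Sum>i\<in>UNIV. divergence (\<lambda>y. \<sigma> i y *\<^sub>R fu i y) x) = 0"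
    and bdry: "\<And>x. x \<in> frontier X \<Longrightarrow> \<rho> x \<le> 0"
    and \<rho>0: "\<And>x. x \<in> X \<Longrightarrow> 1 \<le> \<rho>0 x" and \<sigma>_le: "\<And>x i. x \<in> X \<Longrightarrow> \<sigma> i x \<le> ubar * \<rho> x"
    and \<rho>T: "\<And>x. x \<in> X \<Longrightarrow> 0 \<le> \<rho>T x" and \<sigma>_ge: "\<And>x i. x \<in> X \<Longrightarrow> 0 \<le> \<sigma> i x"
    using feas unfolding lp_feasible_def Y_def by blast+
  \<comment> \<open>Here \<open>ubar > 0\<close> turns
    \<open>0 \<le> \<sigma> i x \<le> ubar * \<rho> x\<close> into a sign for \<open>\<rho>\<close>;
    \<open>undefined\<close> serves as an arbitrary control index.\<close>
  have \<rho>_ge: "0 \<le> \<rho> x" if "x \<in> X" for x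
    using \<sigma>_le[OF that, of undefined] \<sigma>_ge[OF that, of undefined] U(2)
    by (meson order_trans zero_le_mult_iff not_le)
  have frontier: "frontier X = X - Y" using cX by (simp add: frontier_def Y_def)
  have bdry0: "\<rho> x = 0" "\<sigma> i x = 0" if "x \<in> frontier X" for x i
  proof -
    have "x \<in> X" using that frontier by blast
    then show "\<rho> x = 0" using bdry[OF that] \<rho>_ge by force
    then show "\<sigma> i x = 0" using \<sigma>_le[OF \<open>x \<in> X\<close>, of i] \<sigma>_ge[OF \<open>x \<in> X\<close>, of i] by simp
  qed
  define r where "r x = (if x \<in> X then \<rho> x else 0)" for x
  define s where "s i x = (if x \<in> X then \<sigma> i x else 0)" for i x
  have rX: "x \<in> X \<Longrightarrow> r x = \<rho> x" "x \<notin> X \<Longrightarrow> r x = 0" and sX: "x \<in> X \<Longrightarrow> s i x = \<sigma> i x" "x \<notin> X \<Longrightarrow> s i x = 0" for x i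
    by (simp_all add: r_def s_def)
  have r_ge: "0 \<le> r x" and s_ge: "0 \<le> s i x" and s_le: "s i x \<le> ubar * r x" for x i
    using \<rho>_ge \<sigma>_ge \<sigma>_le by (auto simp: r_def s_def)
  have r_pos: "y \<in> Y" if "0 < r y" for y
    using that bdry0(1)[of y] frontier by (auto simp: r_def split: if_splits)
  have off: "r x = 0" "s i x = 0" if "x \<notin> Y" for x i
    using that bdry0[of x] frontier by (auto simp: r_def s_def)
  have bl: "bounded_lipschitz r" "bounded_lipschitz (s i)" for i
    unfolding bounded_lipschitz_def real_norm_def
    using C1_zero_extension_lipschitz[OF C1(1) X(1) bdry0(1) rX]
      C1_zero_extension_lipschitz[OF C1(2) X(1) bdry0(2) sX] by blast+
  define F where "F x = r x *\<^sub>R f x + (\<Sum>i\<in>UNIV. s i x *\<^sub>R fu i x)" for x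
  define lc where "lc x = lx x * r x + (\<Sum>i\<in>UNIV. lu i x * s i x)" for x
  have "bounded_lipschitz F" unfolding F_def
    by (intro bounded_lipschitz_add bounded_lipschitz_sum bounded_lipschitz_mult_polynomial[OF _ _ _ bX] bl poly rX sX) auto
  then obtain L where L: "0 \<le> L" "\<And>x. norm (F x) \<le> L" "\<And>x y. norm (F x - F y) \<le> L * norm (x - y)"
    unfolding bounded_lipschitz_def by blast
  have "bounded_lipschitz (\<lambda>x. r x *\<^sub>R lx x + (\<Sum>i\<in>UNIV. s i x *\<^sub>R lu i x))"
    using poly(3,4) unfolding real_polynomial_function_eq
    by (intro bounded_lipschitz_add bounded_lipschitz_sum bounded_lipschitz_mult_polynomial[OF _ _ _ bX] bl rX sX) auto
  then obtain Ll where Ll: "0 \<le> Ll" "\<And>x y. \<bar>lc x - lc y\<bar> \<le> Ll * norm (x - y)"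
    unfolding bounded_lipschitz_def lc_def by (auto simp: mult.commute)
  obtain K where K: "0 \<le> K" "\<And>x. \<bar>r x\<bar> \<le> K" "\<And>x y. \<bar>r x - r y\<bar> \<le> K * norm (x - y)"
    using bl(1) unfolding bounded_lipschitz_def real_norm_def by blast
  \<comment> \<open>The divergence of \<open>F\<close>, read off from the continuity equation. This
    expression is continuous on all of \<open>X\<close>, so compactness bounds it.\<close>
  define d where "d x = \<rho>0 x - \<rho>T x - \<beta> * \<rho> x" for x
  have "continuous_on X \<rho>" using C1(1) by (simp add: C1_on_def)
  then have cd: "continuous_on X d" unfolding d_def by (intro continuous_intros cont)
  obtain D where D: "\<And>x. x \<in> X \<Longrightarrow> \<bar>d x\<bar> \<le> D"
    using compact_imp_bounded[OF compact_continuous_image[OF cd X(1)]] by (auto simp: bounded_iff)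
  define F' where "F' x = (\<lambda>v. frechet_derivative (\<lambda>y. \<rho> y *\<^sub>R f y) (at x) v
    + (\<Sum>i\<in>UNIV. frechet_derivative (\<lambda>y. \<sigma> i y *\<^sub>R fu i y) (at x) v))" for x
  have diff: "\<phi> differentiable (at x)" if "C1_on X \<phi>" "x \<in> Y" for \<phi> x
    using that by (auto simp: C1_on_def Y_def gderiv_def differentiable_def)
  have der: "(F has_derivative F' x) (at x)" if x: "x \<in> Y" for x
  proof -
    have "((\<lambda>y. \<rho> y *\<^sub>R f y + (\<Sum>i\<in>UNIV. \<sigma> i y *\<^sub>R fu i y)) has_derivative F' x) (at x)"
      unfolding F'_def
      by (intro has_derivative_add has_derivative_sum)
        (intro frechet_derivative_works[THEN iffD1] differentiable_scaleR diff[OF _ x] C1 differentiable_at_polynomial_function poly)+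
    then show ?thesis
      by (rule has_derivative_transform_within_open[OF _ Y(1) x]) (use Y(3) rX sX in \<open>auto simp: F_def\<close>)
  qed
  have d_div: "d x = (\<Sum>b\<in>Basis. F' x b \<bullet> b)" if x: "x \<in> Y" for x
  proof -
    have "(\<Sum>b\<in>Basis. F' x b \<bullet> b) = divergence (\<lambda>y. \<rho> y *\<^sub>R f y) x
        + (\<Sum>i\<in>UNIV. divergence (\<lambda>y. \<sigma> i y *\<^sub>R fu i y) x)"
      unfolding F'_def divergence_def inner_add_left sum.distrib inner_sum_left
      by (subst sum.swap) simp
    then show ?thesis using pde[OF x] by (simp add: d_def)
  qed
  \<comment> \<open>\<open>lc x\<close> is \<open>r x\<close> times the stage cost under the
    admissible control \<open>s i x / r x\<close>, so both bounds on the stage cost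
    transfer.\<close>
  have lc_bounds: "0 \<le> lc x" "lc x \<le> M * (\<beta> * r x)" if x: "x \<in> X" for x
  proof -
    define u0 :: "real^'m" where "u0 = (\<chi> i. s i x / r x)"
    have u0: "u0 \<in> U"
      using s_ge[of _ x] s_le[of _ x] r_ge[of x] U(2)
      by (cases "r x = 0") (auto simp: U(1) control_set_def u0_def pos_divide_le_eq)
    have "s i x = 0" if "r x = 0" for i using s_ge[of i x] s_le[of i x] that by simp
    then have eq: "lc x = r x * stage_cost lx lu x u0"
      by (cases "r x = 0") (simp_all add: lc_def stage_cost_def u0_def distrib_left sum_distrib_left mult_ac)
    show "0 \<le> lc x" unfolding eq using l(1)[OF x u0] r_ge by simp
    show "lc x \<le> M * (\<beta> * r x)"
      unfolding eq using mult_left_mono[OF l(2)[OF x u0] r_ge[of x]] by (simp add: mult_ac)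
  qed
  have "control_set ubar \<noteq> ({} :: (real^'m) set)"
    using U(2) by (auto simp: control_set_def intro!: exI[of _ 0])
  then have Une: "U \<noteq> {}" by (simp add: U(1))
  define V where "V = optimal_attainable_cost f fu lx lu X U \<beta> M"
  have V: "value_function f fu lx lu X U \<beta> M x \<le> V x" "0 \<le> V x" "V x \<le> M" if "x \<in> X" for x
    unfolding V_def using optimal_attainable_cost_bounds[OF l(1) M that Une] by blast+
  define N where "N = (\<integral>\<^sup>+x\<in>X. ennreal (value_function f fu lx lu X U \<beta> M x) \<partial>lebesgue)"
  \<comment> \<open>\<open>nn_integral\<close> is monotone almost everywhere for arbitrary
    functions, and \<open>X - Y\<close> is null. Thus any \<open>w\<close> above \<open>V\<close> on
    \<open>Y\<close> bounds \<open>N\<close>.\<close>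
  have N_le: "N \<le> ennreal (integral Y w)"
    if w: "continuous_on Y w" "\<And>x. x \<in> Y \<Longrightarrow> V x \<le> w x \<and> 0 \<le> w x \<and> w x \<le> M + 1" for w
  proof -
    have abs: "w absolutely_integrable_on Y"
      by (rule absolutely_integrable_bounded_continuous[OF Y(1,2) w(1), of "M + 1"]) (use w(2) in auto)
    have "N \<le> (\<integral>\<^sup>+x. ennreal (indicator Y x *\<^sub>R w x) \<partial>lebesgue)"
      unfolding N_def
    proof (rule nn_integral_mono_AE)
      have "X - Y \<in> null_sets lebesgue" using X(2) by (simp add: Y_def negligible_iff_null_sets)
      then show "AE x in lebesgue. ennreal (value_function f fu lx lu X U \<beta> M x) * indicator X x
          \<le> ennreal (indicator Y x *\<^sub>R w x)"
      proof (rule AE_I'[OF _ subsetI])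
        fix x assume x: "x \<in> {x \<in> space lebesgue. \<not> ennreal (value_function f fu lx lu X U \<beta> M x) * indicator X x
          \<le> ennreal (indicator Y x *\<^sub>R w x)}"
        have "x \<in> X" using x by (cases "x \<in> X") auto
        moreover have "x \<notin> Y"
        proof
          assume "x \<in> Y"
          then have "value_function f fu lx lu X U \<beta> M x \<le> w x"
            using V(1)[OF \<open>x \<in> X\<close>] w(2)[of x] by simp
          then show False using x \<open>x \<in> X\<close> \<open>x \<in> Y\<close> by (simp add: ennreal_leI)
        qed
        ultimately show "x \<in> X - Y" by blast
      qed
    qed
    also have "\<dots> = ennreal (\<integral>x. indicator Y x *\<^sub>R w x \<partial>lebesgue)"
      using abs w(2) by (intro nn_integral_eq_integral) (auto simp: set_integrable_def indicator_def)
    also have "(\<integral>x. indicator Y x *\<^sub>R w x \<partial>lebesgue) = integral Y w"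
      using set_lebesgue_integral_eq_integral(2)[OF abs] by (simp add: set_lebesgue_integral_def)
    finally show ?thesis .
  qed
  \<comment> \<open>The constant \<open>M\<close> is itself a majorant, so \<open>N\<close> is
    finite and \<open>enn2real\<close> loses nothing.\<close>
  have "N \<le> ennreal (integral Y (\<lambda>_. M))"
    by (rule N_le) (use V M Y(3) in auto)
  then have N_fin: "N < top" by (rule le_less_trans) simp
  have N_real: "enn2real N \<le> integral Y w"
    if w: "continuous_on Y w" "\<And>x. x \<in> Y \<Longrightarrow> V x \<le> w x \<and> 0 \<le> w x \<and> w x \<le> M + 1" for w
  proof -
    have "0 \<le> integral Y w" using w(2)
      by (cases "w integrable_on Y") (auto simp: integral_nonneg not_integrable_integral)
    then show ?thesis using enn2real_mono[OF N_le[OF w]] by simp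
  qed
  have int: "g integrable_on Y" if "continuous_on X g" for g :: "real ^ 'n \<Rightarrow> real"
    using set_integral_compact_eq_integral_interior(2)[OF X that] by (simp add: Y_def)
  have cont_lc: "continuous_on X lc"
    by (rule lipschitz_imp_continuous_on, unfold real_norm_def) (rule Ll(2))
  have Ic: "integral Y (\<lambda>x. c) = c * measure lebesgue Y" for c :: real
    using lmeasure_integral[OF lm] integral_mult_right[of Y c "\<lambda>x. 1"] by simp
  have ic: "(\<lambda>x. c :: real) integrable_on Y" for c
    using lm by (rule integrable_on_const)
  have main: "enn2real N \<le> integral Y lc + M * integral Y \<rho>T + 2 * e * (M * measure lebesgue Y)" if e: "0 < e" for e
  proof -
    \<comment> \<open>Approximating \<open>\<rho>T + e\<close> to within \<open>e\<close> puts
      \<open>\<kappa>\<close> between \<open>\<rho>T\<close> and \<open>\<rho>T + 2 * e\<close>.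
      Lying above \<open>\<rho>T\<close> preserves \<open>1 \<le> a + d\<close>, and a polynomial is
      Lipschitz on \<open>X\<close>.\<close>
    have "continuous_on X (\<lambda>x. \<rho>T x + e)" by (intro continuous_intros cont)
    then obtain \<kappa> where \<kappa>p: "real_polynomial_function \<kappa>" and "\<And>x. x \<in> X \<Longrightarrow> \<bar>\<rho>T x + e - \<kappa> x\<bar> < e"
      using Stone_Weierstrass_real_polynomial_function[OF X(1) _ e] by blast
    then have \<kappa>: "\<rho>T x \<le> \<kappa> x" "\<kappa> x \<le> \<rho>T x + 2 * e" "0 \<le> \<kappa> x" if "x \<in> X" for x
      using \<rho>T[OF that] that by force+
    obtain Q where Q: "0 \<le> Q" "\<And>x. x \<in> X \<Longrightarrow> \<bar>\<kappa> x\<bar> \<le> Q" "\<And>x y. x \<in> X \<Longrightarrow> y \<in> X \<Longrightarrow> \<bar>\<kappa> x - \<kappa> y\<bar> \<le> Q * norm (x - y)"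
      using real_polynomial_function_lipschitz_bounded[OF \<kappa>p bX] by blast
    define a where "a x = \<beta> * r x + \<kappa> x" for x
    define b where "b x = lc x + M * \<kappa> x" for x
    have "\<exists>C\<ge>0. \<exists>h1>0. \<forall>h x. 0 < h \<longrightarrow> h \<le> h1 \<longrightarrow> x \<in> Y \<longrightarrow>
      (\<exists>y\<in>Y. norm (y - (x + h *\<^sub>R F x)) \<le> C * h\<^sup>2 \<and> V x \<le> h * lc x + C * h\<^sup>2 + exp (- \<beta> * (h * r x)) * V y)"
      (is "\<exists>C\<ge>0. \<exists>h1>0. ?step C h1")
      unfolding F_def lc_def V_def
      by (rule optimal_attainable_cost_step[OF poly bX Y(3) U(1) less_imp_le[OF U(2)] l(1) M less_imp_le[OF \<beta>]
          K(3,2) r_ge r_pos s_ge s_le])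
    then obtain C h1 where C: "0 \<le> C" and h1: "0 < h1" and step: "?step C h1"
      by (elim exE conjE)
    \<comment> \<open>The second entry gives \<open>h * Q \<le> 1\<close>, so that
      \<open>h * \<kappa> x\<close> can serve as a weight in a convex combination.\<close>
    define h0 where "h0 = min h1 (1 / (Q + 1))"
    \<comment> \<open>Errors of the trajectory, of the quadratic term of the discount, and of the
      product of discounting and stopping.\<close>
    define C0 where "C0 = C + M * (\<beta> * K)\<^sup>2 + M * (Q * (\<beta> * K))"
    have "enn2real N \<le> integral Y b"
    proof (rule transport_comparison[OF L(3,1) Y(1,2) _ der _ d_div _ L(2), where V = V and a = a and M = M
          and La = "\<beta> * K + Q" and Lb = "Ll + M * Q" and A = "\<beta> * K + Q" and ?h0.0 = h0 and ?C0.0 = C0 and D = D])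
      show "F x = 0" if "x \<notin> Y" for x using off[OF that] by (simp add: F_def)
      show "continuous_on Y d" using cd Y(3) by (rule continuous_on_subset)
      show "\<bar>d x\<bar> \<le> D" if "x \<in> Y" for x using D that Y(3) by blast
      show "0 \<le> \<beta> * K + Q" "0 \<le> Ll + M * Q" using \<beta> K Q Ll M by auto
      show "0 \<le> M" by fact
      show "0 \<le> C0" using C M \<beta> K Q by (auto simp: C0_def)
      show "0 < h0" using h1 Q by (simp add: h0_def)
      fix x assume x: "x \<in> Y"
      then have xX: "x \<in> X" using Y(3) by blast
      show "0 \<le> a x" using \<beta> r_ge[of x] \<kappa>(3)[OF xX] by (simp add: a_def)
      show "a x \<le> \<beta> * K + Q"
        unfolding a_def using \<beta> K(2)[of x] Q(2)[OF xX] by (intro add_mono mult_left_mono) auto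
      show "0 \<le> b x" using lc_bounds[OF xX] \<kappa>(3)[OF xX] M by (simp add: b_def)
      show "b x \<le> M * a x" using lc_bounds[OF xX] by (simp add: b_def a_def distrib_left)
      show "1 \<le> a x + d x" using \<kappa>(1)[OF xX] \<rho>0[OF xX] rX(1)[OF xX] by (simp add: a_def d_def)
      show "V x \<le> M" by (rule V[OF xX])
      show "\<bar>a x - a y\<bar> \<le> (\<beta> * K + Q) * norm (x - y)" "\<bar>b x - b y\<bar> \<le> (Ll + M * Q) * norm (x - y)" if y: "y \<in> Y" for y
      proof -
        have \<kappa>l: "\<bar>\<kappa> x - \<kappa> y\<bar> \<le> Q * norm (x - y)" using Q(3) xX y Y(3) by blast
        have "\<bar>\<beta> * (r x - r y)\<bar> \<le> \<beta> * (K * norm (x - y))"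
          using \<beta> K(3)[of x y] by (simp add: abs_mult)
        moreover have "a x - a y = \<beta> * (r x - r y) + (\<kappa> x - \<kappa> y)" by (simp add: a_def algebra_simps)
        ultimately show "\<bar>a x - a y\<bar> \<le> (\<beta> * K + Q) * norm (x - y)"
          using \<kappa>l unfolding distrib_right mult.assoc by linarith
        have "\<bar>M * (\<kappa> x - \<kappa> y)\<bar> \<le> M * (Q * norm (x - y))"
          using M \<kappa>l by (simp add: abs_mult mult_left_mono)
        moreover have "b x - b y = (lc x - lc y) + M * (\<kappa> x - \<kappa> y)" by (simp add: b_def algebra_simps)
        ultimately show "\<bar>b x - b y\<bar> \<le> (Ll + M * Q) * norm (x - y)"
          using Ll(2)[of x y] unfolding distrib_right mult.assoc by linarith
      qed
      fix h assume h: "0 < h" "h \<le> h0"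
      then have hQ: "h * Q \<le> 1" using Q(1) by (simp add: h0_def field_simps)
      obtain y where y: "y \<in> Y" "norm (y - (x + h *\<^sub>R F x)) \<le> C * h\<^sup>2"
        "V x \<le> h * lc x + C * h\<^sup>2 + exp (- \<beta> * (h * r x)) * V y"
        using step[rule_format, OF h(1) _ x] h(2) by (auto simp: h0_def)
      have Vy: "0 \<le> V y" "V y \<le> M" using V[of y] y(1) Y(3) by auto
      define c where "c = h * \<kappa> x"
      have "c \<le> h * Q" using Q(2)[OF xX] h by (simp add: c_def)
      moreover have "0 \<le> c" using h \<kappa>(3)[OF xX] by (simp add: c_def)
      ultimately have c: "0 \<le> c" "c \<le> 1" "c \<le> h * Q" using hQ by linarith+
      define q where "q = \<beta> * (h * r x)"
      have "h * r x \<le> h * K" using h K(2)[of x] by simp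
      then have q: "0 \<le> q" "q \<le> h * (\<beta> * K)"
        using \<beta> h r_ge[of x] by (auto simp: q_def mult.left_commute[of h] intro: mult_left_mono)
      have "exp (- \<beta> * (h * r x)) * V y \<le> (1 - q + q\<^sup>2) * V y"
        using exp_minus_le_quadratic[OF q(1)] Vy by (intro mult_right_mono) (simp_all add: q_def)
      then have "V x \<le> h * lc x + C * h\<^sup>2 + (1 - q + q\<^sup>2) * V y" using y(3) by linarith
      \<comment> \<open>The bound \<open>V x \<le> M\<close> enters with weight \<open>c\<close> and
        the dynamic programming bound with weight \<open>1 - c\<close>. To first order the factor of
        \<open>V y\<close> becomes \<open>1 - c - q = 1 - h * a x\<close>.\<close>
      then have "(1 - c) * V x \<le> (1 - c) * (h * lc x + C * h\<^sup>2 + (1 - q + q\<^sup>2) * V y)"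
        using c by (intro mult_left_mono) auto
      moreover have "c * V x \<le> c * M" using V(3)[OF xX] c by (intro mult_left_mono) auto
      ultimately have 1: "V x \<le> c * M + (1 - c) * (h * lc x + C * h\<^sup>2 + (1 - q + q\<^sup>2) * V y)"
        by (simp add: algebra_simps)
      have nn: "0 \<le> c * (h * lc x)" "0 \<le> c * (C * h\<^sup>2)" "0 \<le> c * (q\<^sup>2 * V y)"
        using c h lc_bounds(1)[OF xX] C Vy by auto
      have 2: "c * (q * V y) \<le> (h * Q) * (h * (\<beta> * K) * M)"
        using c q Vy \<beta> K h Q by (intro mult_mono mult_nonneg_nonneg) auto
      have 3: "q\<^sup>2 * V y \<le> (h * (\<beta> * K))\<^sup>2 * M"
        using q Vy by (intro mult_mono power_mono) auto
      have "V x \<le> h * b x + C0 * h\<^sup>2 + (1 - h * a x) * V y"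
        using 1 2 3 nn by (simp add: b_def a_def C0_def c_def q_def algebra_simps power2_eq_square)
      moreover have "C * h\<^sup>2 \<le> C0 * h\<^sup>2" using M \<beta> K Q by (intro mult_right_mono) (auto simp: C0_def)
      ultimately show "\<exists>y\<in>Y. norm (y - (x + h *\<^sub>R F x)) \<le> C0 * h\<^sup>2 \<and> V x \<le> h * b x + C0 * h\<^sup>2 + (1 - h * a x) * V y"
        using y(1,2) by (intro bexI[of _ y]) auto
    next
      show "enn2real N \<le> integral Y w" if "continuous_on Y w"
        "\<And>x. x \<in> Y \<Longrightarrow> V x \<le> w x \<and> 0 \<le> w x \<and> w x \<le> M + 1" for w
        using that by (rule N_real)
    qed
    also have "\<dots> \<le> integral Y (\<lambda>x. lc x + (M * \<rho>T x + 2 * e * M))"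
    proof (rule integral_le)
      have "continuous_on X \<kappa>"
        using \<kappa>p continuous_on_polymonial_function real_polynomial_function_eq by blast
      then show "b integrable_on Y" unfolding b_def by (intro int continuous_intros cont_lc)
      show "(\<lambda>x. lc x + (M * \<rho>T x + 2 * e * M)) integrable_on Y" by (intro int continuous_intros cont_lc cont)
      fix x assume "x \<in> Y"
      then have "M * \<kappa> x \<le> M * (\<rho>T x + 2 * e)" using \<kappa>(2) Y(3) M by (intro mult_left_mono) auto
      then show "b x \<le> lc x + (M * \<rho>T x + 2 * e * M)" by (simp add: b_def algebra_simps)
    qed
    also have "\<dots> = integral Y lc + (M * integral Y \<rho>T + 2 * e * M * measure lebesgue Y)"
    proof -
      have "(\<lambda>x. M * \<rho>T x) integrable_on Y" by (intro int continuous_intros cont)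
      then show ?thesis
        by (simp add: integral_add integrable_add int cont_lc ic Ic)
    qed
    finally show ?thesis by simp
  qed
  have "enn2real N \<le> integral Y lc + M * integral Y \<rho>T"
  proof (rule field_le_epsilon)
    fix e :: real assume e: "0 < e"
    define m where "m = 2 * (M * measure lebesgue Y) + 1"
    have m: "0 < m" using M by (simp add: m_def add_nonneg_pos)
    have "2 * (e / m) * (M * measure lebesgue Y) = (e / m) * (m - 1)" by (simp add: m_def)
    also have "\<dots> \<le> (e / m) * m" using e m by (intro mult_left_mono) auto
    also have "\<dots> = e" using m by simp
    finally show "enn2real N \<le> integral Y lc + M * integral Y \<rho>T + e"
      using main[of "e / m"] e m by simp
  qed
  also have "integral Y lc + M * integral Y \<rho>T = lp_objective lx lu X M \<rho> \<rho>T \<sigma>"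
  proof -
    have cp: "continuous_on X lx" "continuous_on X (lu i)" for i
      using poly(3,4) continuous_on_polymonial_function real_polynomial_function_eq by blast+
    have c\<sigma>: "continuous_on X (\<sigma> i)" for i using C1(2) by (simp add: C1_on_def)
    have c1: "continuous_on X (\<lambda>x. lx x * \<rho> x)" "continuous_on X (\<lambda>x. lu i x * \<sigma> i x)" for i
      by (intro continuous_intros cp c\<sigma> \<open>continuous_on X \<rho>\<close>)+
    have "integral Y lc = integral Y (\<lambda>x. lx x * \<rho> x + (\<Sum>i\<in>UNIV. lu i x * \<sigma> i x))"
      by (rule integral_cong) (use Y(3) rX sX in \<open>auto simp: lc_def\<close>)
    also have "\<dots> = integral Y (\<lambda>x. lx x * \<rho> x) + (\<Sum>i\<in>UNIV. integral Y (\<lambda>x. lu i x * \<sigma> i x))"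
      using int[OF c1(1)] int[OF c1(2)] by (simp add: integral_add integral_sum integrable_sum)
    finally show ?thesis
      unfolding lp_objective_def
      using set_integral_compact_eq_integral_interior(1)[OF X] c1 cont(2) by (simp add: Y_def)
  qed
  finally have "enn2real N \<le> lp_objective lx lu X M \<rho> \<rho>T \<sigma>" .
  moreover have "enn2ereal N = ereal (enn2real N)"
    using N_fin by (cases N) auto
  ultimately show ?thesis unfolding N_def by simp
qed

theorem theorem3:
  fixes f :: "real ^ 'n \<Rightarrow> real ^ 'n"
    and fu :: "'m::finite \<Rightarrow> real ^ 'n \<Rightarrow> real ^ 'n"
    and lx :: "real ^ 'n \<Rightarrow> real"
    and lu :: "'m \<Rightarrow> real ^ 'n \<Rightarrow> real"
    and g :: "nat \<Rightarrow> real ^ 'n \<Rightarrow> real"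
    and ng :: nat
    and X :: "(real ^ 'n) set"
    and U :: "(real ^ 'm) set"
    and ubar \<beta> M :: real
  assumes "polynomial_function f"
    and "\<And>i. polynomial_function (fu i)"
    and "real_polynomial_function lx"
    and "\<And>i. real_polynomial_function (lu i)"
    and "\<And>i. i \<in> {1..ng} \<Longrightarrow> real_polynomial_function (g i)"
    and "X = semialg_set ng g"
    and "U = control_set ubar"
    and "ubar > 0"
    and "compact X"
    and "\<exists>j\<in>{1..ng}. \<exists>N\<ge>0. \<forall>x. g j x = N - (norm x)\<^sup>2"
    and "\<And>x. x \<in> interior X \<Longrightarrow> (\<Prod>i\<in>{1..ng}. g i x) > 0"
    and "\<beta> > 0"
    and "\<And>x u. x \<in> X \<Longrightarrow> u \<in> U \<Longrightarrow> stage_cost lx lu x u \<ge> 0"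
    and "M > inverse \<beta> * (SUP (x, u)\<in>X \<times> U. stage_cost lx lu x u)"
  shows "lp_value f fu lx lu X ubar \<beta> M
    \<ge> enn2ereal (\<integral>\<^sup>+x\<in>X. ennreal (value_function f fu lx lu X U \<beta> M x) \<partial>lebesgue)"
  unfolding lp_value_def
proof (rule Inf_greatest)
  fix v assume "v \<in> {ereal (lp_objective lx lu X M \<rho> \<rho>T \<sigma>) | \<rho> \<rho>0 \<rho>T \<sigma>.
      lp_feasible f fu X ubar \<beta> \<rho> \<rho>0 \<rho>T \<sigma>}"
  then obtain \<rho> \<rho>0 \<rho>T \<sigma> where v: "v = ereal (lp_objective lx lu X M \<rho> \<rho>T \<sigma>)"
    and feas: "lp_feasible f fu X ubar \<beta> \<rho> \<rho>0 \<rho>T \<sigma>" by blast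
  show "enn2ereal (\<integral>\<^sup>+x\<in>X. ennreal (value_function f fu lx lu X U \<beta> M x) \<partial>lebesgue) \<le> v"
  \<comment> \<open>For empty \<open>X\<close> the supremum in the hypothesis on \<open>M\<close> is
    unspecified and gives no sign for \<open>M\<close>, but then all integrals vanish.\<close>
  proof (cases "X = {}")
    case True
    then show ?thesis by (simp add: v lp_objective_def set_lebesgue_integral_def zero_ennreal.rep_eq)
  next
    case False
    have stage: "stage_cost lx lu x u = lx x + (\<Sum>i\<in>UNIV. u $ i *\<^sub>R lu i x)" for x u
      by (simp add: stage_cost_def mult.commute)
    obtain B where B: "\<And>u x. u \<in> U \<Longrightarrow> x \<in> X \<Longrightarrow> \<bar>stage_cost lx lu x u\<bar> \<le> B"
      using affine_in_control_lipschitz_bounded[of lx lu, OF assms(3,4)[unfolded real_polynomial_function_eq]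
          compact_imp_bounded[OF assms(9)] less_imp_le[OF assms(8)]]
      unfolding stage assms(7) real_norm_def by blast
    define S where "S = (SUP (x, u)\<in>X \<times> U. stage_cost lx lu x u)"
    have "bdd_above ((\<lambda>(x, u). stage_cost lx lu x u) ` (X \<times> U))"
      using B by (intro bdd_aboveI[of _ B]) (auto simp: abs_le_iff)
    then have le_S: "stage_cost lx lu x u \<le> S" if "x \<in> X" "u \<in> U" for x u
      unfolding S_def using cSUP_upper[of "(x, u)" "X \<times> U" "\<lambda>(x, u). stage_cost lx lu x u"] that by simp
    have "0 \<in> U" using assms(7,8) by (simp add: control_set_def)
    \<comment> \<open>The control \<open>0\<close> is available at any point of \<open>X\<close>, so
      \<open>S\<close> dominates a nonnegative stage cost. With \<open>S < \<beta> * M\<close> this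
      makes \<open>M\<close> nonnegative.\<close>
    then have "0 \<le> S" using False assms(13) le_S by (meson ex_in_conv order_trans)
    have MS: "S < \<beta> * M" using assms(12,14) by (simp add: S_def field_simps)
    show ?thesis unfolding v
    proof (rule lp_objective_ge_value_integral[OF assms(1-4,9) _ assms(7,8,13) _ _ assms(12) feas])
      show "negligible (X - interior X)"
        unfolding assms(6) using assms(5) by (rule negligible_semialg_set_minus_interior)
      show "stage_cost lx lu x u \<le> \<beta> * M" if "x \<in> X" "u \<in> U" for x u
        using le_S[OF that] MS by simp
      show "0 \<le> M" using MS \<open>0 \<le> S\<close> assms(12) by (meson le_less_trans less_imp_le zero_less_mult_pos)
    qed
  qed
qed

end
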